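(* Let $\Gamma=\{a_1,\dots,a_\tau\}$ be a finite collection of translations, regarded as a variable $\mathbf a=(a_1,\dots,a_\tau)\in\mathbb R^{\tau d}$. Let $E^{\mathbf a}$ be the nonautonomous affine set in $\mathbb R^d$ whose translations are elements of $\Gamma$ (see context), generated by nonsingular matrices $T_{k,j}$ ($1\le j\le n_k$, $k\ge1$) with $\inf_{k,j}\alpha_d(T_{k,j})>0$, where $\alpha_d$ denotes the smallest singular value. Let $\mu^{\mathbf a}$ be a nonautonomous affine measure on $E^{\mathbf a}$, i.e. the image under $\Pi^{\mathbf a}$ of a Bernoulli measure $\mu$ on $\Sigma^\infty$. Suppose that $$\sup\{\|T_{k,j}\|:0<j\le n_k,\ k>0\}<\tfrac12.$$ Then for $1<q\le2$, $$\underline D_q(\mu^{\mathbf a})=\min\{d_q^-,d\}$$ for $\mathcal L^{\tau d}$-almost all $\mathbf a\in\mathbb R^{\tau d}$, where $$d_q^-=\sup\Big\{s:\sum_{k=1}^\infty\sum_{\mathbf u\in\Sigma^k}\psi^s(T_{\mathbf u})^{1-q}\mu(\mathcal C_{\mathbf u})^q<\infty\Big\}.$$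
   Context: **Words.** Let $\{n_k\}_{k\ge1}$ be integers $\ge2$; $\Sigma^k=\{u_1\cdots u_k:1\le u_j\le n_j\}$, $\Sigma^0=\{\emptyset\}$, $\Sigma^*=\bigcup_{k\ge0}\Sigma^k$, $\Sigma^\infty=\{u_1u_2\cdots:1\le u_k\le n_k\}$. $\mathcal C_{\mathbf u}\subset\Sigma^\infty$ is the cylinder of infinite words with prefix $\mathbf u$. **Nonautonomous affine set with translations in $\Gamma$.** To each nonempty word $\mathbf u\in\Sigma^*$ is assigned a translation $\omega_{\mathbf u}\in\Gamma$ (one of the variables $a_1,\dots,a_\tau$). For $\mathbf u=u_1\cdots u_k$ put $\Psi_{u_j}(x)=T_{j,u_j}x+\omega_{u_1\cdots u_j}$ and $J_{\mathbf u}=\Psi_{u_1}\circ\cdots\circ\Psi_{u_k}(J)$, $J_\emptyset=J$, where $J\subset\mathbb R^d$ is a compact set with non-empty interior such that $J_{\mathbf ui}\subset J_{\mathbf u}$ for all $\mathbf u$ and $i$, and $\max_{\mathbf u\in\Sigma^k}|J_{\mathbf u}|\to0$ as $k\to\infty$ ($|\cdot|$ of a set denoting diameter). Then $E^{\mathbf a}=\bigcap_{k\ge1}\bigcup_{\mathbf u\in\Sigma^k}J_{\mathbf u}$, and $\Pi^{\mathbf a}:\Sigma^\infty\to E^{\mathbf a}$ sends $\mathbf u=u_1u_2\cdots$ to the unique point of $\bigcap_kJ_{u_1\cdots u_k}$; equivalently $\Pi^{\mathbf a}(\mathbf u)=\omega_{u_1}+T_{1,u_1}\omega_{u_1u_2}+T_{1,u_1}T_{2,u_2}\omega_{u_1u_2u_3}+\cdots$.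 **Nonautonomous affine measure.** Given probability vectors $\mathbf p_k=(p_{k,1},\dots,p_{k,n_k})$, $\mu$ is the Bernoulli measure with $\mu(\mathcal C_{\mathbf u})=p_{1,u_1}\cdots p_{k,u_k}$ for $\mathbf u=u_1\cdots u_k$, and $\mu^{\mathbf a}(A)=\mu\{\mathbf u:\Pi^{\mathbf a}(\mathbf u)\in A\}$. **Generalized $q$-dimension.** Let $\mathcal M_r$ be the family of $r$-mesh cubes $[j_1r,(j_1+1)r)\times\cdots\times[j_dr,(j_d+1)r)$, $j_i\in\mathbb Z$. For a finite Borel measure $\nu$ on $\mathbb R^d$ and $q\ne1$, $\underline D_q(\nu)=\liminf_{r\to0}\frac{\log\sum_{Q\in\mathcal M_r}\nu(Q)^q}{(q-1)\log r}$. **Singular value function.** For a contracting nonsingular linear $T$ with singular values $1>\alpha_1(T)\ge\cdots\ge\alpha_d(T)>0$: $\psi^s(T)=\alpha_1(T)\cdots\alpha_{m-1}(T)\alpha_m(T)^{s-m+1}$ for $0<s\le d$, where $m$ is the integer with $m-1<s\le m$; $\psi^0(T)=1$; and $\psi^s(T)=(\alpha_1(T)\cdots\alpha_d(T))^{s/d}$ for $s>d$. For $\mathbf u=u_1\cdots u_k$, $T_{\mathbf u}=T_{1,u_1}\cdots T_{k,u_k}$. In the supremum, $s$ ranges over $s>0$, with $\sup\emptyset=0$. $\mathcal L^{\tau d}$ is Lebesgue measure on $\mathbb R^{\tau d}$.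
   Formalization: Added hypothesis: words with the same parent carry different translation variables (ω_{ui} ≠ ω_{uj} for i ≠ j); without it the claim fails, e.g. d=τ=1, n_k=2, all T_{k,j}=1/3, p=1/2, q=2 gives a Dirac mass while d_q^- = log 2/log 3. *)

theory Defs
  imports "HOL-Probability.Probability"
begin

section \<open>Words and the Bernoulli measure\<close>

text \<open>Levels \<open>k\<close> and letters are numbered from \<open>1\<close>, so the letter of a finite word \<open>u\<close> at level
  \<open>j\<close> is \<open>u ! (j - 1)\<close>; an infinite word is an extensional function on \<open>{1..}\<close>.\<close>

definition words :: "(nat \<Rightarrow> nat) \<Rightarrow> nat \<Rightarrow> nat list set" where
  "words n k = {u. length u = k \<and> (\<forall>j\<in>{1..k}. u ! (j - 1) \<in> {1..n j})}"

definition inf_words :: "(nat \<Rightarrow> nat) \<Rightarrow> (nat \<Rightarrow> nat) set" where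
  "inf_words n = (\<Pi>\<^sub>E k\<in>{1..}. {1..n k})"

definition prefix_of :: "(nat \<Rightarrow> nat) \<Rightarrow> nat \<Rightarrow> nat list" where
  "prefix_of x k = map x [1..<Suc k]"

definition cylinder :: "(nat \<Rightarrow> nat) \<Rightarrow> nat list \<Rightarrow> (nat \<Rightarrow> nat) set" where
  "cylinder n u = {x \<in> inf_words n. prefix_of x (length u) = u}"

definition prob_vectors :: "(nat \<Rightarrow> nat) \<Rightarrow> (nat \<Rightarrow> nat \<Rightarrow> real) \<Rightarrow> bool" where
  "prob_vectors n p \<longleftrightarrow> (\<forall>k\<ge>1. (\<forall>i\<in>{1..n k}. 0 \<le> p k i) \<and> (\<Sum>i = 1..n k. p k i) = 1)"

definition bernoulli_measure :: "(nat \<Rightarrow> nat) \<Rightarrow> (nat \<Rightarrow> nat \<Rightarrow> real) \<Rightarrow> (nat \<Rightarrow> nat) measure" where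
  "bernoulli_measure n p = PiM {1..} (\<lambda>k. point_measure {1..n k} (\<lambda>i. ennreal (p k i)))"

lemma space_bernoulli_measure: "space (bernoulli_measure n p) = inf_words n"
  by (simp add: bernoulli_measure_def space_PiM space_point_measure inf_words_def)

lemma measure_bernoulli_cylinder:
  assumes p: "prob_vectors n p" and u: "u \<in> words n k"
  shows "measure (bernoulli_measure n p) (cylinder n u) = (\<Prod>j = 1..k. p j (u ! (j - 1)))"
proof -
  define M where "M = (\<lambda>j. if j = 0 then return (count_space UNIV) (0::nat)
      else point_measure {1..n j} (\<lambda>i. ennreal (p j i)))"
  have PM: "prob_space (M j)" for j
  proof (cases "j = 0")
    case True
    then show ?thesis by (simp add: M_def prob_space_return)
  next
    case False
    have "prob_space (point_measure {1..n j} (\<lambda>i. ennreal (p j i)))"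
    proof (rule prob_spaceI)
      have *: "\<forall>i\<in>{1..n j}. 0 \<le> p j i" "(\<Sum>i = 1..n j. p j i) = 1"
        using p False by (auto simp: prob_vectors_def)
      then have "(\<Sum>i = 1..n j. ennreal (p j i)) = 1"
        by (subst sum_ennreal) auto
      then show "emeasure (point_measure {1..n j} (\<lambda>i. ennreal (p j i)))
          (space (point_measure {1..n j} (\<lambda>i. ennreal (p j i)))) = 1"
        by (simp add: space_point_measure emeasure_point_measure_finite)
    qed
    with False show ?thesis by (simp add: M_def)
  qed
  interpret product_prob_space M "{1..}"
    by (simp add: product_prob_space_def product_prob_space_axioms_def product_sigma_finite_def PM
        prob_space_imp_sigma_finite)
  have eq: "bernoulli_measure n p = PiM {1..} M"
    unfolding bernoulli_measure_def by (rule PiM_cong) (auto simp: M_def)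
  have len: "length u = k" and uj: "\<And>j. j \<in> {1..k} \<Longrightarrow> u ! (j - 1) \<in> {1..n j}"
    using u by (auto simp: words_def)
  have pre: "prefix_of x k = u \<longleftrightarrow> (\<forall>j\<in>{1..k}. x j \<in> {u ! (j - 1)})" for x
  proof
    assume "prefix_of x k = u"
    then show "\<forall>j\<in>{1..k}. x j \<in> {u ! (j - 1)}"
      by (auto simp: prefix_of_def simp del: upt_Suc)
  next
    assume *: "\<forall>j\<in>{1..k}. x j \<in> {u ! (j - 1)}"
    show "prefix_of x k = u"
      by (rule nth_equalityI) (use * len in \<open>auto simp: prefix_of_def simp del: upt_Suc\<close>)
  qed
  have cyl: "cylinder n u = {x \<in> space (PiM {1..} M). \<forall>j\<in>{1..k}. x j \<in> {u ! (j - 1)}}"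
    unfolding cylinder_def len pre using eq space_bernoulli_measure[of n p] by simp
  have "emeasure (PiM {1..} M) (cylinder n u) = (\<Prod>j\<in>{1..k}. emeasure (M j) {u ! (j - 1)})"
    unfolding cyl by (rule emeasure_PiM_Collect) (use uj in \<open>auto simp: M_def sets_point_measure\<close>)
  also have "\<dots> = (\<Prod>j\<in>{1..k}. ennreal (p j (u ! (j - 1))))"
  proof (rule prod.cong)
    fix j assume j: "j \<in> {1..k}"
    then show "emeasure (M j) {u ! (j - 1)} = ennreal (p j (u ! (j - 1)))"
      using uj[OF j] by (simp add: M_def emeasure_point_measure_finite)
  qed simp
  also have "\<dots> = ennreal (\<Prod>j\<in>{1..k}. p j (u ! (j - 1)))"
    by (rule prod_ennreal) (use p uj in \<open>auto simp: prob_vectors_def\<close>)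
  finally have "measure (PiM {1..} M) (cylinder n u) = enn2real (ennreal (\<Prod>j\<in>{1..k}. p j (u ! (j - 1))))"
    by (simp only: measure_def)
  moreover have "0 \<le> (\<Prod>j\<in>{1..k}. p j (u ! (j - 1)))"
    by (rule prod_nonneg) (use p uj in \<open>auto simp: prob_vectors_def\<close>)
  ultimately show ?thesis
    unfolding eq by (simp only: enn2real_ennreal)
qed


section \<open>Nonautonomous affine sets and measures\<close>

text \<open>The word \<open>u\<close> is assigned the translation with index \<open>\<omega> u\<close>, that is \<open>a $ \<omega> u\<close>, where \<open>a\<close> is the
  vector of all translation variables. Only nonempty words matter.\<close>

definition affine_step :: "(nat \<Rightarrow> nat \<Rightarrow> real^'d^'d) \<Rightarrow> (nat list \<Rightarrow> 't) \<Rightarrow> real^'d^'t \<Rightarrow>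
    nat list \<Rightarrow> nat \<Rightarrow> real^'d \<Rightarrow> real^'d" where
  "affine_step T \<omega> a u j x = T j (u ! (j - 1)) *v x + a $ \<omega> (take j u)"

definition word_map :: "(nat \<Rightarrow> nat \<Rightarrow> real^'d^'d) \<Rightarrow> (nat list \<Rightarrow> 't) \<Rightarrow> real^'d^'t \<Rightarrow>
    nat list \<Rightarrow> real^'d \<Rightarrow> real^'d" where
  "word_map T \<omega> a u = foldr (\<lambda>j f. affine_step T \<omega> a u j \<circ> f) [1..<Suc (length u)] id"

definition basic_set :: "(nat \<Rightarrow> nat \<Rightarrow> real^'d^'d) \<Rightarrow> (nat list \<Rightarrow> 't) \<Rightarrow> real^'d^'t \<Rightarrow>
    (real^'d) set \<Rightarrow> nat list \<Rightarrow> (real^'d) set" where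
  "basic_set T \<omega> a J u = word_map T \<omega> a u ` J"

definition nonaut_affine :: "(nat \<Rightarrow> nat) \<Rightarrow> (nat \<Rightarrow> nat \<Rightarrow> real^'d^'d) \<Rightarrow> (nat list \<Rightarrow> 't) \<Rightarrow>
    real^'d^'t \<Rightarrow> (real^'d) set \<Rightarrow> bool" where
  "nonaut_affine n T \<omega> a J \<longleftrightarrow>
     compact J \<and> interior J \<noteq> {} \<and>
     (\<forall>k. \<forall>u\<in>words n k. \<forall>i\<in>{1..n (Suc k)}. basic_set T \<omega> a J (u @ [i]) \<subseteq> basic_set T \<omega> a J u) \<and>
     (\<lambda>k. Max ((\<lambda>u. diameter (basic_set T \<omega> a J u)) ` words n k)) \<longlonglongrightarrow> 0"

definition nonaut_affine_set :: "(nat \<Rightarrow> nat) \<Rightarrow> (nat \<Rightarrow> nat \<Rightarrow> real^'d^'d) \<Rightarrow>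
    (nat list \<Rightarrow> 't) \<Rightarrow> real^'d^'t \<Rightarrow> (real^'d) set \<Rightarrow> (real^'d) set" where
  "nonaut_affine_set n T \<omega> a J = (\<Inter>k\<in>{1..}. \<Union>u\<in>words n k. basic_set T \<omega> a J u)"

definition coding_map :: "(nat \<Rightarrow> nat \<Rightarrow> real^'d^'d) \<Rightarrow> (nat list \<Rightarrow> 't) \<Rightarrow> real^'d^'t \<Rightarrow>
    (real^'d) set \<Rightarrow> (nat \<Rightarrow> nat) \<Rightarrow> real^'d" where
  "coding_map T \<omega> a J x = (THE y. y \<in> (\<Inter>k\<in>{1..}. basic_set T \<omega> a J (prefix_of x k)))"

text \<open>As a measure on all of \<open>\<real>\<^sup>d\<close>; it is carried by the nonautonomous affine set.\<close>

definition nonaut_affine_measure :: "(nat \<Rightarrow> nat) \<Rightarrow> (nat \<Rightarrow> nat \<Rightarrow> real^'d^'d) \<Rightarrow>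
    (nat list \<Rightarrow> 't) \<Rightarrow> real^'d^'t \<Rightarrow> (real^'d) set \<Rightarrow> (nat \<Rightarrow> nat \<Rightarrow> real) \<Rightarrow> (real^'d) measure" where
  "nonaut_affine_measure n T \<omega> a J p = distr (bernoulli_measure n p) borel (coding_map T \<omega> a J)"

text \<open>Sibling words carry different translation variables. This is what makes the projections of
  distinct infinite words move independently: if all words carried the same variable and the
  matrices were equal on each level, the affine set would be a single point.\<close>

definition distinct_siblings :: "(nat \<Rightarrow> nat) \<Rightarrow> (nat list \<Rightarrow> 't) \<Rightarrow> bool" where
  "distinct_siblings n \<omega> \<longleftrightarrow>
     (\<forall>k. \<forall>u\<in>words n k. \<forall>i\<in>{1..n (Suc k)}. \<forall>j\<in>{1..n (Suc k)}.
        i \<noteq> j \<longrightarrow> \<omega> (u @ [i]) \<noteq> \<omega> (u @ [j]))"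

lemma prefix_of_Suc: "prefix_of x (Suc k) = prefix_of x k @ [x (Suc k)]"
  by (simp add: prefix_of_def)

lemma prefix_of_words: "x \<in> inf_words n \<Longrightarrow> prefix_of x k \<in> words n k"
  by (auto simp: prefix_of_def words_def inf_words_def PiE_iff simp del: upt_Suc)

lemma finite_words: "finite (words n k)"
proof (rule finite_subset)
  show "words n k \<subseteq> {u. set u \<subseteq> (\<Union>j\<in>{1..k}. {1..n j}) \<and> length u = k}"
  proof (intro subsetI CollectI conjI)
    fix u y assume u: "u \<in> words n k" and "y \<in> set u"
    then obtain i where i: "i < k" "y = u ! i" by (auto simp: in_set_conv_nth words_def)
    have "Suc i \<in> {1..k}" using i by simp
    moreover from this have "u ! (Suc i - 1) \<in> {1..n (Suc i)}"
      using u unfolding words_def by blast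
    then have "y \<in> {1..n (Suc i)}" using i by simp
    ultimately show "y \<in> (\<Union>j\<in>{1..k}. {1..n j})" by blast
  qed (simp add: words_def)
  show "finite {u. set u \<subseteq> (\<Union>j\<in>{1..k}. {1..n j}) \<and> length u = k}"
    by (rule finite_lists_length_eq) auto
qed

lemma compact_basic_set: "compact J \<Longrightarrow> compact (basic_set T \<omega> a J u)"
proof -
  have "continuous_on UNIV (foldr (\<lambda>j f. affine_step T \<omega> a u j \<circ> f) js id)" for js
  proof (induction js)
    case (Cons j js)
    have "continuous_on A (affine_step T \<omega> a u j)" for A
      unfolding affine_step_def[abs_def]
      by (intro continuous_intros linear_continuous_on matrix_vector_mul_bounded_linear)
    from continuous_on_compose[OF Cons.IH this] show ?case by (simp add: o_def)
  qed (simp add: id_def)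
  then show "compact J \<Longrightarrow> compact (basic_set T \<omega> a J u)"
    unfolding basic_set_def word_map_def
    using compact_continuous_image continuous_on_subset by (metis top_greatest)
qed

lemma coding_map_unique:
  assumes J: "nonaut_affine n T \<omega> a J" and x: "x \<in> inf_words n"
  shows "\<exists>!y. y \<in> (\<Inter>k\<in>{1..}. basic_set T \<omega> a J (prefix_of x k))"
proof -
  define S where "S = (\<lambda>k. basic_set T \<omega> a J (prefix_of x k))"
  have cS: "compact (S k)" for k
    using J by (auto simp: S_def nonaut_affine_def intro: compact_basic_set)
  have step: "S (Suc k) \<subseteq> S k" for k
    using J prefix_of_words[OF x, of k] x
    by (auto simp: S_def nonaut_affine_def prefix_of_Suc inf_words_def PiE_iff)
  have "\<exists>y. \<Inter>(range S) = {y}"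
  proof (rule decreasing_closed_nest_sing)
    show "closed (S k)" for k using cS compact_imp_closed by blast
    show "S k \<noteq> {}" for k using J by (auto simp: S_def basic_set_def nonaut_affine_def)
    show "m \<le> k \<Longrightarrow> S k \<subseteq> S m" for m k by (rule lift_Suc_antimono_le[of S, OF step])
    fix e :: real assume "e > 0"
    then have "\<forall>\<^sub>F k in sequentially. Max ((\<lambda>u. diameter (basic_set T \<omega> a J u)) ` words n k) < e"
      using J unfolding nonaut_affine_def by (auto intro: order_tendstoD)
    then obtain k where k: "Max ((\<lambda>u. diameter (basic_set T \<omega> a J u)) ` words n k) < e"
      by (auto simp: eventually_sequentially)
    have "diameter (S k) \<le> Max ((\<lambda>u. diameter (basic_set T \<omega> a J u)) ` words n k)"
      unfolding S_def by (rule Max_ge) (auto simp: finite_words prefix_of_words[OF x])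
    with k have "diameter (S k) < e" by simp
    then show "\<exists>k. \<forall>y\<in>S k. \<forall>z\<in>S k. dist y z < e"
      using diameter_bounded_bound[OF compact_imp_bounded[OF cS]] by (meson order_le_less_trans)
  qed
  moreover have "\<Inter>(range S) = (\<Inter>k\<in>{1..}. S k)"
  proof -
    have "y \<in> S k" if "\<forall>k\<in>{1..}. y \<in> S k" for y k
      using that step[of 0] by (cases k) auto
    then show ?thesis by auto
  qed
  ultimately obtain y where "(\<Inter>k\<in>{1..}. S k) = {y}" by auto
  then show ?thesis unfolding S_def by (simp only:) blast
qed

lemma coding_map_in_nonaut_affine_set:
  assumes "nonaut_affine n T \<omega> a J" and "x \<in> inf_words n"
  shows "coding_map T \<omega> a J x \<in> nonaut_affine_set n T \<omega> a J"
  using theI'[OF coding_map_unique[OF assms]] prefix_of_words[OF assms(2)]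
  unfolding coding_map_def nonaut_affine_set_def by blast


section \<open>Generalized dimension\<close>

definition mesh_cube :: "real \<Rightarrow> ('d::finite \<Rightarrow> int) \<Rightarrow> (real^'d) set" where
  "mesh_cube r j = {x. \<forall>i. of_int (j i) * r \<le> x $ i \<and> x $ i < (of_int (j i) + 1) * r}"

definition mesh_cubes :: "real \<Rightarrow> (real^'d::finite) set set" where
  "mesh_cubes r = range (mesh_cube r)"

text \<open>For a finite measure and \<open>q > 1\<close>, the sum over the mesh always converges, being at most
  \<open>\<nu>(\<real>\<^sup>d)\<^sup>q\<close>; for \<open>q < 1\<close> the definition is meaningful for boundedly supported measures.\<close>

definition lower_gen_dim :: "real \<Rightarrow> (real^'d::finite) measure \<Rightarrow> ereal" where
  "lower_gen_dim q \<nu> =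
     Liminf (at_right 0)
       (\<lambda>r. ereal (ln (\<Sum>\<^sub>\<infinity>Q\<in>mesh_cubes r. measure \<nu> Q powr q) / ((q - 1) * ln r)))"


section \<open>Singular value function and the critical exponent\<close>

text \<open>The singular values are the nonnegative square roots of the eigenvalues of the symmetric
  matrix \<open>A\<^sup>T A\<close>, repeated according to multiplicity, which for a symmetric matrix is the dimension
  of the eigenspace.\<close>

definition sv_space :: "real^'d^'d \<Rightarrow> real \<Rightarrow> (real^'d) set" where
  "sv_space A \<sigma> = {x. (transpose A ** A) *v x = \<sigma>\<^sup>2 *\<^sub>R x}"

definition singular_values :: "real^'d^'d \<Rightarrow> real multiset" where
  "singular_values A =
     (\<Sum>\<sigma> | 0 \<le> \<sigma> \<and> sv_space A \<sigma> \<noteq> {0}. replicate_mset (dim (sv_space A \<sigma>)) \<sigma>)"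

text \<open>In decreasing order, for indices \<open>1, \<dots>, d\<close>:\<close>

definition singular_value :: "nat \<Rightarrow> real^'d^'d \<Rightarrow> real" where
  "singular_value i A = rev (sorted_list_of_multiset (singular_values A)) ! (i - 1)"

text \<open>Used for \<open>s \<ge> 0\<close> only.\<close>

definition sv_fun :: "real \<Rightarrow> real^'d^'d \<Rightarrow> real" where
  "sv_fun s A =
     (if s = 0 then 1
      else if s \<le> real CARD('d) then
        let m = nat \<lceil>s\<rceil>
        in (\<Prod>i = 1..m - 1. singular_value i A) * singular_value m A powr (s - real m + 1)
      else (\<Prod>i = 1..CARD('d). singular_value i A) powr (s / real CARD('d)))"

definition word_matrix :: "(nat \<Rightarrow> nat \<Rightarrow> real^'d^'d) \<Rightarrow> nat list \<Rightarrow> real^'d^'d" where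
  "word_matrix T u = foldr (\<lambda>j A. T j (u ! (j - 1)) ** A) [1..<Suc (length u)] (mat 1)"

definition crit_set :: "(nat \<Rightarrow> nat) \<Rightarrow> (nat \<Rightarrow> nat \<Rightarrow> real^'d^'d) \<Rightarrow>
    (nat \<Rightarrow> nat) measure \<Rightarrow> real \<Rightarrow> real set" where
  "crit_set n T \<mu> q =
     {s. 0 < s \<and>
         (\<lambda>k. \<Sum>u\<in>words n k. sv_fun s (word_matrix T u) powr (1 - q) * measure \<mu> (cylinder n u) powr q)
           summable_on {1..}}"

definition crit_exp :: "(nat \<Rightarrow> nat) \<Rightarrow> (nat \<Rightarrow> nat \<Rightarrow> real^'d^'d) \<Rightarrow>
    (nat \<Rightarrow> nat) measure \<Rightarrow> real \<Rightarrow> ereal" where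
  "crit_exp n T \<mu> q = (if crit_set n T \<mu> q = {} then 0 else (SUP s\<in>crit_set n T \<mu> q. ereal s))"

end

theory Submission
  imports Defs
begin

text \<open>
  The projection \<open>\<Pi>\<^sup>a\<close> is linear in \<open>a\<close>. If \<open>x\<close> and \<open>y\<close> first differ after the word \<open>u\<close>, then
  \<open>\<Pi>\<^sup>a x - \<Pi>\<^sup>a y = T\<^sub>u (L a)\<close>, where \<open>L\<close> restricted to one of the two translation variables involved is, up to
  sign, a perturbation of the identity of norm at most \<open>\<rho> / (1 - \<rho>) < 1\<close>. Hence the set of \<open>a\<close> in a ball with
  \<open>\<bar>\<Pi>\<^sup>a x - \<Pi>\<^sup>a y\<bar> \<le> r\<close> has volume at most \<open>C r\<^sup>s / \<psi>\<^sup>s(T\<^sub>u)\<close>. Since \<open>0 < q - 1 \<le> 1\<close>, the map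
  \<open>t \<mapsto> t powr (q - 1)\<close> is subadditive and concave, so that integrating \<open>\<mu>\<^sup>a(B(\<Pi>\<^sup>a x, r)) powr (q - 1)\<close> over
  \<open>x\<close> and \<open>a\<close> gives at most \<open>C r powr (s (q - 1))\<close> times the series defining \<open>d\<^sub>q\<^sup>-\<close>; summing over
  dyadic \<open>r\<close> yields the lower bound for almost all \<open>a\<close>.

  The upper bound holds for every \<open>a\<close>. Let \<open>m\<close> be the least integer with \<open>s \<le> m\<close>. For a word \<open>u\<close> with
  \<open>\<alpha>\<^sub>m(T\<^sub>u) \<approx> r\<close>, the set \<open>J\<^sub>u\<close> meets at most \<open>C \<alpha>\<^sub>1 \<cdots> \<alpha>\<^sub>m\<^sub>-\<^sub>1 / r\<^bsup>m-1\<^esup>\<close> mesh cubes, so by the power mean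
  inequality these words contribute at least a multiple of \<open>r powr (s (q - 1))\<close> times their part of the series to the
  mesh sum. As \<open>\<alpha>\<^sub>m(T\<^sub>u) \<le> 2\<^bsup>-k\<^esup>\<close> for words of length \<open>k\<close>, only the scales \<open>r = 2\<^bsup>-j\<^esup>\<close> with \<open>j \<ge> k\<close>
  occur, and a dimension larger than \<open>s\<close> would force the series to converge.
\<close>


section \<open>Singular values\<close>

lemma symmetric_eigenvector_exists:
  fixes f :: "'a::euclidean_space \<Rightarrow> 'a"
  assumes f: "linear f" and sym: "\<And>x y. f x \<bullet> y = x \<bullet> f y"
    and S: "subspace S" "S \<noteq> {0}" and inv: "f ` S \<subseteq> S"
  obtains v l where "v \<in> S" "norm v = 1" "f v = l *\<^sub>R v"
proof -
  define K where "K = S \<inter> sphere 0 1"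
  have "compact K" unfolding K_def
    by (intro closed_Int_compact closed_subspace S compact_sphere)
  obtain s where s: "s \<in> S" "s \<noteq> 0" using S subspace_0 by blast
  have "(1 / norm s) *\<^sub>R s \<in> K" using s S by (auto simp: K_def subspace_scale)
  then have "K \<noteq> {}" by auto
  moreover have "continuous_on K (\<lambda>x. x \<bullet> f x)"
    by (intro continuous_intros linear_continuous_on linear_conv_bounded_linear[THEN iffD1] f)
  ultimately obtain v where v: "v \<in> K" "\<And>x. x \<in> K \<Longrightarrow> x \<bullet> f x \<le> v \<bullet> f v"
    using continuous_attains_sup[OF \<open>compact K\<close>] by blast
  define l where "l = v \<bullet> f v"
  have vS: "v \<in> S" "norm v = 1" using v by (auto simp: K_def)
  have vv: "v \<bullet> v = 1" using vS by (simp add: dot_square_norm)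
  have le: "x \<bullet> f x \<le> l * (x \<bullet> x)" if "x \<in> S" for x
  proof (cases "x = 0")
    case False
    have "((1 / norm x) *\<^sub>R x) \<bullet> f ((1 / norm x) *\<^sub>R x) \<le> l"
      unfolding l_def by (rule v) (use that False S in \<open>auto simp: K_def subspace_scale\<close>)
    then have "(x \<bullet> f x) / (norm x)^2 \<le> l"
      using f by (simp add: linear_cmul power2_eq_square)
    then show ?thesis using False by (simp add: divide_le_eq dot_square_norm)
  qed simp
  have orth: "w \<bullet> (f v - l *\<^sub>R v) = 0" if w: "w \<in> S" for w
  proof (rule ccontr)
    define c where "c = w \<bullet> (f v - l *\<^sub>R v)"
    define e where "e = l * (w \<bullet> w) - w \<bullet> f w"
    assume "w \<bullet> (f v - l *\<^sub>R v) \<noteq> 0"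
    then have c: "c \<noteq> 0" by (simp add: c_def)
    have ineq: "2 * t * c \<le> t^2 * e" for t
    proof -
      have "(v + t *\<^sub>R w) \<bullet> f (v + t *\<^sub>R w) \<le> l * ((v + t *\<^sub>R w) \<bullet> (v + t *\<^sub>R w))"
        by (rule le) (use vS w S in \<open>auto simp: subspace_add subspace_scale\<close>)
      moreover have "v \<bullet> f w = w \<bullet> f v" by (simp add: sym inner_commute flip: sym[of w v])
      ultimately show ?thesis
        using f vv unfolding c_def e_def l_def
        by (simp add: linear_add linear_cmul inner_simps power2_eq_square inner_commute algebra_simps)
    qed
    define t where "t = c / (\<bar>e\<bar> + 1)"
    have "2 * t * c * (\<bar>e\<bar> + 1)\<^sup>2 \<le> t^2 * e * (\<bar>e\<bar> + 1)\<^sup>2"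
      by (rule mult_right_mono[OF ineq]) simp
    moreover have tc: "t * (\<bar>e\<bar> + 1) = c" by (simp add: t_def)
    have "2 * t * c * (\<bar>e\<bar> + 1)\<^sup>2 = 2 * c * (t * (\<bar>e\<bar> + 1)) * (\<bar>e\<bar> + 1)"
      "t^2 * e * (\<bar>e\<bar> + 1)\<^sup>2 = (t * (\<bar>e\<bar> + 1))\<^sup>2 * e"
      by (simp_all add: power2_eq_square)
    ultimately have "2 * c * c * (\<bar>e\<bar> + 1) \<le> c^2 * e" by (simp only: tc)
    then have "2 * c^2 * (\<bar>e\<bar> + 1) \<le> c^2 * e" by (simp add: power2_eq_square mult.assoc)
    then have "2 * (\<bar>e\<bar> + 1) \<le> e" using c by (simp add: mult.commute mult.left_commute)
    then show False by (simp add: abs_if split: if_splits)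
  qed
  have "f v - l *\<^sub>R v \<in> S" using inv vS S by (auto intro!: subspace_diff subspace_scale)
  from orth[OF this] have "f v = l *\<^sub>R v" by simp
  with vS show ?thesis by (rule that)
qed

lemma symmetric_eigenbasis:
  fixes f :: "'a::euclidean_space \<Rightarrow> 'a"
  assumes f: "linear f" and sym: "\<And>x y. f x \<bullet> y = x \<bullet> f y"
    and "subspace S" and "f ` S \<subseteq> S"
  shows "\<exists>B. B \<subseteq> S \<and> pairwise orthogonal B \<and> (\<forall>b\<in>B. norm b = 1 \<and> (\<exists>l. f b = l *\<^sub>R b)) \<and> span B = S"
  using assms(3,4)
proof (induction "dim S" arbitrary: S rule: less_induct)
  case (less S)
  show ?case
  proof (cases "S = {0}")
    case True
    then show ?thesis by (intro exI[of _ "{}"]) auto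
  next
    case False
    obtain v l where v: "v \<in> S" "norm v = 1" "f v = l *\<^sub>R v"
      using symmetric_eigenvector_exists[OF f sym less.prems(1) False less.prems(2)] by blast
    have vv: "v \<bullet> v = 1" using v by (simp add: dot_square_norm)
    define S' where "S' = {x \<in> S. v \<bullet> x = 0}"
    have sub: "subspace S'" using less.prems(1)
      by (auto simp: S'_def subspace_def inner_simps)
    have "v \<notin> S'" using vv by (simp add: S'_def)
    moreover have "S' \<subseteq> S" by (auto simp: S'_def)
    ultimately have "S' \<subset> S" using v by blast
    then have "dim S' < dim S"
      using dim_psubset[of S' S] less.prems(1) sub by (simp add: span_eq_iff[THEN iffD2])
    moreover have "f ` S' \<subseteq> S'"
      using less.prems(2) v by (auto simp: S'_def simp flip: sym)
    ultimately obtain B where B: "B \<subseteq> S'" "pairwise orthogonal B"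
      "\<forall>b\<in>B. norm b = 1 \<and> (\<exists>l. f b = l *\<^sub>R b)" "span B = S'"
      using less.hyps[OF _ sub] by blast
    have "span (insert v B) = S"
    proof
      show "span (insert v B) \<subseteq> S"
        using B v less.prems(1) by (intro span_minimal) (auto simp: S'_def)
      show "S \<subseteq> span (insert v B)"
      proof
        fix x assume x: "x \<in> S"
        have "x - (v \<bullet> x) *\<^sub>R v \<in> S'"
          using x v vv less.prems(1) by (auto simp: S'_def inner_simps subspace_diff subspace_scale)
        then show "x \<in> span (insert v B)"
          unfolding span_insert B(4)[symmetric] by blast
      qed
    qed
    moreover have "pairwise orthogonal (insert v B)"
      using B by (auto simp: pairwise_insert S'_def orthogonal_def inner_commute)
    ultimately show ?thesis
      using B v by (intro exI[of _ "insert v B"]) (auto simp: S'_def)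
  qed
qed

lemma gram_matrix_inner:
  fixes A :: "real^'d^'d"
  shows "((transpose A ** A) *v x) \<bullet> y = (A *v x) \<bullet> (A *v y)"
proof -
  have "(transpose A ** A) *v x = (A *v x) v* A"
    by (simp flip: matrix_vector_mul_assoc)
  then show ?thesis by (simp only: dot_lmul_matrix)
qed

lemma gram_eigenbasis:
  fixes A :: "real^'d^'d"
  shows "\<exists>B. finite B \<and> card B = CARD('d) \<and> pairwise orthogonal B \<and> (\<forall>b\<in>B. norm b = 1) \<and>
    (\<forall>b\<in>B. (transpose A ** A) *v b = (norm (A *v b))\<^sup>2 *\<^sub>R b) \<and> span B = UNIV \<and> independent B"
proof -
  obtain B where B: "pairwise orthogonal B" "\<forall>b\<in>B. norm b = 1 \<and> (\<exists>l. (transpose A ** A) *v b = l *\<^sub>R b)"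
     "span B = UNIV"
  proof -
    have "(transpose A ** A *v x) \<bullet> y = x \<bullet> (transpose A ** A *v y)" for x y
      using gram_matrix_inner[of A x y] gram_matrix_inner[of A y x] by (simp add: inner_commute)
    with symmetric_eigenbasis[of "(*v) (transpose A ** A)" UNIV]
    have "\<exists>B. B \<subseteq> UNIV \<and> pairwise orthogonal B \<and>
        (\<forall>b\<in>B. norm b = 1 \<and> (\<exists>l. (transpose A ** A) *v b = l *\<^sub>R b)) \<and> span B = UNIV"
      by (simp only: matrix_vector_mul_linear subspace_UNIV subset_UNIV simp_thms)
    then show thesis using that by (elim exE conjE)
  qed
  have "0 \<notin> B" using B(2) by force
  with B(1) have ind: "independent B" by (rule pairwise_orthogonal_independent)
  have "(transpose A ** A) *v b = (norm (A *v b))\<^sup>2 *\<^sub>R b" if b: "b \<in> B" for b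
  proof -
    obtain l where l: "(transpose A ** A) *v b = l *\<^sub>R b" using bspec[OF B(2) b] by (elim conjE exE)
    have "l = ((transpose A ** A) *v b) \<bullet> b" using bspec[OF B(2) b] unfolding l by (simp add: dot_square_norm)
    then have "l = (norm (A *v b))\<^sup>2" by (simp only: gram_matrix_inner dot_square_norm)
    then show ?thesis using l by simp
  qed
  moreover have "card B = CARD('d)"
    using dim_eq_card[OF _ ind, of UNIV] B(3) by simp
  moreover have "finite B" using ind by (rule independent_imp_finite)
  ultimately show ?thesis using B ind by (intro exI[of _ B]) simp
qed

lemma singular_values_gram_eigenbasis:
  fixes A :: "real^'d^'d"
  assumes B: "finite B" "pairwise orthogonal B" "\<forall>b\<in>B. norm b = 1"
    "\<forall>b\<in>B. (transpose A ** A) *v b = (norm (A *v b))\<^sup>2 *\<^sub>R b" "span B = UNIV" "independent B"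
  shows "singular_values A = image_mset (\<lambda>b. norm (A *v b)) (mset_set B)"
proof -
  have sp: "sv_space A s = span {b \<in> B. norm (A *v b) = s}" if s: "s \<ge> 0" for s
  proof
    have "subspace (sv_space A s)"
      by (auto simp: sv_space_def subspace_def matrix_vector_right_distrib scaleR_add_right
          matrix_vector_mult_scaleR)
    moreover have "{b \<in> B. norm (A *v b) = s} \<subseteq> sv_space A s" using B by (auto simp: sv_space_def)
    ultimately show "span {b \<in> B. norm (A *v b) = s} \<subseteq> sv_space A s" by (rule span_minimal[rotated])
    show "sv_space A s \<subseteq> span {b \<in> B. norm (A *v b) = s}"
    proof
      fix x assume "x \<in> sv_space A s"
      then have x: "(transpose A ** A) *v x = s\<^sup>2 *\<^sub>R x" by (simp add: sv_space_def)
      have expand: "x = (\<Sum>b\<in>B. (b \<bullet> x) *\<^sub>R b)"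
      proof -
        have "x - (\<Sum>b\<in>B. (b \<bullet> x / (b \<bullet> b)) *\<^sub>R b) = 0"
        proof -
          let ?y = "x - (\<Sum>b\<in>B. (b \<bullet> x / (b \<bullet> b)) *\<^sub>R b)"
          have "orthogonal ?y y" if "y \<in> span B" for y
            using Gram_Schmidt_step[OF B(2) that] by (simp add: orthogonal_commute)
          then have "orthogonal ?y ?y" by (simp add: B(5))
          then show ?thesis by (simp add: orthogonal_def)
        qed
        then show ?thesis using B(3) by (simp add: dot_square_norm)
      qed
      have "b \<bullet> x = 0" if b: "b \<in> B" "norm (A *v b) \<noteq> s" for b
      proof -
        have "(norm (A *v b))\<^sup>2 * (b \<bullet> x) = s\<^sup>2 * (b \<bullet> x)"
          using gram_matrix_inner[of A b x] gram_matrix_inner[of A x b] bspec[OF B(4) b(1)] x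
          by (simp add: inner_commute)
        then show ?thesis using b(2) s by auto
      qed
      then have "(\<Sum>b\<in>B. (b \<bullet> x) *\<^sub>R b) = (\<Sum>b\<in>{b \<in> B. norm (A *v b) = s}. (b \<bullet> x) *\<^sub>R b)"
        using B(1) by (intro sum.mono_neutral_right) auto
      then show "x \<in> span {b \<in> B. norm (A *v b) = s}"
        by (subst expand) (simp, intro span_sum span_scale span_base, simp)
    qed
  qed
  have dim: "dim (sv_space A s) = card {b \<in> B. norm (A *v b) = s}" if "s \<ge> 0" for s
    unfolding sp[OF that] dim_span
    by (rule dim_eq_card_independent, rule independent_mono[OF B(6)]) auto
  have set: "{s. 0 \<le> s \<and> sv_space A s \<noteq> {0}} = (\<lambda>b. norm (A *v b)) ` B"
  proof -
    have "sv_space A s \<noteq> {0} \<longleftrightarrow> s \<in> (\<lambda>b. norm (A *v b)) ` B" if "s \<ge> 0" for s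
    proof
      assume "s \<in> (\<lambda>b. norm (A *v b)) ` B"
      then obtain b where b: "b \<in> B" "s = norm (A *v b)" by auto
      then have "b \<in> sv_space A s" unfolding sp[OF that] by (auto intro: span_base)
      moreover have "b \<noteq> 0" using B(3) b by force
      ultimately show "sv_space A s \<noteq> {0}" by auto
    next
      assume "sv_space A s \<noteq> {0}"
      then have "{b \<in> B. norm (A *v b) = s} \<noteq> {}" unfolding sp[OF that] by (metis span_empty)
      then show "s \<in> (\<lambda>b. norm (A *v b)) ` B" by auto
    qed
    then have "{s. 0 \<le> s \<and> sv_space A s \<noteq> {0}} = {s. 0 \<le> s \<and> s \<in> (\<lambda>b. norm (A *v b)) ` B}"
      by blast
    also have "\<dots> = (\<lambda>b. norm (A *v b)) ` B" by auto
    finally show ?thesis .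
  qed
  show ?thesis
  proof (rule multiset_eqI)
    fix s
    have "count (singular_values A) s = (\<Sum>t\<in>(\<lambda>b. norm (A *v b)) ` B. if t = s then dim (sv_space A t) else 0)"
      unfolding singular_values_def set by (simp add: count_sum eq_commute[of s])
    also have "\<dots> = card {b \<in> B. norm (A *v b) = s}"
    proof (cases "s \<in> (\<lambda>b. norm (A *v b)) ` B")
      case True
      then have "s \<ge> 0" by auto
      with True B(1) show ?thesis by (simp add: dim)
    next
      case False
      then have "{b \<in> B. norm (A *v b) = s} = {}" by auto
      then have "card {b \<in> B. norm (A *v b) = s} = 0" by (simp only: card.empty)
      moreover have "(\<Sum>t\<in>(\<lambda>b. norm (A *v b)) ` B. if t = s then dim (sv_space A t) else 0) = 0"
        using False by (intro sum.neutral) auto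
      ultimately show ?thesis by simp
    qed
    also have "\<dots> = count (image_mset (\<lambda>b. norm (A *v b)) (mset_set B)) s"
    proof -
      have "(\<lambda>b. norm (A *v b)) -` {s} \<inter> B = {b \<in> B. norm (A *v b) = s}" by auto
      then show ?thesis using B(1) by (simp add: count_image_mset sum.If_cases)
    qed
    finally show "count (singular_values A) s = count (image_mset (\<lambda>b. norm (A *v b)) (mset_set B)) s" .
  qed
qed

lemma singular_value_decomposition:
  fixes A :: "real^'d^'d"
  obtains v :: "nat \<Rightarrow> real^'d"
  where "\<And>i. i \<in> {1..CARD('d)} \<Longrightarrow> norm (v i) = 1"
    "\<And>i. i \<in> {1..CARD('d)} \<Longrightarrow> norm (A *v v i) = singular_value i A"
    "\<And>i j. i \<in> {1..CARD('d)} \<Longrightarrow> j \<in> {1..CARD('d)} \<Longrightarrow> i \<noteq> j \<Longrightarrow> v i \<bullet> v j = 0"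
    "\<And>i x. i \<in> {1..CARD('d)} \<Longrightarrow> (A *v v i) \<bullet> (A *v x) = (singular_value i A)\<^sup>2 * (v i \<bullet> x)"
    "\<And>i j. 1 \<le> i \<Longrightarrow> i \<le> j \<Longrightarrow> j \<le> CARD('d) \<Longrightarrow> singular_value j A \<le> singular_value i A"
proof -
  obtain B where B: "finite B" "card B = CARD('d)" "pairwise orthogonal B" "\<forall>b\<in>B. norm b = 1"
    "\<forall>b\<in>B. (transpose A ** A) *v b = (norm (A *v b))\<^sup>2 *\<^sub>R b" "span B = UNIV" "independent B"
    using gram_eigenbasis[of A] by (elim exE conjE)
  define g where "g = (\<lambda>b. norm (A *v b))"
  obtain ys where ys: "set ys = B" "distinct ys" using finite_distinct_list[OF B(1)] by blast
  define xs where "xs = rev (sort_key g ys)"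
  have xs: "set xs = B" "distinct xs" "length xs = CARD('d)"
  proof -
    have "length ys = card B" using distinct_card[OF ys(2)] ys(1) by simp
    then show "set xs = B" "distinct xs" "length xs = CARD('d)" using ys B(2) by (auto simp: xs_def)
  qed
  have ms: "sorted_list_of_multiset (singular_values A) = rev (map g xs)"
  proof -
    have "singular_values A = mset (map g xs)"
      using singular_values_gram_eigenbasis[OF B(1,3-7)] xs
      by (simp add: g_def mset_set_set[symmetric])
    moreover have "sorted (rev (map g xs))" by (simp add: xs_def rev_map)
    ultimately show ?thesis
      using properties_for_sort[of "rev (map g xs)" "map g xs"]
      by (simp del: mset_map add: sorted_list_of_multiset_mset)
  qed
  define v where "v = (\<lambda>i. xs ! (i - 1))"
  have nth: "map g xs ! (i - 1) = g (v i)" if "i \<in> {1..CARD('d)}" for i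
    unfolding v_def by (rule nth_map) (use that xs(3) in auto)
  have sv: "singular_value i A = g (v i)" if "i \<in> {1..CARD('d)}" for i
    unfolding singular_value_def ms rev_rev_ident using that by (rule nth)
  have vB: "v i \<in> B" if "i \<in> {1..CARD('d)}" for i
    using that xs by (auto simp: v_def)
  have vv: "v i \<bullet> v j = 0" if "i \<in> {1..CARD('d)}" "j \<in> {1..CARD('d)}" "i \<noteq> j" for i j
  proof -
    have "v i \<noteq> v j" using that xs by (auto simp: v_def nth_eq_iff_index_eq)
    then show ?thesis using B(3) vB that by (auto simp: pairwise_def orthogonal_def)
  qed
  show ?thesis
  proof (rule that[of v])
    fix i j assume ij: "i \<in> {1..CARD('d)}" "j \<in> {1..CARD('d)}" "i \<noteq> j"
    then show "v i \<bullet> v j = 0" by (rule vv)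
  next
    fix i x assume i: "i \<in> {1..CARD('d)}"
    show "(A *v v i) \<bullet> (A *v x) = (singular_value i A)\<^sup>2 * (v i \<bullet> x)"
      unfolding gram_matrix_inner[symmetric] bspec[OF B(5) vB[OF i]] by (simp add: sv[OF i] g_def)
  next
    fix i j :: nat assume ij: "1 \<le> i" "i \<le> j" "j \<le> CARD('d)"
    have "sorted_wrt (\<ge>) (map g xs)"
    proof -
      have "map g xs = rev (map g (sort_key g ys))" by (simp add: xs_def rev_map)
      then show ?thesis using sorted_sort_key[of g ys] by (simp add: sorted_wrt_rev)
    qed
    then have "map g xs ! (j - 1) \<le> map g xs ! (i - 1)"
      using ij xs(3) by (cases "i = j") (auto simp: sorted_wrt_iff_nth_less)
    then show "singular_value j A \<le> singular_value i A" using ij by (simp add: sv nth[simplified])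
  qed (use sv vB B in \<open>auto simp: g_def\<close>)
qed

lemma singular_vector:
  fixes A :: "real^'d^'d"
  assumes "i \<in> {1..CARD('d)}"
  shows "\<exists>v. norm v = 1 \<and> norm (A *v v) = singular_value i A"
proof -
  show ?thesis by (rule singular_value_decomposition[of A]) (use assms in blast)
qed

lemma singular_value_pos:
  fixes A :: "real^'d^'d"
  assumes "invertible A" "i \<in> {1..CARD('d)}"
  shows "singular_value i A > 0"
proof -
  obtain v where v: "norm v = 1" "norm (A *v v) = singular_value i A"
    using singular_vector[OF assms(2)] by blast
  have "A *v v \<noteq> 0"
  proof
    assume 0: "A *v v = 0"
    obtain A' where "A' ** A = mat 1" using assms(1) by (auto simp: invertible_def)
    then have "v = A' *v (A *v v)" by (simp add: matrix_vector_mul_assoc)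
    then show False using v(1) by (simp add: 0)
  qed
  then show ?thesis by (simp flip: v(2))
qed

lemma singular_value_le:
  fixes A :: "real^'d^'d"
  assumes "\<And>x. norm (A *v x) \<le> c * norm x" "i \<in> {1..CARD('d)}"
  shows "singular_value i A \<le> c"
proof -
  obtain v where v: "norm v = 1" "norm (A *v v) = singular_value i A"
    using singular_vector[OF assms(2)] by blast
  then show ?thesis using assms(1)[of v] by simp
qed

lemma nat_ceiling_bounds:
  assumes "0 < s" "s \<le> real d"
  shows "nat \<lceil>s\<rceil> \<in> {1..d}" "0 < s - real (nat \<lceil>s\<rceil>) + 1" "s - real (nat \<lceil>s\<rceil>) + 1 \<le> 1"
proof -
  have c: "0 < \<lceil>s\<rceil>" using assms by simp
  moreover have "\<lceil>s\<rceil> \<le> int d" unfolding ceiling_le_iff using assms by simp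
  moreover have "nat z \<in> {1..d}" if "0 < z" "z \<le> int d" for z using that by auto
  ultimately show "nat \<lceil>s\<rceil> \<in> {1..d}" by blast
  have "real (nat \<lceil>s\<rceil>) = real_of_int \<lceil>s\<rceil>" using c by simp
  then show "0 < s - real (nat \<lceil>s\<rceil>) + 1" "s - real (nat \<lceil>s\<rceil>) + 1 \<le> 1"
    using ceiling_correct[of s] by linarith+
qed

lemma sv_fun_eq:
  fixes A :: "real^'d^'d"
  assumes "0 < s" "s \<le> real CARD('d)" "m = nat \<lceil>s\<rceil>"
  shows "sv_fun s A = (\<Prod>i = 1..m - 1. singular_value i A) * singular_value m A powr (s - real m + 1)"
  using assms by (simp add: sv_fun_def Let_def)

lemma sv_fun_bounds:
  fixes A :: "real^'d^'d"
  assumes s: "0 < s" "s \<le> real CARD('d)"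
    and sv: "\<And>i. i \<in> {1..CARD('d)} \<Longrightarrow> 0 < singular_value i A \<and> singular_value i A \<le> 1"
  shows "0 < sv_fun s A" "sv_fun s A \<le> 1"
proof -
  define m where "m = nat \<lceil>s\<rceil>"
  have m: "m \<in> {1..CARD('d)}" "0 < s - real m + 1"
    using nat_ceiling_bounds[OF s] by (auto simp: m_def)
  have P: "0 < (\<Prod>i = 1..m - 1. singular_value i A)" "(\<Prod>i = 1..m - 1. singular_value i A) \<le> 1"
    using sv m by (auto intro!: prod_pos prod_le_1 simp: less_imp_le)
  have Q: "0 < singular_value m A powr (s - real m + 1)" "singular_value m A powr (s - real m + 1) \<le> 1"
    using sv[OF m(1)] m(2) by (auto intro: powr_le1)
  show "0 < sv_fun s A" "sv_fun s A \<le> 1"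
    unfolding sv_fun_eq[OF s m_def] using P Q by (auto intro: mult_le_one)
qed

lemma sv_fun_beyond_dim_le:
  fixes A :: "real^'d^'d"
  assumes s: "s > real CARD('d)"
    and sv: "\<And>i. i \<in> {1..CARD('d)} \<Longrightarrow> 0 < singular_value i A \<and> singular_value i A \<le> 1"
  shows "0 < sv_fun s A" "sv_fun s A \<le> sv_fun (real CARD('d)) A"
proof -
  define P where "P = (\<Prod>i = 1..CARD('d). singular_value i A)"
  have P: "0 < P" "P \<le> 1" unfolding P_def using sv by (auto intro!: prod_pos prod_le_1 simp: less_imp_le)
  have s_eq: "sv_fun s A = P powr (s / real CARD('d))"
    using s by (auto simp: sv_fun_def P_def)
  then show "0 < sv_fun s A" using P by simp
  have "sv_fun (real CARD('d)) A =
      (\<Prod>i = 1..CARD('d) - 1. singular_value i A) * singular_value CARD('d) A powr 1"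
    using sv_fun_eq[of "real CARD('d)" "CARD('d)" A] by simp
  also have "\<dots> = (\<Prod>i = 1..CARD('d) - 1. singular_value i A) * singular_value CARD('d) A"
    using sv[of "CARD('d)"] by (simp add: Suc_le_eq)
  also have "\<dots> = P"
  proof -
    have "{1..CARD('d)} = insert CARD('d) {1..CARD('d) - 1}" by (auto simp: Suc_le_eq)
    moreover have "CARD('d) \<notin> {1..CARD('d) - 1}" by (simp add: not_le)
    ultimately have "P = singular_value CARD('d) A * (\<Prod>i = 1..CARD('d) - 1. singular_value i A)"
      unfolding P_def by (metis finite_atLeastAtMost prod.insert)
    then show ?thesis by (simp only: mult.commute)
  qed
  finally have d_eq: "sv_fun (real CARD('d)) A = P" .
  have "P powr (s / real CARD('d)) \<le> P powr 1"
    using P s by (intro powr_mono') (auto simp: divide_simps)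
  then show "sv_fun s A \<le> sv_fun (real CARD('d)) A"
    unfolding s_eq d_eq using P by simp
qed

section \<open>Power sums and integrals\<close>

lemma sum_powr_superadditive:
  fixes x :: "'i \<Rightarrow> real"
  assumes "finite F" "\<And>i. i \<in> F \<Longrightarrow> x i \<ge> 0" "q \<ge> 1"
  shows "(\<Sum>i\<in>F. x i powr q) \<le> (\<Sum>i\<in>F. x i) powr q"
proof -
  have eq: "y powr q = y * y powr (q - 1)" if "y \<ge> 0" for y :: real
    using that powr_mult_base[of y "q - 1"] by simp
  have "(\<Sum>i\<in>F. x i powr q) \<le> (\<Sum>i\<in>F. x i * (\<Sum>i\<in>F. x i) powr (q - 1))"
  proof (rule sum_mono)
    fix i assume i: "i \<in> F"
    have "x i \<le> (\<Sum>i\<in>F. x i)" using assms i by (intro member_le_sum) auto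
    then show "x i powr q \<le> x i * (\<Sum>i\<in>F. x i) powr (q - 1)"
      using assms i by (subst eq) (auto intro!: mult_left_mono powr_mono2)
  qed
  also have "\<dots> = (\<Sum>i\<in>F. x i) powr q"
    using assms by (subst eq[OF sum_nonneg]) (auto simp: sum_distrib_right)
  finally show ?thesis .
qed

lemma sum_powr_power_mean:
  fixes x :: "'i \<Rightarrow> real"
  assumes "finite F" "\<And>i. i \<in> F \<Longrightarrow> x i \<ge> 0" "q \<ge> 1"
  shows "(\<Sum>i\<in>F. x i) powr q \<le> real (card F) powr (q - 1) * (\<Sum>i\<in>F. x i powr q)"
proof -
  define G where "G = {i \<in> F. x i > 0}"
  have G: "finite G" "G \<subseteq> F" using assms by (auto simp: G_def)
  have s1: "(\<Sum>i\<in>F. x i) = (\<Sum>i\<in>G. x i)"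
    using assms by (intro sum.mono_neutral_right) (auto simp: G_def order.order_iff_strict)
  have s2: "(\<Sum>i\<in>F. x i powr q) = (\<Sum>i\<in>G. x i powr q)"
    using assms by (intro sum.mono_neutral_right) (auto simp: G_def order.order_iff_strict)
  show ?thesis
  proof (cases "G = {}")
    case True
    then show ?thesis unfolding s1 s2 by simp
  next
    case False
    define N where "N = real (card G)"
    have N: "N > 0" using False G by (simp add: N_def card_gt_0_iff)
    have "(\<Sum>i\<in>G. (1 / N) *\<^sub>R x i) powr q \<le> (\<Sum>i\<in>G. (1 / N) * x i powr q)"
      by (rule convex_on_sum[OF G(1) False powr_convex[OF assms(3)]])
        (use N in \<open>auto simp: G_def N_def\<close>)
    then have "((\<Sum>i\<in>G. x i) / N) powr q \<le> (\<Sum>i\<in>G. x i powr q) / N"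
      by (simp add: sum_divide_distrib)
    then have "(\<Sum>i\<in>G. x i) powr q / N powr q \<le> (\<Sum>i\<in>G. x i powr q) / N"
      using N by (simp add: powr_divide sum_nonneg G_def)
    then have "(\<Sum>i\<in>G. x i) powr q \<le> N powr q / N * (\<Sum>i\<in>G. x i powr q)"
      using N by (simp add: field_simps)
    also have "N powr q / N = N powr (q - 1)" using N by (simp add: powr_diff)
    also have "\<dots> * (\<Sum>i\<in>G. x i powr q) \<le> real (card F) powr (q - 1) * (\<Sum>i\<in>G. x i powr q)"
      using assms N G by (intro mult_right_mono powr_mono2 sum_nonneg) (auto simp: N_def card_mono)
    finally show ?thesis unfolding s1 s2 .
  qed
qed

lemma powr_add_le:
  fixes a b e :: real
  assumes "0 \<le> a" "0 \<le> b" "0 < e" "e \<le> 1"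
  shows "(a + b) powr e \<le> a powr e + b powr e"
proof (cases "a = 0 \<or> b = 0")
  case False
  then have ab: "a > 0" "b > 0" using assms by auto
  have eq: "c powr e = c * c powr (e - 1)" if "c > 0" for c :: real
    using that by (simp add: powr_mult_base)
  have "(a + b) powr e = a * (a + b) powr (e - 1) + b * (a + b) powr (e - 1)"
    using eq[of "a + b"] ab by (simp add: distrib_right)
  also have "\<dots> \<le> a * a powr (e - 1) + b * b powr (e - 1)"
    using ab assms by (intro add_mono mult_left_mono powr_mono2') auto
  also have "\<dots> = a powr e + b powr e" using eq ab by simp
  finally show ?thesis .
qed auto

lemma powr_sum_subadditive:
  fixes f :: "'i \<Rightarrow> real"
  assumes "finite I" "\<And>i. i \<in> I \<Longrightarrow> 0 \<le> f i" "0 < e" "e \<le> 1"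
  shows "(\<Sum>i\<in>I. f i) powr e \<le> (\<Sum>i\<in>I. f i powr e)"
  using assms(1,2)
proof (induction I rule: finite_induct)
  case (insert i I)
  have "(f i + (\<Sum>i\<in>I. f i)) powr e \<le> f i powr e + (\<Sum>i\<in>I. f i) powr e"
    using insert assms by (intro powr_add_le sum_nonneg) auto
  then show ?case using insert by simp
qed simp

lemma powr_le_affine:
  fixes f l e :: real
  assumes "0 \<le> f" "0 < l" "0 < e" "e \<le> 1"
  shows "f powr e \<le> l powr e + l powr (e - 1) * f"
proof (cases "f \<le> l")
  case True
  then have "f powr e \<le> l powr e" using assms by (intro powr_mono2) auto
  then show ?thesis using assms by (simp add: add_increasing2)
next
  case False
  then have "f powr e = f powr (e - 1) * f"
    using assms by (simp add: powr_mult_base mult.commute)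
  also have "\<dots> \<le> l powr (e - 1) * f"
    using False assms by (intro mult_right_mono powr_mono2') auto
  finally show ?thesis by (simp add: add_increasing)
qed

lemma nn_integral_linear_combination:
  fixes F G :: "'a \<Rightarrow> ennreal"
  assumes [measurable]: "F \<in> borel_measurable M" "G \<in> borel_measurable M"
  shows "(\<integral>\<^sup>+x. c * F x + d * G x \<partial>M) = c * (\<integral>\<^sup>+x. F x \<partial>M) + d * (\<integral>\<^sup>+x. G x \<partial>M)"
  by (simp add: nn_integral_add nn_integral_cmult)

lemma nn_integral_sum_add:
  fixes F :: "'i \<Rightarrow> 'a \<Rightarrow> ennreal"
  assumes [measurable]: "\<And>i. F i \<in> borel_measurable M" "G \<in> borel_measurable M"
  shows "(\<integral>\<^sup>+x. (\<Sum>i\<in>I. F i x) + c * G x \<partial>M) = (\<Sum>i\<in>I. \<integral>\<^sup>+x. F i x \<partial>M) + c * (\<integral>\<^sup>+x. G x \<partial>M)"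
  by (simp add: nn_integral_add nn_integral_cmult nn_integral_sum)

lemma sets_cball[measurable]: "cball (c :: 'a::metric_space) R \<in> sets borel"
  by simp

section \<open>Volumes and mesh cubes\<close>

lemma nn_integral_lborel_translate:
  fixes f :: "'a::euclidean_space \<Rightarrow> ennreal"
  assumes [measurable]: "f \<in> borel_measurable borel"
  shows "(\<integral>\<^sup>+x. f (c + x) \<partial>lborel) = (\<integral>\<^sup>+x. f x \<partial>lborel)"
proof -
  have "(\<integral>\<^sup>+x. f x \<partial>lborel) = (\<integral>\<^sup>+x. f x \<partial>distr lborel borel ((+) c))"
    by (simp add: lborel_distr_plus)
  also have "\<dots> = (\<integral>\<^sup>+x. f (c + x) \<partial>lborel)"
    by (subst nn_integral_distr) auto
  finally show ?thesis ..
qed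

lemma closed_slab_intersection:
  fixes \<phi> :: "'i \<Rightarrow> 'a::euclidean_space \<Rightarrow> real"
  assumes "\<And>i. i \<in> I \<Longrightarrow> linear (\<phi> i)"
  shows "closed {x \<in> cball c R. \<forall>i\<in>I. \<bar>\<phi> i x - g i\<bar> \<le> h i}"
proof -
  have "closed {x. \<bar>\<phi> i x - g i\<bar> \<le> h i}" if "i \<in> I" for i
    by (intro closed_Collect_le continuous_intros linear_continuous_on)
      (use assms[OF that] in \<open>simp add: linear_conv_bounded_linear\<close>)
  then have "closed (cball c R \<inter> (\<Inter>i\<in>I. {x. \<bar>\<phi> i x - g i\<bar> \<le> h i}))"
    by (intro closed_Int closed_cball closed_INT) auto
  also have "cball c R \<inter> (\<Inter>i\<in>I. {x. \<bar>\<phi> i x - g i\<bar> \<le> h i}) =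
      {x \<in> cball c R. \<forall>i\<in>I. \<bar>\<phi> i x - g i\<bar> \<le> h i}" by auto
  finally show ?thesis .
qed

lemma emeasure_average_translates:
  fixes S :: "'a::euclidean_space set"
  assumes [measurable]: "S \<in> sets borel"
  shows "2 * emeasure lborel S =
    (\<integral>\<^sup>+x. (\<integral>\<^sup>+t. indicator {-1..1} t * indicator S (t *\<^sub>R b + x) \<partial>(lborel::real measure)) \<partial>lborel)"
proof -
  have average: "(\<integral>\<^sup>+x. indicator {-1..1} t * indicator S (t *\<^sub>R b + x) \<partial>lborel) =
      indicator {-1..1} t * emeasure lborel S" for t :: real
    by (subst nn_integral_cmult) (simp_all add: nn_integral_lborel_translate)
  have "2 * emeasure lborel S = (\<integral>\<^sup>+t. indicator {-1..1} t * emeasure lborel S \<partial>(lborel::real measure))"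
    by (simp add: nn_integral_multc)
  also have "\<dots> = (\<integral>\<^sup>+t. (\<integral>\<^sup>+x. indicator {-1..1} t * indicator S (t *\<^sub>R b + x) \<partial>lborel) \<partial>(lborel::real measure))"
    unfolding average ..
  also have "\<dots> = (\<integral>\<^sup>+x. (\<integral>\<^sup>+t. indicator {-1..1} t * indicator S (t *\<^sub>R b + x) \<partial>(lborel::real measure)) \<partial>lborel)"
    by (rule lborel_pair.Fubini'[symmetric]) measurable
  finally show ?thesis .
qed

text \<open>Averaging the translates of the set over \<open>\<tau> *\<^sub>R b\<close>, \<open>\<bar>\<tau>\<bar> \<le> 1\<close>, gains the factor \<open>h / \<sigma>\<close>
  by Tonelli's theorem, without any change of coordinates.\<close>

lemma emeasure_slab_step:
  fixes \<phi> :: "'i \<Rightarrow> 'a::euclidean_space \<Rightarrow> real"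
  assumes lin: "linear (\<phi> k)" "\<And>i. i \<in> I \<Longrightarrow> linear (\<phi> i)"
    and b: "norm b \<le> \<beta>" "\<phi> k b = \<sigma>" "\<sigma> > 0" "\<And>i. i \<in> I \<Longrightarrow> \<phi> i b = 0" and h: "h k \<ge> 0"
  shows "emeasure lborel {x \<in> cball c R. \<forall>i\<in>insert k I. \<bar>\<phi> i x - g i\<bar> \<le> h i}
     \<le> ennreal (h k / \<sigma>) * emeasure lborel {x \<in> cball c (R + \<beta>). \<forall>i\<in>I. \<bar>\<phi> i x - g i\<bar> \<le> h i}"
    (is "emeasure lborel ?S \<le> _ * emeasure lborel ?S'")
proof -
  have S[measurable]: "?S \<in> sets borel"
    by (intro borel_closed closed_slab_intersection) (use lin in auto)
  have S'[measurable]: "?S' \<in> sets borel"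
    by (intro borel_closed closed_slab_intersection) (use lin in auto)
  have inner: "(\<integral>\<^sup>+t. indicator {-1..1} t * indicator ?S (t *\<^sub>R b + x) \<partial>lborel)
      \<le> indicator ?S' x * ennreal (2 * h k / \<sigma>)" (is "?l \<le> _") for x
  proof (cases "x \<in> ?S'")
    case True
    have "?l \<le> (\<integral>\<^sup>+t. indicator {(g k - h k - \<phi> k x) / \<sigma>..(g k + h k - \<phi> k x) / \<sigma>} t \<partial>lborel)"
    proof (rule nn_integral_mono)
      fix t :: real
      have "t \<in> {(g k - h k - \<phi> k x) / \<sigma>..(g k + h k - \<phi> k x) / \<sigma>}" if "t *\<^sub>R b + x \<in> ?S"
      proof -
        have "\<phi> k (t *\<^sub>R b + x) = t * \<sigma> + \<phi> k x" using lin b by (simp add: linear_add linear_cmul)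
        moreover have "\<bar>\<phi> k (t *\<^sub>R b + x) - g k\<bar> \<le> h k" using that by simp
        ultimately have "\<bar>t * \<sigma> + \<phi> k x - g k\<bar> \<le> h k" by simp
        then show ?thesis using b(3) by (simp add: divide_le_eq le_divide_eq abs_le_iff)
      qed
      then show "indicator {-1..1} t * indicator ?S (t *\<^sub>R b + x)
          \<le> (indicator {(g k - h k - \<phi> k x) / \<sigma>..(g k + h k - \<phi> k x) / \<sigma>} t :: ennreal)"
        by (auto simp: indicator_def)
    qed
    also have "\<dots> = ennreal (2 * h k / \<sigma>)"
      using b(3) h by (simp add: divide_right_mono diff_divide_distrib[symmetric])
    finally show ?thesis using True by simp
  next
    case False
    have "t *\<^sub>R b + x \<notin> ?S" if "t \<in> {-1..1}" for t
    proof
      assume *: "t *\<^sub>R b + x \<in> ?S"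
      have "\<bar>t\<bar> * norm b \<le> 1 * \<beta>" using that b by (intro mult_mono) auto
      then have "norm (t *\<^sub>R b) \<le> \<beta>" by simp
      moreover have "dist c x \<le> dist c (t *\<^sub>R b + x) + norm (t *\<^sub>R b)"
        using dist_triangle[of c x "t *\<^sub>R b + x"] by (simp add: dist_norm)
      ultimately have "x \<in> cball c (R + \<beta>)" using * by auto
      moreover have "\<phi> i (t *\<^sub>R b + x) = \<phi> i x" if "i \<in> I" for i
        using lin(2)[OF that] b that by (simp add: linear_add linear_cmul)
      ultimately show False using * False by auto
    qed
    then have "?l = (\<integral>\<^sup>+t. 0 \<partial>(lborel::real measure))"
      by (intro nn_integral_cong) (auto simp: indicator_def)
    then show ?thesis by simp
  qed
  have "2 * emeasure lborel ?S = (\<integral>\<^sup>+x. (\<integral>\<^sup>+t. indicator {-1..1} t * indicator ?S (t *\<^sub>R b + x) \<partial>(lborel::real measure)) \<partial>lborel)"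
    by (rule emeasure_average_translates[OF S])
  also have "\<dots> \<le> (\<integral>\<^sup>+x. indicator ?S' x * ennreal (2 * h k / \<sigma>) \<partial>lborel)"
    by (intro nn_integral_mono inner)
  also have "\<dots> = 2 * (ennreal (h k / \<sigma>) * emeasure lborel ?S')"
  proof -
    have "ennreal (2 * h k / \<sigma>) = 2 * ennreal (h k / \<sigma>)"
      using ennreal_mult[of 2 "h k / \<sigma>"] h b(3) by simp
    moreover have "(\<integral>\<^sup>+x. indicator ?S' x * ennreal (2 * h k / \<sigma>) \<partial>lborel) =
        emeasure lborel ?S' * ennreal (2 * h k / \<sigma>)"
      using S' by (subst nn_integral_multc) (simp_all only: nn_integral_indicator sets_lborel
          borel_measurable_indicator measurable_lborel1)
    ultimately show ?thesis by (simp only: mult_ac)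
  qed
  finally show ?thesis by (simp add: ennreal_mult_le_mult_iff)
qed

lemma emeasure_slab_intersection_le:
  fixes \<phi> :: "'i \<Rightarrow> 'a::euclidean_space \<Rightarrow> real"
  assumes "finite I" "\<And>i. i \<in> I \<Longrightarrow> linear (\<phi> i)" "\<And>i. i \<in> I \<Longrightarrow> norm (b i) \<le> \<beta>"
    "\<And>i. i \<in> I \<Longrightarrow> \<phi> i (b i) = \<sigma> i" "\<And>i. i \<in> I \<Longrightarrow> \<sigma> i > 0"
    "\<And>i j. i \<in> I \<Longrightarrow> j \<in> I \<Longrightarrow> i \<noteq> j \<Longrightarrow> \<phi> i (b j) = 0" "\<And>i. i \<in> I \<Longrightarrow> h i \<ge> 0"
  shows "emeasure lborel {x \<in> cball c R. \<forall>i\<in>I. \<bar>\<phi> i x - g i\<bar> \<le> h i}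
     \<le> ennreal (\<Prod>i\<in>I. h i / \<sigma> i) * emeasure lborel (cball c (R + real (card I) * \<beta>))"
  using assms
proof (induction I arbitrary: R rule: finite_induct)
  case (insert k I)
  have "emeasure lborel {x \<in> cball c R. \<forall>i\<in>insert k I. \<bar>\<phi> i x - g i\<bar> \<le> h i}
     \<le> ennreal (h k / \<sigma> k) * emeasure lborel {x \<in> cball c (R + \<beta>). \<forall>i\<in>I. \<bar>\<phi> i x - g i\<bar> \<le> h i}"
  proof (rule emeasure_slab_step[of _ _ _ "b k"])
    show "\<phi> i (b k) = 0" if "i \<in> I" for i
    proof -
      have "i \<noteq> k" using that insert.hyps by auto
      then show ?thesis using insert.prems(5)[of i k] that by simp
    qed
  qed (use insert in auto)
  also have "\<dots> \<le> ennreal (h k / \<sigma> k) * (ennreal (\<Prod>i\<in>I. h i / \<sigma> i) *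
      emeasure lborel (cball c (R + \<beta> + real (card I) * \<beta>)))"
    by (intro mult_left_mono insert.IH) (use insert in auto)
  also have "\<dots> = ennreal (\<Prod>i\<in>insert k I. h i / \<sigma> i) *
      emeasure lborel (cball c (R + \<beta> + real (card I) * \<beta>))"
    using insert by (simp add: ennreal_mult[symmetric] prod_nonneg mult.assoc[symmetric] less_imp_le)
  finally show ?case using insert by (simp add: algebra_simps)
qed (simp add: cball_def)

lemma mesh_cube_index:
  assumes "r > 0" "x \<in> mesh_cube r j"
  shows "j i = \<lfloor>x $ i / r\<rfloor>"
  using assms by (intro floor_unique[symmetric]) (auto simp: mesh_cube_def field_simps)

lemma in_mesh_cube_floor: "r > 0 \<Longrightarrow> x \<in> mesh_cube r (\<lambda>i. \<lfloor>x $ i / r\<rfloor>)"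
  using floor_divide_lower[of r "x $ i" for i] floor_divide_upper[of r "x $ i" for i]
  by (simp add: mesh_cube_def)

lemma disjoint_mesh_cubes:
  assumes "r > 0"
  shows "disjoint (mesh_cubes r :: (real^'d::finite) set set)"
proof (rule disjointI)
  fix a b :: "(real^'d) set" assume "a \<in> mesh_cubes r" "b \<in> mesh_cubes r" "a \<noteq> b"
  then obtain i j where ij: "a = mesh_cube r i" "b = mesh_cube r j" "i \<noteq> j"
    by (auto simp: mesh_cubes_def)
  have "i = j" if "x \<in> a" "x \<in> b" for x
    using that mesh_cube_index[OF assms] ij by (metis ext)
  then show "a \<inter> b = {}" using ij by auto
qed

lemma sets_mesh_cube[measurable]: "Q \<in> mesh_cubes r \<Longrightarrow> Q \<in> sets borel"
  by (auto simp: mesh_cubes_def mesh_cube_def)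

lemma dist_mesh_cube_le:
  fixes x y :: "real^'d"
  assumes "r > 0" "Q \<in> mesh_cubes r" "x \<in> Q" "y \<in> Q"
  shows "dist x y \<le> real CARD('d) * r"
proof -
  obtain j where Q: "Q = mesh_cube r j" using assms by (auto simp: mesh_cubes_def)
  have "dist x y \<le> (\<Sum>i\<in>UNIV. \<bar>(x - y) $ i\<bar>)" unfolding dist_norm by (rule norm_le_l1_cart)
  also have "\<dots> \<le> (\<Sum>i\<in>(UNIV::'d set). r)"
  proof (rule sum_mono)
    fix i
    have "of_int (j i) * r \<le> x $ i" "x $ i < (of_int (j i) + 1) * r"
      "of_int (j i) * r \<le> y $ i" "y $ i < (of_int (j i) + 1) * r"
      using assms by (auto simp: Q mesh_cube_def)
    then show "\<bar>(x - y) $ i\<bar> \<le> r" by (simp add: algebra_simps)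
  qed
  finally show ?thesis by simp
qed

lemma emeasure_mesh_cube_ge:
  assumes "r > 0" "Q \<in> (mesh_cubes r :: (real^'d) set set)"
  shows "ennreal (r ^ CARD('d)) \<le> emeasure lborel Q"
proof -
  obtain j where Q: "Q = mesh_cube r j" using assms by (auto simp: mesh_cubes_def)
  define l :: "real^'d" where "l = (\<chi> i. of_int (j i) * r)"
  define u :: "real^'d" where "u = (\<chi> i. (of_int (j i) + 1) * r)"
  have d: "(u - l) \<bullet> b = r" if "b \<in> Basis" for b
    using that by (auto simp: Basis_vec_def inner_axis l_def u_def algebra_simps)
  have "emeasure lborel (box l u) = ennreal (\<Prod>b\<in>Basis. (u - l) \<bullet> b)"
  proof (rule emeasure_lborel_box)
    show "l \<bullet> b \<le> u \<bullet> b" if "b \<in> Basis" for b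
      using d[OF that] assms(1) by (simp add: inner_diff_left)
  qed
  also have "\<dots> = ennreal (r ^ CARD('d))" by (simp add: d)
  finally have "ennreal (r ^ CARD('d)) = emeasure lborel (box l u)" ..
  also have "\<dots> \<le> emeasure lborel Q"
    using assms(2) by (intro emeasure_mono) (auto simp: mem_box_cart Q mesh_cube_def l_def u_def less_imp_le)
  finally show ?thesis .
qed

lemma mesh_cubes_meeting:
  fixes X Y :: "(real^'d) set"
  assumes r: "r > 0" and Y: "Y \<in> sets borel" "emeasure lborel Y \<le> ennreal V" "V \<ge> 0"
    and sub: "\<And>x y. x \<in> X \<Longrightarrow> dist x y \<le> real CARD('d) * r \<Longrightarrow> y \<in> Y"
  shows "finite {Q \<in> mesh_cubes r. Q \<inter> X \<noteq> {}}"
    and "real (card {Q \<in> mesh_cubes r. Q \<inter> X \<noteq> {}}) \<le> V / r ^ CARD('d)"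
proof -
  have *: "real (card F) \<le> V / r ^ CARD('d)"
    if F: "finite F" "F \<subseteq> {Q \<in> mesh_cubes r. Q \<inter> X \<noteq> {}}" for F
  proof -
    have "ennreal (real (card F) * r ^ CARD('d)) = (\<Sum>Q\<in>F. ennreal (r ^ CARD('d)))"
      using r by (simp add: ennreal_mult' ennreal_of_nat_eq_real_of_nat)
    also have "\<dots> \<le> (\<Sum>Q\<in>F. emeasure lborel Q)"
      using F r by (intro sum_mono emeasure_mesh_cube_ge) auto
    also have "\<dots> = emeasure lborel (\<Union>Q\<in>F. Q)"
    proof (rule sum_emeasure)
      show "disjoint_family_on (\<lambda>Q. Q) F"
        using F unfolding disjoint_family_on_def
        by (intro ballI impI disjointD[OF disjoint_mesh_cubes[OF r]]) auto
    qed (use F in auto)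
    also have "\<dots> \<le> emeasure lborel Y"
    proof (rule emeasure_mono)
      show "(\<Union>Q\<in>F. Q) \<subseteq> Y"
      proof safe
        fix y Q assume "y \<in> Q" "Q \<in> F"
        with F obtain x where "x \<in> Q" "x \<in> X" "Q \<in> mesh_cubes r" by auto
        with dist_mesh_cube_le[OF r this(3,1) \<open>y \<in> Q\<close>] show "y \<in> Y" by (intro sub)
      qed
    qed (use Y in simp)
    also have "\<dots> \<le> ennreal V" by (rule Y)
    finally have "real (card F) * r ^ CARD('d) \<le> V" using Y(3) by (simp add: ennreal_le_iff)
    then show ?thesis using r by (simp add: le_divide_eq)
  qed
  have "finite {Q \<in> mesh_cubes r. Q \<inter> X \<noteq> {}} \<and>
      card {Q \<in> mesh_cubes r. Q \<inter> X \<noteq> {}} \<le> nat \<lfloor>V / r ^ CARD('d)\<rfloor>"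
    by (rule finite_if_finite_subsets_card_bdd) (use * in \<open>simp add: le_nat_floor\<close>)
  then show "finite {Q \<in> mesh_cubes r. Q \<inter> X \<noteq> {}}" by simp
  then show "real (card {Q \<in> mesh_cubes r. Q \<inter> X \<noteq> {}}) \<le> V / r ^ CARD('d)" by (rule *) simp
qed

definition mesh_sum :: "real \<Rightarrow> (real^'d::finite) measure \<Rightarrow> real \<Rightarrow> real" where
  "mesh_sum q \<nu> r = (\<Sum>\<^sub>\<infinity>Q\<in>mesh_cubes r. measure \<nu> Q powr q)"

lemma lower_gen_dim_ge:
  fixes \<nu> :: "(real^'d::finite) measure"
  assumes q: "q > 1" and K: "K > 0" and r0: "r0 > 0"
    and S: "\<And>r. 0 < r \<Longrightarrow> r < r0 \<Longrightarrow> 0 < mesh_sum q \<nu> r \<and> mesh_sum q \<nu> r \<le> K * r powr (t * (q - 1))"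
  shows "ereal t \<le> lower_gen_dim q \<nu>"
proof -
  have "filterlim (\<lambda>r. (q - 1) * ln r) at_bot (at_right (0::real))"
    by (rule filterlim_tendsto_pos_mult_at_bot[OF tendsto_const _ ln_at_0]) (use q in simp)
  then have "((\<lambda>r. ln K / ((q - 1) * ln r)) \<longlongrightarrow> 0) (at_right 0)"
    by (intro tendsto_divide_0[OF tendsto_const] filterlim_at_bot_imp_at_infinity)
  then have "((\<lambda>r. ln K / ((q - 1) * ln r) + t) \<longlongrightarrow> 0 + t) (at_right 0)"
    by (intro tendsto_add tendsto_const)
  then have "((\<lambda>r. ereal (ln K / ((q - 1) * ln r) + t)) \<longlongrightarrow> ereal t) (at_right 0)"
    by (simp add: tendsto_ereal)
  then have L: "Liminf (at_right 0) (\<lambda>r. ereal (ln K / ((q - 1) * ln r) + t)) = ereal t"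
    by (intro lim_imp_Liminf) auto
  have "\<forall>\<^sub>F r in at_right 0. ereal (ln K / ((q - 1) * ln r) + t)
      \<le> ereal (ln (mesh_sum q \<nu> r) / ((q - 1) * ln r))"
    unfolding eventually_at_right_field
  proof (intro exI[of _ "min r0 1"] conjI allI impI)
    fix r :: real assume r: "r > 0" "r < min r0 1"
    have "ln (mesh_sum q \<nu> r) \<le> ln (K * r powr (t * (q - 1)))"
      using S[of r] r K by (simp add: ln_le_cancel_iff)
    also have "\<dots> = ln K + t * ((q - 1) * ln r)" using K r by (simp add: ln_mult ln_powr)
    finally have *: "ln (mesh_sum q \<nu> r) \<le> ln K + t * ((q - 1) * ln r)" .
    have neg: "(q - 1) * ln r < 0" using q r by (simp add: mult_less_0_iff)
    have "ln K / W + t = (ln K + t * W) / W" if "W < 0" for W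
      using that by (simp add: add_divide_distrib)
    then have "ln K / ((q - 1) * ln r) + t = (ln K + t * ((q - 1) * ln r)) / ((q - 1) * ln r)"
      using neg by blast
    also have "\<dots> \<le> ln (mesh_sum q \<nu> r) / ((q - 1) * ln r)"
      using * neg by (intro divide_right_mono_neg) auto
    finally show "ereal (ln K / ((q - 1) * ln r) + t) \<le> ereal (ln (mesh_sum q \<nu> r) / ((q - 1) * ln r))"
      by simp
  qed (use r0 in auto)
  from Liminf_mono[OF this] show ?thesis
    unfolding L lower_gen_dim_def mesh_sum_def[symmetric] .
qed

lemma mesh_sum_le_of_lower_gen_dim_gt:
  fixes \<nu> :: "(real^'d::finite) measure"
  assumes q: "q > 1" and D: "ereal s < lower_gen_dim q \<nu>" and S: "\<And>r. 0 < r \<Longrightarrow> r \<le> 1 \<Longrightarrow> 0 < mesh_sum q \<nu> r"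
  shows "\<exists>r0>0. r0 \<le> 1 \<and> (\<forall>r. 0 < r \<and> r < r0 \<longrightarrow> mesh_sum q \<nu> r \<le> r powr (s * (q - 1)))"
proof -
  have "\<forall>\<^sub>F r in at_right 0. ereal s < ereal (ln (mesh_sum q \<nu> r) / ((q - 1) * ln r))"
    using D unfolding lower_gen_dim_def mesh_sum_def[symmetric] by (rule less_LiminfD)
  then obtain b where b: "b > 0" "\<And>r. r > 0 \<Longrightarrow> r < b \<Longrightarrow> s < ln (mesh_sum q \<nu> r) / ((q - 1) * ln r)"
    by (auto simp: eventually_at_right_field)
  show ?thesis
  proof (intro exI[of _ "min b 1"] conjI allI impI)
    fix r assume r: "0 < r \<and> r < min b 1"
    have neg: "(q - 1) * ln r < 0" using q r by (simp add: mult_less_0_iff)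
    have "ln (mesh_sum q \<nu> r) < s * ((q - 1) * ln r)"
      using b(2)[of r] r neg by (simp add: neg_less_divide_eq)
    then have *: "exp (ln (mesh_sum q \<nu> r)) \<le> exp (s * (q - 1) * ln r)" by (simp only: exp_le_cancel_iff mult.assoc)
    have "exp (ln (mesh_sum q \<nu> r)) = mesh_sum q \<nu> r" using S[of r] r by simp
    moreover have "exp (s * (q - 1) * ln r) = r powr (s * (q - 1))" using r by (simp add: powr_def)
    ultimately show "mesh_sum q \<nu> r \<le> r powr (s * (q - 1))" using * by simp
  qed (use b in auto)
qed

lemma dyadic_scale:
  fixes r :: real
  assumes "0 < r" "r \<le> 1"
  obtains j :: nat where "(1 / 2) ^ (Suc j) < r" "r \<le> (1 / 2) ^ j"
proof -
  have "\<exists>j. (1 / 2) ^ j < r" using real_arch_pow_inv[of r "1 / 2"] assms by auto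
  then have L: "(1 / 2) ^ (LEAST j. (1 / 2) ^ j < r) < r" by (rule LeastI_ex)
  then have "(LEAST j. (1 / 2) ^ j < r) \<noteq> 0" using assms by (metis not_le power_0)
  then obtain j where j: "(LEAST j. (1 / 2) ^ j < r) = Suc j" by (metis not0_implies_Suc)
  have "\<not> (1 / 2) ^ j < r" using not_less_Least[of j "\<lambda>j. (1 / 2) ^ j < r"] j by simp
  then show ?thesis using L j that by (metis not_less)
qed

section \<open>Words and projections\<close>

lemma prefix_of_differ:
  "prefix_of x K = prefix_of y K \<or> (\<exists>k<K. prefix_of x k = prefix_of y k \<and> x (Suc k) \<noteq> y (Suc k))"
proof (induction K)
  case (Suc K)
  then show ?case by (auto simp: prefix_of_Suc less_Suc_eq)
qed (simp add: prefix_of_def)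

lemma length_prefix_of[simp]: "length (prefix_of x k) = k"
  by (simp add: prefix_of_def)

lemma words_SucE:
  assumes "u \<in> words n (Suc k)"
  obtains v i where "u = v @ [i]" "v \<in> words n k" "i \<in> {1..n (Suc k)}"
proof -
  have len: "length u = Suc k" and u: "\<And>j. j \<in> {1..Suc k} \<Longrightarrow> u ! (j - 1) \<in> {1..n j}"
    using assms by (auto simp: words_def)
  define v i where "v = butlast u" and "i = last u"
  have uv: "u = v @ [i]" using len by (auto simp: v_def i_def intro: append_butlast_last_id[symmetric])
  have lv: "length v = k" using len by (simp add: v_def)
  have "v \<in> words n k" unfolding words_def
  proof (intro CollectI conjI ballI)
    fix j assume j: "j \<in> {1..k}"
    then have "v ! (j - 1) = u ! (j - 1)" using lv by (auto simp: uv nth_append)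
    then show "v ! (j - 1) \<in> {1..n j}" using u[of j] j by simp
  qed (rule lv)
  moreover have "i \<in> {1..n (Suc k)}" using u[of "Suc k"] lv by (simp add: uv nth_append)
  ultimately show ?thesis using uv that by blast
qed

lemma words_0: "words n 0 = {[]}"
  by (auto simp: words_def)

lemma length_words: "u \<in> words n k \<Longrightarrow> length u = k"
  by (simp add: words_def)

lemma foldr_comp_id: "foldr (\<lambda>j f. g j \<circ> f) js h = foldr (\<lambda>j f. g j \<circ> f) js id \<circ> h"
  by (induction js) (simp_all add: o_assoc)

lemma word_map_snoc:
  "word_map T \<omega> a (u @ [i]) y = word_map T \<omega> a u (T (Suc (length u)) i *v y + a $ \<omega> (u @ [i]))"
proof -
  have "foldr (\<lambda>j f. affine_step T \<omega> a (u @ [i]) j \<circ> f) [1..<Suc (length u)] id =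
      foldr (\<lambda>j f. affine_step T \<omega> a u j \<circ> f) [1..<Suc (length u)] id"
    by (rule foldr_cong) (auto simp: affine_step_def[abs_def] nth_append)
  moreover have "affine_step T \<omega> a (u @ [i]) (Suc (length u)) y = T (Suc (length u)) i *v y + a $ \<omega> (u @ [i])"
    by (simp add: affine_step_def nth_append)
  ultimately show ?thesis
    unfolding word_map_def by (simp add: foldr_comp_id[where h = "affine_step T \<omega> a (u @ [i]) (Suc (length u))"])
qed

lemma word_map_Nil: "word_map T \<omega> a [] y = y"
  by (simp add: word_map_def)

lemma foldr_matrix_mult:
  fixes M :: "real^'d^'d"
  shows "foldr (\<lambda>j A. g j ** A) js M = foldr (\<lambda>j A. g j ** A) js (mat 1) ** M"
  by (induction js) (simp_all add: matrix_mul_assoc)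

lemma word_matrix_snoc:
  fixes T :: "nat \<Rightarrow> nat \<Rightarrow> real^'d^'d"
  shows "word_matrix T (u @ [i]) = word_matrix T u ** T (Suc (length u)) i"
proof -
  have "foldr (\<lambda>j A. T j ((u @ [i]) ! (j - 1)) ** A) [1..<Suc (length u)] (mat 1) =
      foldr (\<lambda>j A. T j (u ! (j - 1)) ** A) [1..<Suc (length u)] (mat 1)"
    by (rule foldr_cong) (auto simp: nth_append)
  then show ?thesis
    unfolding word_matrix_def
    by (simp add: nth_append foldr_matrix_mult[where M = "T (Suc (length u)) i"])
qed

lemma word_matrix_Nil: "word_matrix T [] = mat 1"
  by (simp add: word_matrix_def)

lemma word_map_diff:
  fixes T :: "nat \<Rightarrow> nat \<Rightarrow> real^'d^'d"
  shows "word_map T \<omega> a u y - word_map T \<omega> a u z = word_matrix T u *v (y - z)"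
proof (induction u arbitrary: y z rule: rev_induct)
  case (snoc i u)
  show ?case
    unfolding word_map_snoc snoc word_matrix_snoc
    by (simp add: matrix_vector_mul_assoc[symmetric] matrix_vector_mult_diff_distrib)
qed (simp add: word_map_Nil word_matrix_Nil)

primrec tail_prod :: "(nat \<Rightarrow> nat \<Rightarrow> real^'d^'d) \<Rightarrow> nat \<Rightarrow> (nat \<Rightarrow> nat) \<Rightarrow> nat \<Rightarrow> real^'d \<Rightarrow> real^'d" where
  "tail_prod T 0 x k v = v"
| "tail_prod T (Suc j) x k v = T (Suc k) (x (Suc k)) *v tail_prod T j x (Suc k) v"

text \<open>The projection of the word with the first \<open>k\<close> letters removed, so that
  \<open>\<Pi>\<^sup>a x = word_map T \<omega> a (prefix_of x k) (tail_point T \<omega> a x k)\<close>.\<close>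

definition tail_point :: "(nat \<Rightarrow> nat \<Rightarrow> real^'d^'d) \<Rightarrow> (nat list \<Rightarrow> 't) \<Rightarrow> real^'d^'t \<Rightarrow>
    (nat \<Rightarrow> nat) \<Rightarrow> nat \<Rightarrow> real^'d" where
  "tail_point T \<omega> a x k = (\<Sum>j. tail_prod T j x k (a $ \<omega> (prefix_of x (Suc (k + j)))))"

lemma linear_tail_prod: "linear (tail_prod T j x k)"
proof (induction j arbitrary: k)
  case (Suc j)
  have "linear ((*v) (T (Suc k) (x (Suc k))) \<circ> tail_prod T j x (Suc k))"
    by (rule linear_compose[OF Suc]) simp
  then show ?case by (simp add: o_def)
qed (auto intro: linearI)

locale contracting_system =
  fixes n :: "nat \<Rightarrow> nat"
    and T :: "nat \<Rightarrow> nat \<Rightarrow> real^'d^'d"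
    and \<omega> :: "nat list \<Rightarrow> 't::finite"
    and p :: "nat \<Rightarrow> nat \<Rightarrow> real"
    and \<rho> :: real
  assumes invertible_T: "\<And>k j. 1 \<le> k \<Longrightarrow> j \<in> {1..n k} \<Longrightarrow> invertible (T k j)"
    and siblings: "distinct_siblings n \<omega>"
    and prob_vectors: "prob_vectors n p"
    and rho: "0 < \<rho>" "\<rho> < 1 / 2"
    and norm_T: "\<And>k j x. 1 \<le> k \<Longrightarrow> j \<in> {1..n k} \<Longrightarrow> norm (T k j *v x) \<le> \<rho> * norm x"
begin

lemma word_matrix_norm_le:
  "u \<in> words n k \<Longrightarrow> norm (word_matrix T u *v x) \<le> \<rho> ^ k * norm x"
proof (induction k arbitrary: u x)
  case (Suc k)
  obtain v i where u: "u = v @ [i]" "v \<in> words n k" "i \<in> {1..n (Suc k)}"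
    using words_SucE[OF Suc.prems] by blast
  have "norm (word_matrix T u *v x) = norm (word_matrix T v *v (T (Suc k) i *v x))"
    using u length_words[OF u(2)] by (simp add: word_matrix_snoc matrix_vector_mul_assoc)
  also have "\<dots> \<le> \<rho> ^ k * norm (T (Suc k) i *v x)" by (rule Suc.IH[OF u(2)])
  also have "\<dots> \<le> \<rho> ^ k * (\<rho> * norm x)"
    using norm_T[of "Suc k" i x] u(3) rho by (intro mult_left_mono) auto
  finally show ?case by (simp add: mult_ac)
qed (auto simp: words_0 word_matrix_Nil)

lemma invertible_word_matrix: "u \<in> words n k \<Longrightarrow> invertible (word_matrix T u)"
proof (induction k arbitrary: u)
  case 0
  then show ?case by (auto simp: words_0 word_matrix_Nil invertible_def intro: exI[of _ "mat 1"])
next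
  case (Suc k)
  obtain v i where u: "u = v @ [i]" "v \<in> words n k" "i \<in> {1..n (Suc k)}"
    using words_SucE[OF Suc.prems] by blast
  then show ?case using invertible_T[of "Suc k" i] Suc.IH[OF u(2)] length_words[OF u(2)]
    by (simp add: word_matrix_snoc invertible_mult)
qed

lemma word_matrix_singular_value:
  assumes "u \<in> words n k" "i \<in> {1..CARD('d)}"
  shows "0 < singular_value i (word_matrix T u)" "singular_value i (word_matrix T u) \<le> \<rho> ^ k"
    "singular_value i (word_matrix T u) \<le> 1"
proof -
  show "0 < singular_value i (word_matrix T u)"
    using invertible_word_matrix[OF assms(1)] assms(2) by (rule singular_value_pos)
  show *: "singular_value i (word_matrix T u) \<le> \<rho> ^ k"
    using word_matrix_norm_le[OF assms(1)] assms(2) by (rule singular_value_le)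
  have "\<rho> ^ k \<le> 1" using rho by (intro power_le_one) auto
  with * show "singular_value i (word_matrix T u) \<le> 1" by simp
qed

lemma inf_words_letter: "x \<in> inf_words n \<Longrightarrow> 1 \<le> k \<Longrightarrow> x k \<in> {1..n k}"
  by (auto simp: inf_words_def PiE_iff)

lemma norm_tail_prod_le:
  assumes "x \<in> inf_words n"
  shows "norm (tail_prod T j x k v) \<le> \<rho> ^ j * norm v"
proof (induction j arbitrary: k)
  case (Suc j)
  have "norm (tail_prod T (Suc j) x k v) \<le> \<rho> * norm (tail_prod T j x (Suc k) v)"
    using norm_T[of "Suc k" "x (Suc k)"] inf_words_letter[OF assms, of "Suc k"] by simp
  also have "\<dots> \<le> \<rho> * (\<rho> ^ j * norm v)" using Suc rho by (intro mult_left_mono) auto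
  finally show ?case by simp
qed simp

lemma geometric_rho: "summable (\<lambda>j. \<rho> ^ j * c)" "(\<Sum>j. \<rho> ^ j * c) = c / (1 - \<rho>)"
proof -
  have "(\<lambda>j. \<rho> ^ j * c) sums (1 / (1 - \<rho>) * c)"
    using rho by (intro sums_mult2 geometric_sums) auto
  then show "summable (\<lambda>j. \<rho> ^ j * c)" "(\<Sum>j. \<rho> ^ j * c) = c / (1 - \<rho>)"
    by (auto simp: sums_iff)
qed

lemma summable_tail_point:
  assumes "x \<in> inf_words n"
  shows "summable (\<lambda>j. tail_prod T j x k (a $ \<omega> (prefix_of x (Suc (k + j)))))"
    "norm (tail_point T \<omega> a x k) \<le> norm a / (1 - \<rho>)"
proof -
  have b: "norm (tail_prod T j x k (a $ \<omega> (prefix_of x (Suc (k + j))))) \<le> \<rho> ^ j * norm a" for j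
  proof -
    have "norm (tail_prod T j x k (a $ \<omega> (prefix_of x (Suc (k + j)))))
        \<le> \<rho> ^ j * norm (a $ \<omega> (prefix_of x (Suc (k + j))))"
      by (rule norm_tail_prod_le[OF assms])
    also have "\<dots> \<le> \<rho> ^ j * norm a"
      using rho by (intro mult_left_mono) (auto simp: Finite_Cartesian_Product.norm_nth_le)
    finally show ?thesis .
  qed
  show "summable (\<lambda>j. tail_prod T j x k (a $ \<omega> (prefix_of x (Suc (k + j)))))"
    by (rule summable_comparison_test'[OF geometric_rho(1), of 0]) (use b in auto)
  have "norm (tail_point T \<omega> a x k) \<le> (\<Sum>j. \<rho> ^ j * norm a)"
    unfolding tail_point_def by (rule norm_suminf_le[OF b geometric_rho(1)])
  then show "norm (tail_point T \<omega> a x k) \<le> norm a / (1 - \<rho>)"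
    by (simp add: geometric_rho(2))
qed

lemma tail_point_unfold:
  assumes "x \<in> inf_words n"
  shows "tail_point T \<omega> a x k = a $ \<omega> (prefix_of x (Suc k)) + T (Suc k) (x (Suc k)) *v tail_point T \<omega> a x (Suc k)"
proof -
  have "tail_point T \<omega> a x k = a $ \<omega> (prefix_of x (Suc k)) +
     (\<Sum>j. tail_prod T (Suc j) x k (a $ \<omega> (prefix_of x (Suc (k + Suc j)))))"
    using suminf_split_head[OF summable_tail_point(1)[OF assms, of k a]] by (simp add: tail_point_def)
  also have "(\<Sum>j. tail_prod T (Suc j) x k (a $ \<omega> (prefix_of x (Suc (k + Suc j))))) =
      (\<Sum>j. T (Suc k) (x (Suc k)) *v tail_prod T j x (Suc k) (a $ \<omega> (prefix_of x (Suc (Suc k + j)))))"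
    by simp
  also have "\<dots> = T (Suc k) (x (Suc k)) *v tail_point T \<omega> a x (Suc k)"
    unfolding tail_point_def
    by (rule bounded_linear.suminf[OF matrix_vector_mul_bounded_linear, symmetric])
      (rule summable_tail_point(1)[OF assms])
  finally show ?thesis .
qed

lemma linear_tail_point:
  assumes "x \<in> inf_words n"
  shows "linear (\<lambda>a. tail_point T \<omega> a x k)"
proof (rule linearI)
  fix a b :: "real^'d^'t" and c :: real
  show "tail_point T \<omega> (a + b) x k = tail_point T \<omega> a x k + tail_point T \<omega> b x k"
    unfolding tail_point_def
    by (subst suminf_add[OF summable_tail_point(1)[OF assms] summable_tail_point(1)[OF assms]])
      (simp add: linear_add[OF linear_tail_prod])
  show "tail_point T \<omega> (c *\<^sub>R a) x k = c *\<^sub>R tail_point T \<omega> a x k"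
    unfolding tail_point_def
    by (subst suminf_scaleR_right[OF summable_tail_point(1)[OF assms]])
      (simp add: linear_cmul[OF linear_tail_prod])
qed

lemma word_map_tail_point:
  assumes "x \<in> inf_words n"
  shows "word_map T \<omega> a (prefix_of x k) (tail_point T \<omega> a x k) = tail_point T \<omega> a x 0"
proof (induction k)
  case 0
  then show ?case by (simp add: prefix_of_def word_map_Nil)
next
  case (Suc k)
  have "length (prefix_of x k) = k" by (simp add: prefix_of_def)
  then show ?case
    using Suc tail_point_unfold[OF assms, of a k] by (simp add: prefix_of_Suc word_map_snoc add.commute)
qed

lemma coding_map_eq_tail_point:
  assumes J: "nonaut_affine n T \<omega> a J" and x: "x \<in> inf_words n"
  shows "coding_map T \<omega> a J x = tail_point T \<omega> a x 0"
proof -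
  have inI: "coding_map T \<omega> a J x \<in> basic_set T \<omega> a J (prefix_of x k)" if "k \<ge> 1" for k
    using theI'[OF coding_map_unique[OF J x]] that unfolding coding_map_def by blast
  obtain B where B: "\<And>z. z \<in> J \<Longrightarrow> norm z \<le> B"
  proof -
    have "bounded J" using J compact_imp_bounded by (auto simp: nonaut_affine_def)
    then show thesis using that by (auto simp: bounded_iff)
  qed
  define C where "C = B + norm a / (1 - \<rho>)"
  have le: "norm (coding_map T \<omega> a J x - tail_point T \<omega> a x 0) \<le> \<rho> ^ k * C" if k: "k \<ge> 1" for k
  proof -
    obtain z where z: "z \<in> J" "coding_map T \<omega> a J x = word_map T \<omega> a (prefix_of x k) z"
      using inI[OF k] by (auto simp: basic_set_def)
    have "norm (coding_map T \<omega> a J x - tail_point T \<omega> a x 0)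
        = norm (word_matrix T (prefix_of x k) *v (z - tail_point T \<omega> a x k))"
      unfolding word_map_diff[symmetric, of T _ _ _ \<omega> a] word_map_tail_point[OF x] z(2) ..
    also have "\<dots> \<le> \<rho> ^ k * norm (z - tail_point T \<omega> a x k)"
      by (rule word_matrix_norm_le[OF prefix_of_words[OF x]])
    also have "\<dots> \<le> \<rho> ^ k * C"
    proof (rule mult_left_mono)
      show "norm (z - tail_point T \<omega> a x k) \<le> C"
        using norm_triangle_ineq4[of z "tail_point T \<omega> a x k"] B[OF z(1)] summable_tail_point(2)[OF x, of a k]
        by (simp add: C_def)
    qed (use rho in simp)
    finally show ?thesis .
  qed
  have "(\<lambda>k. \<rho> ^ k * C) \<longlonglongrightarrow> 0 * C"
    using rho by (intro tendsto_mult_right LIMSEQ_realpow_zero) auto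
  then have "norm (coding_map T \<omega> a J x - tail_point T \<omega> a x 0) \<le> 0 * C"
    by (rule LIMSEQ_le_const) (use le in auto)
  then show ?thesis by simp
qed

section \<open>Transversality\<close>

lemma linear_tail_point_diff:
  assumes "x \<in> inf_words n" "y \<in> inf_words n"
  shows "linear (\<lambda>a. tail_point T \<omega> a x k - tail_point T \<omega> a y k)"
  by (rule linear_compose_sub[OF linear_tail_point[OF assms(1)] linear_tail_point[OF assms(2)]])

lemma tail_point_axis:
  assumes x: "x \<in> inf_words n"
  obtains e :: "'t \<Rightarrow> real" and E :: "'t \<Rightarrow> real^'d \<Rightarrow> real^'d"
  where "\<And>t w. tail_point T \<omega> (axis t w) x k = (if \<omega> (prefix_of x (Suc k)) = t then w else 0) + E t w"
    and "\<And>t w. norm (E t w) \<le> e t * norm w" "\<And>t t'. t \<noteq> t' \<Longrightarrow> e t + e t' \<le> \<rho> / (1 - \<rho>)"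
proof -
  define e where "e = (\<lambda>t. \<Sum>j. \<rho> ^ j * (if \<omega> (prefix_of x (Suc (Suc k + j))) = t then \<rho> else 0))"
  define E where "E = (\<lambda>t w. T (Suc k) (x (Suc k)) *v tail_point T \<omega> (axis t w) x (Suc k))"
  have sm: "summable (\<lambda>j. \<rho> ^ j * (if \<omega> (prefix_of x (Suc (Suc k + j))) = t then \<rho> else 0))" for t
    by (rule summable_comparison_test'[OF geometric_rho(1)[of \<rho>], of 0]) (use rho in auto)
  show ?thesis
  proof (rule that[of E e])
    show "tail_point T \<omega> (axis t w) x k = (if \<omega> (prefix_of x (Suc k)) = t then w else 0) + E t w" for t w
      by (subst tail_point_unfold[OF x]) (simp add: E_def axis_def)
  next
    fix t w
    have "norm (tail_point T \<omega> (axis t w) x (Suc k)) \<le>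
        (\<Sum>j. \<rho> ^ j * (if \<omega> (prefix_of x (Suc (Suc k + j))) = t then \<rho> else 0) * (norm w / \<rho>))"
      unfolding tail_point_def
    proof (rule norm_suminf_le[OF _ summable_mult2[OF sm]])
      fix j
      show "norm (tail_prod T j x (Suc k) (axis t w $ \<omega> (prefix_of x (Suc (Suc k + j)))))
         \<le> \<rho> ^ j * (if \<omega> (prefix_of x (Suc (Suc k + j))) = t then \<rho> else 0) * (norm w / \<rho>)"
        using norm_tail_prod_le[OF x, of j "Suc k" "axis t w $ \<omega> (prefix_of x (Suc (Suc k + j)))"] rho
        by (auto simp: axis_def split: if_splits)
    qed
    also have "\<dots> = e t * (norm w / \<rho>)"
      unfolding e_def by (rule suminf_mult2[OF sm, symmetric])
    finally have "\<rho> * norm (tail_point T \<omega> (axis t w) x (Suc k)) \<le> e t * norm w"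
      using rho by (simp add: field_simps)
    moreover have "norm (E t w) \<le> \<rho> * norm (tail_point T \<omega> (axis t w) x (Suc k))"
      unfolding E_def using inf_words_letter[OF x, of "Suc k"] by (intro norm_T) auto
    ultimately show "norm (E t w) \<le> e t * norm w" by simp
  next
    fix t t' :: 't assume tt: "t \<noteq> t'"
    have "e t + e t' = (\<Sum>j. \<rho> ^ j * (if \<omega> (prefix_of x (Suc (Suc k + j))) = t then \<rho> else 0) +
        \<rho> ^ j * (if \<omega> (prefix_of x (Suc (Suc k + j))) = t' then \<rho> else 0))"
      unfolding e_def by (rule suminf_add[OF sm sm])
    also have "\<dots> \<le> (\<Sum>j. \<rho> ^ j * \<rho>)"
      by (rule suminf_le[OF _ summable_add[OF sm sm] geometric_rho(1)]) (use tt rho in auto)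
    finally show "e t + e t' \<le> \<rho> / (1 - \<rho>)" by (simp add: geometric_rho(2))
  qed
qed

definition \<kappa> :: real where "\<kappa> = \<rho> / (1 - \<rho>)"

lemma kappa: "0 < \<kappa>" "\<kappa> < 1"
  using rho by (auto simp: \<kappa>_def divide_less_eq)

text \<open>The perturbations of the two identity blocks of the linear map have total norm at most
  \<open>2 * \<kappa>\<close>, since each level of each word contributes to one of them only. Hence one of them has
  norm at most \<open>\<kappa> < 1\<close>: this is where the bound \<open>1 / 2\<close> on the norms is needed.\<close>

lemma transversality:
  assumes x: "x \<in> inf_words n" and y: "y \<in> inf_words n"
    and pre: "prefix_of x k = prefix_of y k" and ne: "x (Suc k) \<noteq> y (Suc k)"
  shows "\<exists>t. \<forall>w. (1 - \<kappa>) * norm w \<le>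
    norm (tail_point T \<omega> (axis t w) x k - tail_point T \<omega> (axis t w) y k)"
proof -
  obtain e E where E: "\<And>t w. tail_point T \<omega> (axis t w) x k = (if \<omega> (prefix_of x (Suc k)) = t then w else 0) + E t w"
    and Ee: "\<And>t w. norm (E t w) \<le> e t * norm w" and e: "\<And>t t'. t \<noteq> t' \<Longrightarrow> e t + e t' \<le> \<rho> / (1 - \<rho>)"
    by (rule tail_point_axis[OF x, of k]) (rule that; assumption)
  obtain f F where F: "\<And>t w. tail_point T \<omega> (axis t w) y k = (if \<omega> (prefix_of y (Suc k)) = t then w else 0) + F t w"
    and Ff: "\<And>t w. norm (F t w) \<le> f t * norm w" and f: "\<And>t t'. t \<noteq> t' \<Longrightarrow> f t + f t' \<le> \<rho> / (1 - \<rho>)"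
    by (rule tail_point_axis[OF y, of k]) (rule that; assumption)
  define s t where "s = \<omega> (prefix_of x (Suc k))" and "t = \<omega> (prefix_of y (Suc k))"
  have st: "s \<noteq> t"
    using siblings prefix_of_words[OF x, of k] inf_words_letter[OF x, of "Suc k"]
      inf_words_letter[OF y, of "Suc k"] ne
    unfolding s_def t_def prefix_of_Suc pre[symmetric] distinct_siblings_def by auto
  have bound: "(1 - \<kappa>) * norm w \<le> norm (w + (E r w - F r w))" "(1 - \<kappa>) * norm w \<le> norm (- w + (E r w - F r w))"
    if "e r + f r \<le> \<kappa>" for r w
  proof -
    have "norm (E r w - F r w) \<le> norm (E r w) + norm (F r w)" by (rule norm_triangle_ineq4)
    also have "\<dots> \<le> (e r + f r) * norm w" using Ee[of r w] Ff[of r w] by (simp add: distrib_right)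
    also have "\<dots> \<le> \<kappa> * norm w" using that by (intro mult_right_mono) auto
    finally have *: "norm (E r w - F r w) \<le> \<kappa> * norm w" .
    have "norm w \<le> norm (w + (E r w - F r w)) + norm (E r w - F r w)"
      using norm_triangle_ineq4[of "w + (E r w - F r w)" "E r w - F r w"] by simp
    then show "(1 - \<kappa>) * norm w \<le> norm (w + (E r w - F r w))" using * by (simp add: left_diff_distrib)
    have "norm (- w) \<le> norm (- w + (E r w - F r w)) + norm (E r w - F r w)"
      using norm_triangle_ineq4[of "- w + (E r w - F r w)" "E r w - F r w"] by simp
    then show "(1 - \<kappa>) * norm w \<le> norm (- w + (E r w - F r w))" using * by (simp add: left_diff_distrib)
  qed
  have "e s + f s \<le> \<kappa> \<or> e t + f t \<le> \<kappa>" using e[OF st] f[OF st] by (auto simp: \<kappa>_def)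
  then show ?thesis
  proof
    assume "e s + f s \<le> \<kappa>"
    then have "(1 - \<kappa>) * norm w \<le> norm (tail_point T \<omega> (axis s w) x k - tail_point T \<omega> (axis s w) y k)" for w
      using bound(1)[of s w] st by (simp add: E F s_def[symmetric] t_def[symmetric] algebra_simps)
    then show ?thesis by blast
  next
    assume "e t + f t \<le> \<kappa>"
    then have "(1 - \<kappa>) * norm w \<le> norm (tail_point T \<omega> (axis t w) x k - tail_point T \<omega> (axis t w) y k)" for w
      using bound(2)[of t w] st by (simp add: E F s_def[symmetric] t_def[symmetric] algebra_simps)
    then show ?thesis by blast
  qed
qed

lemma emeasure_close_le_prod:
  assumes x: "x \<in> inf_words n" and y: "y \<in> inf_words n"
    and pre: "prefix_of x k = prefix_of y k" and ne: "x (Suc k) \<noteq> y (Suc k)"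
    and I: "I \<subseteq> {1..CARD('d)}" and r: "r > 0" and R: "R \<ge> 0"
  shows "emeasure lborel {a \<in> cball 0 R. dist (tail_point T \<omega> a x 0) (tail_point T \<omega> a y 0) \<le> r}
     \<le> ennreal (\<Prod>i\<in>I. r / singular_value i (word_matrix T (prefix_of x k)))
        * emeasure lborel (cball (0 :: real^'d^'t) (R + real CARD('d) / (1 - \<kappa>)))"
proof -
  define A where "A = word_matrix T (prefix_of x k)"
  define D where "D = (\<lambda>a. tail_point T \<omega> a x k - tail_point T \<omega> a y k)"
  have linD: "linear D" unfolding D_def by (rule linear_tail_point_diff[OF x y])
  have diff: "tail_point T \<omega> a x 0 - tail_point T \<omega> a y 0 = A *v D a" for a
    unfolding A_def D_def word_map_diff[symmetric, of T _ _ _ \<omega> a] word_map_tail_point[OF x]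
    unfolding pre word_map_tail_point[OF y] ..
  obtain t where t: "\<And>w. (1 - \<kappa>) * norm w \<le> norm (D (axis t w))"
    using transversality[OF x y pre ne] unfolding D_def by blast
  define G where "G = (\<lambda>w. D (axis t w))"
  have axis: "linear (axis t :: real^'d \<Rightarrow> real^'d^'t)"
    by (rule linearI) (auto simp: axis_def vec_eq_iff)
  have linG: "linear G" unfolding G_def using linear_compose[OF axis linD] by (simp add: o_def)
  have "inj G"
  proof (subst linear_injective_0[OF linG], safe)
    fix w assume "G w = 0"
    then have "(1 - \<kappa>) * norm w \<le> 0" using t[of w] by (simp add: G_def)
    then show "w = 0" using kappa by (simp add: mult_le_0_iff)
  qed
  then have "surj G" using linG linear_injective_imp_surjective by blast
  obtain v :: "nat \<Rightarrow> real^'d" where v: "\<And>i. i \<in> {1..CARD('d)} \<Longrightarrow> norm (v i) = 1"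
    "\<And>i. i \<in> {1..CARD('d)} \<Longrightarrow> norm (A *v v i) = singular_value i A"
    "\<And>i j. i \<in> {1..CARD('d)} \<Longrightarrow> j \<in> {1..CARD('d)} \<Longrightarrow> i \<noteq> j \<Longrightarrow> v i \<bullet> v j = 0"
    "\<And>i x. i \<in> {1..CARD('d)} \<Longrightarrow> (A *v v i) \<bullet> (A *v x) = (singular_value i A)\<^sup>2 * (v i \<bullet> x)"
    by (rule singular_value_decomposition[of A]) (rule that; assumption)
  define b where "b = (\<lambda>i. axis t (inv G (v i)) :: real^'d^'t)"
  have Db: "D (b i) = v i" for i
    using surj_f_inv_f[OF \<open>surj G\<close>, of "v i"] by (simp add: b_def G_def)
  have pos: "singular_value i A > 0" if "i \<in> I" for i
    using word_matrix_singular_value(1)[OF prefix_of_words[OF x, of k]] I that by (auto simp: A_def)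
  define \<phi> where "\<phi> = (\<lambda>i a. ((A *v v i) \<bullet> (A *v D a)) / singular_value i A)"
  have lin\<phi>: "linear (\<phi> i)" for i
    by (rule linearI) (simp_all add: \<phi>_def linear_add[OF linD] linear_cmul[OF linD]
        matrix_vector_right_distrib matrix_vector_mult_scaleR inner_add_right add_divide_distrib)
  have "emeasure lborel {a \<in> cball 0 R. dist (tail_point T \<omega> a x 0) (tail_point T \<omega> a y 0) \<le> r}
     \<le> emeasure lborel {a \<in> cball 0 R. \<forall>i\<in>I. \<bar>\<phi> i a - 0\<bar> \<le> r}"
  proof (rule emeasure_mono)
    show "{a \<in> cball 0 R. dist (tail_point T \<omega> a x 0) (tail_point T \<omega> a y 0) \<le> r}
        \<subseteq> {a \<in> cball 0 R. \<forall>i\<in>I. \<bar>\<phi> i a - 0\<bar> \<le> r}"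
    proof (intro subsetI CollectI conjI ballI)
      fix a i assume a: "a \<in> {a \<in> cball 0 R. dist (tail_point T \<omega> a x 0) (tail_point T \<omega> a y 0) \<le> r}"
        and i: "i \<in> I"
      have i': "i \<in> {1..CARD('d)}" using i I by auto
      have "\<bar>(A *v v i) \<bullet> (A *v D a)\<bar> \<le> singular_value i A * norm (A *v D a)"
        using Cauchy_Schwarz_ineq2[of "A *v v i" "A *v D a"] v(2)[OF i'] by simp
      also have "\<dots> \<le> singular_value i A * r"
        using a pos[OF i] by (intro mult_left_mono) (auto simp: dist_norm diff)
      finally show "\<bar>\<phi> i a - 0\<bar> \<le> r" using pos[OF i] by (simp add: \<phi>_def divide_le_eq mult.commute)
    qed auto
    show "{a \<in> cball 0 R. \<forall>i\<in>I. \<bar>\<phi> i a - 0\<bar> \<le> r} \<in> sets lborel"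
      using closed_slab_intersection[of I \<phi> 0 R "\<lambda>_. 0" "\<lambda>_. r"] lin\<phi> by (simp add: borel_closed)
  qed
  also have "\<dots> \<le> ennreal (\<Prod>i\<in>I. r / singular_value i A) *
      emeasure lborel (cball (0 :: real^'d^'t) (R + real (card I) * (1 / (1 - \<kappa>))))"
  proof (rule emeasure_slab_intersection_le)
    show "finite I" using I finite_subset by blast
    show "norm (b i) \<le> 1 / (1 - \<kappa>)" if "i \<in> I" for i
    proof -
      have "(1 - \<kappa>) * norm (inv G (v i)) \<le> norm (D (b i))" unfolding b_def by (rule t)
      also have "\<dots> = 1" using v(1)[of i] that I by (auto simp: Db)
      finally show ?thesis using kappa by (simp add: b_def norm_eq_sqrt_inner inner_axis field_simps)
    qed
    show "\<phi> i (b i) = singular_value i A" if "i \<in> I" for i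
      using v(2)[of i] that I pos[OF that] by (auto simp: \<phi>_def Db dot_square_norm power2_eq_square)
    show "\<phi> i (b j) = 0" if "i \<in> I" "j \<in> I" "i \<noteq> j" for i j
      using v(3)[OF subsetD[OF I] subsetD[OF I]] v(4)[OF subsetD[OF I]] that by (simp add: \<phi>_def Db)
  qed (use pos r lin\<phi> in auto)
  also have "\<dots> \<le> ennreal (\<Prod>i\<in>I. r / singular_value i A) *
      emeasure lborel (cball (0 :: real^'d^'t) (R + real CARD('d) / (1 - \<kappa>)))"
  proof (intro mult_left_mono emeasure_mono cball_subset_cball_iff[THEN iffD2] disjI1)
    have "card I \<le> CARD('d)" using card_mono[OF _ I] by simp
    then show "dist (0 :: real^'d^'t) 0 + (R + real (card I) * (1 / (1 - \<kappa>))) \<le> R + real CARD('d) / (1 - \<kappa>)"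
      using kappa by (simp add: divide_right_mono)
  qed auto
  finally show ?thesis unfolding A_def .
qed

definition param_volume :: "real \<Rightarrow> real" where
  "param_volume R = measure lborel (cball (0 :: real^'d^'t) (R + real CARD('d) / (1 - \<kappa>)))"

lemma emeasure_close_le_sv_fun:
  assumes x: "x \<in> inf_words n" and y: "y \<in> inf_words n"
    and pre: "prefix_of x k = prefix_of y k" and ne: "x (Suc k) \<noteq> y (Suc k)"
    and s: "0 < s" "s \<le> real CARD('d)" and r: "r > 0" and R: "R \<ge> 0"
  shows "emeasure lborel {a \<in> cball 0 R. dist (tail_point T \<omega> a x 0) (tail_point T \<omega> a y 0) \<le> r}
     \<le> ennreal (param_volume R * (r powr s / sv_fun s (word_matrix T (prefix_of x k))))"
proof -
  define A where "A = word_matrix T (prefix_of x k)"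
  define m where "m = nat \<lceil>s\<rceil>"
  define \<theta> where "\<theta> = s - real m + 1"
  have m: "m \<in> {1..CARD('d)}" "0 < \<theta>" "\<theta> \<le> 1"
    using nat_ceiling_bounds[OF s] by (auto simp: m_def \<theta>_def)
  define V where "V = param_volume R"
  have V: "emeasure lborel (cball (0 :: real^'d^'t) (R + real CARD('d) / (1 - \<kappa>))) = ennreal V"
    unfolding V_def param_volume_def
    using emeasure_bounded_finite[OF bounded_cball, of "0 :: real^'d^'t" "R + real CARD('d) / (1 - \<kappa>)"]
    by (intro emeasure_eq_ennreal_measure) auto
  have V0: "V \<ge> 0" by (simp add: V_def param_volume_def)
  have pos: "singular_value i A > 0" if "i \<in> {1..CARD('d)}" for i
    using word_matrix_singular_value(1)[OF prefix_of_words[OF x, of k] that] by (simp add: A_def)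
  define P where "P = (\<Prod>i\<in>{1..m - 1}. r / singular_value i A)"
  define z where "z = r / singular_value m A"
  have z: "z > 0" using pos[OF m(1)] r by (simp add: z_def)
  have P: "P > 0" unfolding P_def using pos r m(1) by (intro prod_pos) auto
  have "{1..m} = insert m {1..m - 1}" "m \<notin> {1..m - 1}" using m(1) by auto
  then have Pm: "(\<Prod>i\<in>{1..m}. r / singular_value i A) = z * P"
    by (simp add: P_def z_def)
  let ?S = "{a \<in> cball 0 R. dist (tail_point T \<omega> a x 0) (tail_point T \<omega> a y 0) \<le> r}"
  have 1: "emeasure lborel ?S \<le> ennreal (P * V)"
  proof -
    have "{1..m - 1} \<subseteq> {1..CARD('d)}" using m(1) by auto
    from emeasure_close_le_prod[OF x y pre ne this r R, unfolded V, folded A_def, folded P_def] P V0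
    show ?thesis by (simp add: ennreal_mult)
  qed
  have 2: "emeasure lborel ?S \<le> ennreal (z * P * V)"
  proof -
    have "{1..m} \<subseteq> {1..CARD('d)}" using m(1) by auto
    from emeasure_close_le_prod[OF x y pre ne this r R, unfolded V, folded A_def, unfolded Pm] P V0 z
    show ?thesis by (simp add: ennreal_mult)
  qed
  have "emeasure lborel ?S \<le> ennreal (z powr \<theta> * P * V)"
  proof (cases "z \<le> 1")
    case True
    have "z powr 1 \<le> z powr \<theta>" using z True m by (intro powr_mono') auto
    then have "z * P * V \<le> z powr \<theta> * P * V" using z P V0 by (intro mult_right_mono) auto
    with 2 show ?thesis by (meson ennreal_leI order_trans)
  next
    case False
    then have "1 \<le> z powr \<theta>" using m by (intro ge_one_powr_ge_zero) auto
    then have "P * V \<le> z powr \<theta> * P * V"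
      using mult_right_mono[of 1 "z powr \<theta>" "P * V"] P V0 by (simp add: mult.assoc)
    with 1 show ?thesis by (meson ennreal_leI order_trans)
  qed
  also have "z powr \<theta> * P * V = V * (r powr s / sv_fun s A)"
  proof -
    have "P = r ^ (m - 1) / (\<Prod>i = 1..m - 1. singular_value i A)"
      unfolding P_def by (simp add: prod_dividef)
    moreover have "r ^ (m - 1) = r powr (real m - 1)"
      using m(1) r by (simp add: powr_realpow[symmetric] of_nat_diff)
    moreover have "z powr \<theta> = r powr \<theta> / singular_value m A powr \<theta>"
      using pos[OF m(1)] r by (simp add: z_def powr_divide)
    moreover have "r powr (real m - 1) * r powr \<theta> = r powr s"
      by (simp add: powr_add[symmetric] \<theta>_def)
    ultimately show ?thesis
      unfolding sv_fun_eq[OF s m_def] \<theta>_def[symmetric] by (simp add: field_simps)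
  qed
  finally show ?thesis unfolding V_def A_def .
qed

section \<open>Measurability\<close>

abbreviation \<mu> :: "(nat \<Rightarrow> nat) measure" where "\<mu> \<equiv> bernoulli_measure n p"

lemma prob_space_bernoulli: "prob_space \<mu>"
  unfolding bernoulli_measure_def
proof (rule prob_space_PiM)
  fix k :: nat assume k: "k \<in> {1..}"
  show "prob_space (point_measure {1..n k} (\<lambda>i. ennreal (p k i)))"
  proof (rule prob_spaceI)
    have *: "\<forall>i\<in>{1..n k}. 0 \<le> p k i" "(\<Sum>i = 1..n k. p k i) = 1"
      using prob_vectors k by (auto simp: prob_vectors_def)
    then have "(\<Sum>i = 1..n k. ennreal (p k i)) = 1"
      by (subst sum_ennreal) auto
    then show "emeasure (point_measure {1..n k} (\<lambda>i. ennreal (p k i)))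
        (space (point_measure {1..n k} (\<lambda>i. ennreal (p k i)))) = 1"
      by (simp add: space_point_measure emeasure_point_measure_finite)
  qed
qed

sublocale mu: prob_space \<mu> by (rule prob_space_bernoulli)

lemma space_mu: "space \<mu> = inf_words n"
  by (rule space_bernoulli_measure)

lemma measurable_letter[measurable]: "(\<lambda>x. x (Suc k)) \<in> measurable \<mu> (count_space UNIV)"
proof -
  have "(\<lambda>x. x (Suc k)) \<in> measurable \<mu> (point_measure {1..n (Suc k)} (\<lambda>i. ennreal (p (Suc k) i)))"
    unfolding bernoulli_measure_def by (rule measurable_component_singleton) simp
  moreover have "(\<lambda>i. i) \<in> measurable (point_measure {1..n (Suc k)} (\<lambda>i. ennreal (p (Suc k) i))) (count_space UNIV)"
    by (simp add: measurable_def space_point_measure sets_point_measure)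
  ultimately show ?thesis by (rule measurable_compose)
qed

lemma measurable_prefix_of[measurable]: "(\<lambda>x. prefix_of x k) \<in> measurable \<mu> (count_space UNIV)"
proof (induction k)
  case (Suc k)
  have "(\<lambda>x. u @ [x (Suc k)]) \<in> measurable \<mu> (count_space UNIV)" for u :: "nat list"
    by (rule measurable_compose[OF measurable_letter]) simp
  from measurable_compose_countable[OF this Suc] show ?case by (simp add: prefix_of_Suc)
qed (simp add: prefix_of_def)

lemma sets_cylinder[measurable]: "cylinder n u \<in> sets \<mu>"
proof -
  have "{x \<in> space \<mu>. prefix_of x (length u) = u} \<in> sets \<mu>" by measurable
  then show ?thesis by (simp add: cylinder_def space_mu)
qed

lemma nn_integral_prefix_of:
  assumes "\<And>u. u \<in> words n k \<Longrightarrow> 0 \<le> h u"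
  shows "(\<integral>\<^sup>+x. ennreal (h (prefix_of x k)) \<partial>\<mu>) = ennreal (\<Sum>u\<in>words n k. h u * measure \<mu> (cylinder n u))"
proof -
  have "(\<integral>\<^sup>+x. ennreal (h (prefix_of x k)) \<partial>\<mu>) =
      (\<integral>\<^sup>+x. (\<Sum>u\<in>words n k. ennreal (h u) * indicator (cylinder n u) x) \<partial>\<mu>)"
  proof (rule nn_integral_cong)
    fix x assume "x \<in> space \<mu>"
    then have x: "x \<in> inf_words n" by (simp add: space_mu)
    have "(\<Sum>u\<in>words n k. ennreal (h u) * indicator (cylinder n u) x) =
        (\<Sum>u\<in>words n k. if u = prefix_of x k then ennreal (h u) else 0)"
      using x by (intro sum.cong refl) (auto simp: cylinder_def indicator_def length_words)
    then show "ennreal (h (prefix_of x k)) = (\<Sum>u\<in>words n k. ennreal (h u) * indicator (cylinder n u) x)"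
      using prefix_of_words[OF x, of k] by (simp add: finite_words)
  qed
  also have "\<dots> = (\<Sum>u\<in>words n k. ennreal (h u) * emeasure \<mu> (cylinder n u))"
    by (subst nn_integral_sum) (simp_all add: nn_integral_cmult_indicator)
  also have "\<dots> = (\<Sum>u\<in>words n k. ennreal (h u * measure \<mu> (cylinder n u)))"
    using assms by (intro sum.cong refl) (simp add: mu.emeasure_eq_measure ennreal_mult)
  also have "\<dots> = ennreal (\<Sum>u\<in>words n k. h u * measure \<mu> (cylinder n u))"
    using assms by (intro sum_ennreal) simp
  finally show ?thesis .
qed

lemma measurable_tail_prod:
  assumes X: "X \<in> measurable N \<mu>" and g: "g \<in> borel_measurable N"
  shows "(\<lambda>z. tail_prod T j (X z) k (g z)) \<in> borel_measurable N"
proof (induction j arbitrary: k)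
  case (Suc j)
  have "(\<lambda>z. T (Suc k) i *v tail_prod T j (X z) (Suc k) (g z)) \<in> borel_measurable N" for i
    by (rule measurable_compose[OF Suc])
      (intro borel_measurable_continuous_onI linear_continuous_on matrix_vector_mul_bounded_linear)
  from measurable_compose_countable[OF this measurable_compose[OF X measurable_letter]]
  show ?case by simp
qed (simp add: g)

lemma measurable_tail_point:
  assumes A: "A \<in> borel_measurable N" and X: "X \<in> measurable N \<mu>"
  shows "(\<lambda>z. tail_point T \<omega> (A z) (X z) k) \<in> borel_measurable N"
  unfolding tail_point_def
proof (intro borel_measurable_suminf measurable_tail_prod X)
  fix j
  have "(\<lambda>z. A z $ \<omega> u) \<in> borel_measurable N" for u
    by (rule measurable_compose[OF A]) (intro borel_measurable_continuous_onI continuous_intros)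
  from measurable_compose_countable[OF this measurable_compose[OF X measurable_prefix_of]]
  show "(\<lambda>z. A z $ \<omega> (prefix_of (X z) (Suc (k + j)))) \<in> borel_measurable N" .
qed

definition \<pi> :: "real^'d^'t \<Rightarrow> (nat \<Rightarrow> nat) \<Rightarrow> real^'d" where
  "\<pi> a x = tail_point T \<omega> a x 0"

lemma measurable_\<pi>[measurable (raw)]:
  "A \<in> borel_measurable N \<Longrightarrow> X \<in> measurable N \<mu> \<Longrightarrow> (\<lambda>z. \<pi> (A z) (X z)) \<in> borel_measurable N"
  unfolding \<pi>_def by (rule measurable_tail_point)

definition close_mass :: "real^'d^'t \<Rightarrow> real \<Rightarrow> (nat \<Rightarrow> nat) \<Rightarrow> real" where
  "close_mass a r x = measure \<mu> {y \<in> space \<mu>. dist (\<pi> a x) (\<pi> a y) \<le> r}"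

definition close_mass_at :: "real^'d^'t \<Rightarrow> real \<Rightarrow> nat \<Rightarrow> (nat \<Rightarrow> nat) \<Rightarrow> real" where
  "close_mass_at a r k x = measure \<mu> {y \<in> space \<mu>.
     prefix_of x k = prefix_of y k \<and> x (Suc k) \<noteq> y (Suc k) \<and> dist (\<pi> a x) (\<pi> a y) \<le> r}"

lemma measurable_close_mass:
  "(\<lambda>z. close_mass (fst z) r (snd z)) \<in> borel_measurable (borel \<Otimes>\<^sub>M \<mu>)"
proof -
  have "(\<lambda>z. emeasure \<mu> {y \<in> space \<mu>. dist (\<pi> (fst z) (snd z)) (\<pi> (fst z) y) \<le> r})
      \<in> borel_measurable (borel \<Otimes>\<^sub>M \<mu>)"
  proof (rule mu.measurable_emeasure)
    have "{w \<in> space ((borel \<Otimes>\<^sub>M \<mu>) \<Otimes>\<^sub>M \<mu>).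
        dist (\<pi> (fst (fst w)) (snd (fst w))) (\<pi> (fst (fst w)) (snd w)) \<le> r}
      \<in> sets ((borel \<Otimes>\<^sub>M \<mu>) \<Otimes>\<^sub>M \<mu>)" by measurable
    also have "{w \<in> space ((borel \<Otimes>\<^sub>M \<mu>) \<Otimes>\<^sub>M \<mu>).
        dist (\<pi> (fst (fst w)) (snd (fst w))) (\<pi> (fst (fst w)) (snd w)) \<le> r} =
      {w \<in> space ((borel \<Otimes>\<^sub>M \<mu>) \<Otimes>\<^sub>M \<mu>).
        snd w \<in> {y \<in> space \<mu>. dist (\<pi> (fst (fst w)) (snd (fst w))) (\<pi> (fst (fst w)) y) \<le> r}}"
      by (auto simp: space_pair_measure)
    finally show "\<dots> \<in> sets ((borel \<Otimes>\<^sub>M \<mu>) \<Otimes>\<^sub>M \<mu>)" .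
  qed auto
  then show ?thesis unfolding close_mass_def measure_def by measurable
qed

lemma measurable_close_mass_param:
  "x \<in> space \<mu> \<Longrightarrow> (\<lambda>a. close_mass a r x) \<in> borel_measurable borel"
  using measurable_compose[OF measurable_Pair2' measurable_close_mass[of r], of x] by simp

lemma sets_close_mass_at:
  assumes x: "x \<in> space \<mu>"
  shows "{z \<in> space (borel \<Otimes>\<^sub>M \<mu>). prefix_of x k = prefix_of (snd z) k \<and> x (Suc k) \<noteq> snd z (Suc k) \<and>
      dist (\<pi> (fst z) x) (\<pi> (fst z) (snd z)) \<le> r} \<in> sets (borel \<Otimes>\<^sub>M \<mu>)"
proof -
  have [measurable]: "(\<lambda>z. x) \<in> measurable (borel \<Otimes>\<^sub>M \<mu>) \<mu>" using x by simp
  have [measurable]: "(\<lambda>z. prefix_of (snd z) k) \<in> measurable (borel \<Otimes>\<^sub>M \<mu>) (count_space UNIV)"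
    "(\<lambda>z. snd z (Suc k)) \<in> measurable (borel \<Otimes>\<^sub>M \<mu>) (count_space UNIV)"
    by (rule measurable_compose[OF measurable_snd], measurable)+
  show ?thesis by measurable
qed

lemma close_mass_le:
  assumes x: "x \<in> space \<mu>"
  shows "close_mass a r x \<le> (\<Sum>k<K. close_mass_at a r k x) + measure \<mu> (cylinder n (prefix_of x K))"
proof -
  have [measurable]: "Measurable.pred \<mu> (\<lambda>y. dist (\<pi> a x) (\<pi> a y) \<le> r)" by measurable
  define A where "A = (\<lambda>k. {y \<in> space \<mu>.
     prefix_of x k = prefix_of y k \<and> x (Suc k) \<noteq> y (Suc k) \<and> dist (\<pi> a x) (\<pi> a y) \<le> r})"
  have A[measurable]: "A k \<in> sets \<mu>" for k unfolding A_def by measurable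
  have "close_mass a r x \<le> measure \<mu> ((\<Union>k<K. A k) \<union> cylinder n (prefix_of x K))"
    unfolding close_mass_def
  proof (rule mu.finite_measure_mono)
    show "{y \<in> space \<mu>. dist (\<pi> a x) (\<pi> a y) \<le> r} \<subseteq> (\<Union>k<K. A k) \<union> cylinder n (prefix_of x K)"
    proof
      fix y assume y: "y \<in> {y \<in> space \<mu>. dist (\<pi> a x) (\<pi> a y) \<le> r}"
      show "y \<in> (\<Union>k<K. A k) \<union> cylinder n (prefix_of x K)"
        using prefix_of_differ[of x K y] y by (auto simp: A_def cylinder_def space_mu)
    qed
  qed measurable
  also have "\<dots> \<le> measure \<mu> (\<Union>k<K. A k) + measure \<mu> (cylinder n (prefix_of x K))"
    by (rule measure_Un_le) auto
  also have "measure \<mu> (\<Union>k<K. A k) \<le> (\<Sum>k<K. measure \<mu> (A k))"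
    by (rule mu.finite_measure_subadditive_finite) auto
  finally show ?thesis by (simp add: close_mass_at_def A_def)
qed

section \<open>The energy estimate\<close>

lemma sets_close_mass_at_fiber:
  "{y \<in> space \<mu>. prefix_of x k = prefix_of y k \<and> x (Suc k) \<noteq> y (Suc k) \<and>
      dist (\<pi> a x) (\<pi> a y) \<le> r} \<in> sets \<mu>"
proof -
  have [measurable]: "Measurable.pred \<mu> (\<lambda>y. dist (\<pi> a x) (\<pi> a y) \<le> r)" by measurable
  show ?thesis by measurable
qed

lemma measurable_close_mass_at:
  assumes x: "x \<in> space \<mu>"
  shows "(\<lambda>a. close_mass_at a r k x) \<in> borel_measurable borel"
proof -
  have "(\<lambda>a. emeasure \<mu> {y \<in> space \<mu>.
     prefix_of x k = prefix_of y k \<and> x (Suc k) \<noteq> y (Suc k) \<and> dist (\<pi> a x) (\<pi> a y) \<le> r}) \<in> borel_measurable borel"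
  proof (rule mu.measurable_emeasure)
    note sets_close_mass_at[OF x, of k r]
    also have "{z \<in> space (borel \<Otimes>\<^sub>M \<mu>). prefix_of x k = prefix_of (snd z) k \<and> x (Suc k) \<noteq> snd z (Suc k) \<and>
        dist (\<pi> (fst z) x) (\<pi> (fst z) (snd z)) \<le> r} =
      {z \<in> space (borel \<Otimes>\<^sub>M \<mu>). snd z \<in> {y \<in> space \<mu>. prefix_of x k = prefix_of y k \<and>
        x (Suc k) \<noteq> y (Suc k) \<and> dist (\<pi> (fst z) x) (\<pi> (fst z) y) \<le> r}}"
      by (auto simp: space_pair_measure)
    finally show "\<dots> \<in> sets (borel \<Otimes>\<^sub>M \<mu>)" .
  qed auto
  then show ?thesis unfolding close_mass_at_def measure_def by (rule measurable_compose) simp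
qed

lemma nn_integral_close_mass_at_le:
  assumes x: "x \<in> space \<mu>" and s: "0 < s" "s \<le> real CARD('d)" and r: "r > 0" and R: "R \<ge> 0"
  shows "(\<integral>\<^sup>+a. indicator (cball 0 R) a * ennreal (close_mass_at a r k x) \<partial>lborel)
    \<le> ennreal (param_volume R * (r powr s / sv_fun s (word_matrix T (prefix_of x k)) *
        measure \<mu> (cylinder n (prefix_of x k))))"
proof -
  interpret P: pair_sigma_finite "lborel :: (real^'d^'t) measure" \<mu> ..
  define S where "S = {z \<in> space (borel \<Otimes>\<^sub>M \<mu>). prefix_of x k = prefix_of (snd z) k \<and>
      x (Suc k) \<noteq> snd z (Suc k) \<and> dist (\<pi> (fst z) x) (\<pi> (fst z) (snd z)) \<le> r}"
  have S: "S \<in> sets (borel \<Otimes>\<^sub>M \<mu>)" unfolding S_def by (rule sets_close_mass_at[OF x])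
  then have [measurable]: "S \<in> sets (lborel \<Otimes>\<^sub>M \<mu>)"
    by (simp cong: sets_pair_measure_cong)
  have xi: "x \<in> inf_words n" using x by (simp add: space_mu)
  define c where "c = param_volume R * (r powr s / sv_fun s (word_matrix T (prefix_of x k)))"
  have sv: "sv_fun s (word_matrix T (prefix_of x k)) > 0"
    by (rule sv_fun_bounds(1)[OF s]) (use word_matrix_singular_value[OF prefix_of_words[OF xi, of k]] in blast)
  have c: "c \<ge> 0" unfolding c_def param_volume_def using sv by simp
  have "(\<integral>\<^sup>+a. indicator (cball 0 R) a * ennreal (close_mass_at a r k x) \<partial>lborel) =
    (\<integral>\<^sup>+a. (\<integral>\<^sup>+y. indicator (cball 0 R) a * indicator S (a, y) \<partial>\<mu>) \<partial>lborel)"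
  proof (rule nn_integral_cong)
    fix a :: "real^'d^'t"
    have "(\<integral>\<^sup>+y. indicator S (a, y) \<partial>\<mu>) = (\<integral>\<^sup>+y. indicator {y \<in> space \<mu>. prefix_of x k = prefix_of y k \<and>
        x (Suc k) \<noteq> y (Suc k) \<and> dist (\<pi> a x) (\<pi> a y) \<le> r} y \<partial>\<mu>)"
      by (intro nn_integral_cong) (auto simp: S_def indicator_def space_pair_measure)
    also have "\<dots> = ennreal (close_mass_at a r k x)"
      unfolding close_mass_at_def using sets_close_mass_at_fiber
      by (simp only: nn_integral_indicator mu.emeasure_eq_measure)
    finally show "indicator (cball 0 R) a * ennreal (close_mass_at a r k x) =
        (\<integral>\<^sup>+y. indicator (cball 0 R) a * indicator S (a, y) \<partial>\<mu>)"
      by (subst nn_integral_cmult) simp_all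
  qed
  also have "\<dots> = (\<integral>\<^sup>+y. (\<integral>\<^sup>+a. indicator (cball 0 R) a * indicator S (a, y) \<partial>lborel) \<partial>\<mu>)"
  proof (rule P.Fubini'[symmetric])
    have "(\<lambda>z. indicator (cball 0 R) (fst z) * indicator S z :: ennreal) \<in> borel_measurable (lborel \<Otimes>\<^sub>M \<mu>)"
    proof (rule borel_measurable_times_ennreal)
      show "(\<lambda>z. indicator (cball 0 R) (fst z) :: ennreal) \<in> borel_measurable (lborel \<Otimes>\<^sub>M \<mu>)"
        by (rule measurable_compose[OF measurable_fst]) (simp add: borel_measurable_indicator)
    qed simp
    then show "(\<lambda>(a, y). indicator (cball 0 R) a * indicator S (a, y) :: ennreal) \<in> borel_measurable (lborel \<Otimes>\<^sub>M \<mu>)"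
      by (simp add: case_prod_beta')
  qed
  also have "\<dots> \<le> (\<integral>\<^sup>+y. ennreal c * indicator (cylinder n (prefix_of x k)) y \<partial>\<mu>)"
  proof (rule nn_integral_mono)
    fix y assume "y \<in> space \<mu>"
    then have yi: "y \<in> inf_words n" by (simp add: space_mu)
    show "(\<integral>\<^sup>+a. indicator (cball 0 R) a * indicator S (a, y) \<partial>lborel)
        \<le> ennreal c * indicator (cylinder n (prefix_of x k)) y"
    proof (cases "prefix_of x k = prefix_of y k \<and> x (Suc k) \<noteq> y (Suc k)")
      case True
      let ?A = "{a \<in> cball 0 R. dist (tail_point T \<omega> a x 0) (tail_point T \<omega> a y 0) \<le> r}"
      have "{a. dist (tail_point T \<omega> a x 0) (tail_point T \<omega> a y 0) \<le> r} \<in> sets borel"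
      proof -
        have "(\<lambda>z. y) \<in> measurable borel \<mu>" "(\<lambda>z. x) \<in> measurable borel \<mu>"
          using x yi by (auto simp: space_mu)
        from measurable_tail_point[OF measurable_ident[unfolded id_def] this(1), of 0]
          measurable_tail_point[OF measurable_ident[unfolded id_def] this(2), of 0]
        have [measurable]: "(\<lambda>a. tail_point T \<omega> a y 0) \<in> borel_measurable borel"
          "(\<lambda>a. tail_point T \<omega> a x 0) \<in> borel_measurable borel" by simp_all
        have "{a \<in> space borel. dist (tail_point T \<omega> a x 0) (tail_point T \<omega> a y 0) \<le> r} \<in> sets borel"
          by measurable
        then show ?thesis by simp
      qed
      then have "cball 0 R \<inter> {a. dist (tail_point T \<omega> a x 0) (tail_point T \<omega> a y 0) \<le> r} \<in> sets borel"
        by (intro sets.Int) auto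
      also have "cball 0 R \<inter> {a. dist (tail_point T \<omega> a x 0) (tail_point T \<omega> a y 0) \<le> r} = ?A" by blast
      finally have A: "?A \<in> sets lborel" by simp
      have "(\<integral>\<^sup>+a. indicator (cball 0 R) a * indicator S (a, y) \<partial>lborel) = (\<integral>\<^sup>+a. indicator ?A a \<partial>lborel)"
        using True yi by (intro nn_integral_cong)
          (auto simp: S_def indicator_def \<pi>_def space_pair_measure space_mu)
      also have "\<dots> = emeasure lborel ?A" by (rule nn_integral_indicator[OF A])
      also have "\<dots> \<le> ennreal c" unfolding c_def
        using True by (intro emeasure_close_le_sv_fun xi yi s r R) auto
      finally show ?thesis using True yi by (simp add: cylinder_def)
    next
      case False
      then have "indicator S (a, y) = (0 :: ennreal)" for a by (auto simp: S_def indicator_def)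
      then show ?thesis by simp
    qed
  qed
  also have "\<dots> = ennreal c * emeasure \<mu> (cylinder n (prefix_of x k))"
    by (rule nn_integral_cmult_indicator) simp
  also have "\<dots> = ennreal (c * measure \<mu> (cylinder n (prefix_of x k)))"
    using c by (simp add: mu.emeasure_eq_measure ennreal_mult)
  finally show ?thesis by (simp add: c_def mult.assoc)
qed

definition ball_volume :: "real \<Rightarrow> real" where
  "ball_volume R = measure lborel (cball (0 :: real^'d^'t) R)"

lemma nn_integral_ball: "(\<integral>\<^sup>+a. indicator (cball (0 :: real^'d^'t) R) a \<partial>lborel) = ennreal (ball_volume R)"
proof -
  have "(\<integral>\<^sup>+a. indicator (cball (0 :: real^'d^'t) R) a \<partial>lborel) = emeasure lborel (cball (0 :: real^'d^'t) R)"
    by (rule nn_integral_indicator) simp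
  also have "\<dots> = ennreal (ball_volume R)"
    unfolding ball_volume_def
    using emeasure_bounded_finite[OF bounded_cball, of "0 :: real^'d^'t" R]
    by (intro emeasure_eq_ennreal_measure) auto
  finally show ?thesis .
qed

lemma nn_integral_close_mass_at_powr_le:
  assumes x: "x \<in> space \<mu>" and s: "0 < s" "s \<le> real CARD('d)" and r: "r > 0" and R: "R \<ge> 0"
    and e: "0 < e" "e \<le> 1"
  shows "(\<integral>\<^sup>+a. indicator (cball 0 R) a * ennreal (close_mass_at a r k x powr e) \<partial>lborel)
    \<le> ennreal ((ball_volume R + param_volume R) * (r powr s / sv_fun s (word_matrix T (prefix_of x k)) *
        measure \<mu> (cylinder n (prefix_of x k))) powr e)"
proof -
  define C where "C = cylinder n (prefix_of x k)"
  define l where "l = r powr s / sv_fun s (word_matrix T (prefix_of x k)) * measure \<mu> C"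
  have xi: "x \<in> inf_words n" using x by (simp add: space_mu)
  have sv: "sv_fun s (word_matrix T (prefix_of x k)) > 0"
    by (rule sv_fun_bounds(1)[OF s]) (use word_matrix_singular_value[OF prefix_of_words[OF xi, of k]] in blast)
  have f0: "0 \<le> close_mass_at a r k x" for a by (simp add: close_mass_at_def)
  have V0: "0 \<le> ball_volume R" "0 \<le> param_volume R" by (simp_all add: ball_volume_def param_volume_def)
  note [measurable] = measurable_close_mass_at[OF x]
  show ?thesis
  proof (cases "measure \<mu> C = 0")
    case True
    have "close_mass_at a r k x = 0" for a
    proof -
      have "close_mass_at a r k x \<le> measure \<mu> C"
        unfolding close_mass_at_def C_def
        by (rule mu.finite_measure_mono[OF _ sets_cylinder]) (auto simp: cylinder_def space_mu)
      with f0[of a] True show ?thesis by simp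
    qed
    then show ?thesis by simp
  next
    case False
    then have l: "l > 0" using sv r by (simp add: l_def zero_less_measure_iff)
    have "(\<integral>\<^sup>+a. indicator (cball 0 R) a * ennreal (close_mass_at a r k x powr e) \<partial>lborel)
      \<le> (\<integral>\<^sup>+a. ennreal (l powr e) * indicator (cball 0 R) a +
           ennreal (l powr (e - 1)) * (indicator (cball 0 R) a * ennreal (close_mass_at a r k x)) \<partial>lborel)"
    proof (rule nn_integral_mono)
      fix a :: "real^'d^'t"
      have "ennreal (close_mass_at a r k x powr e) \<le> ennreal (l powr e + l powr (e - 1) * close_mass_at a r k x)"
        by (intro ennreal_leI powr_le_affine f0 l e)
      also have "\<dots> = ennreal (l powr e) + ennreal (l powr (e - 1)) * ennreal (close_mass_at a r k x)"
        using f0[of a] by (simp add: ennreal_mult)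
      finally show "indicator (cball 0 R) a * ennreal (close_mass_at a r k x powr e) \<le>
        ennreal (l powr e) * indicator (cball 0 R) a +
           ennreal (l powr (e - 1)) * (indicator (cball 0 R) a * ennreal (close_mass_at a r k x))"
        by (simp add: indicator_def)
    qed
    also have "\<dots> = ennreal (l powr e) * ennreal (ball_volume R) +
        ennreal (l powr (e - 1)) * (\<integral>\<^sup>+a. indicator (cball 0 R) a * ennreal (close_mass_at a r k x) \<partial>lborel)"
      by (subst nn_integral_linear_combination) (measurable, simp only: nn_integral_ball)
    also have "\<dots> \<le> ennreal (l powr e) * ennreal (ball_volume R) +
        ennreal (l powr (e - 1)) * ennreal (param_volume R * l)"
      using nn_integral_close_mass_at_le[OF x s r R, of k]
      by (intro add_left_mono mult_left_mono) (auto simp: l_def C_def)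
    also have "\<dots> = ennreal (l powr e * ball_volume R + l powr (e - 1) * (param_volume R * l))"
      using V0 l by (simp add: ennreal_mult[symmetric] ennreal_plus[symmetric] del: ennreal_plus)
    also have "l powr e * ball_volume R + l powr (e - 1) * (param_volume R * l) =
        (ball_volume R + param_volume R) * l powr e"
      using l powr_mult_base[of l "e - 1"] by (simp add: algebra_simps)
    finally show ?thesis unfolding l_def C_def .
  qed
qed

definition level_sum :: "real \<Rightarrow> real \<Rightarrow> nat \<Rightarrow> real" where
  "level_sum s q k =
    (\<Sum>u\<in>words n k. sv_fun s (word_matrix T u) powr (1 - q) * measure \<mu> (cylinder n u) powr q)"

lemma level_sum_nonneg: "0 \<le> level_sum s q k"
  by (simp add: level_sum_def sum_nonneg)

lemma sv_fun_word_matrix: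
  assumes "u \<in> words n k" "0 < s" "s \<le> real CARD('d)"
  shows "0 < sv_fun s (word_matrix T u)" "sv_fun s (word_matrix T u) \<le> 1"
  using sv_fun_bounds[OF assms(2,3), of "word_matrix T u"] word_matrix_singular_value[OF assms(1)] by blast+

lemma nn_integral_close_mass_truncated:
  assumes s: "0 < s" "s \<le> real CARD('d)" and r: "r > 0" and R: "R \<ge> 0" and q: "1 < q" "q \<le> 2"
  shows "(\<integral>\<^sup>+a. indicator (cball 0 R) a * (\<integral>\<^sup>+x. ennreal (close_mass a r x powr (q - 1)) \<partial>\<mu>) \<partial>lborel)
    \<le> ennreal ((ball_volume R + param_volume R) * r powr (s * (q - 1)) * (\<Sum>k<K. level_sum s q k)
        + ball_volume R * level_sum s q K)"
proof -
  interpret P: pair_sigma_finite "lborel :: (real^'d^'t) measure" \<mu> ..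
  define e where "e = q - 1"
  have e: "0 < e" "e \<le> 1" using q by (auto simp: e_def)
  define V where "V = ball_volume R + param_volume R"
  have V0: "0 \<le> ball_volume R" "0 \<le> V" by (simp_all add: V_def ball_volume_def param_volume_def)
  define l where "l = (\<lambda>u. (r powr s / sv_fun s (word_matrix T u) * measure \<mu> (cylinder n u)) powr e)"
  have m2: "(\<lambda>z. close_mass (fst z) r (snd z)) \<in> borel_measurable (lborel \<Otimes>\<^sub>M \<mu>)"
    using measurable_close_mass[of r] by (simp cong: measurable_cong_sets sets_pair_measure_cong)
  have inner: "(\<integral>\<^sup>+a. indicator (cball 0 R) a * ennreal (close_mass a r x powr e) \<partial>lborel)
      \<le> (\<Sum>k<K. ennreal (V * l (prefix_of x k))) + ennreal (ball_volume R * measure \<mu> (cylinder n (prefix_of x K)) powr e)"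
    if x: "x \<in> space \<mu>" for x
  proof -
    note [measurable] = measurable_close_mass_at[OF x] measurable_close_mass_param[OF x]
    define g where "g = measure \<mu> (cylinder n (prefix_of x K)) powr e"
    have f0: "0 \<le> close_mass_at a r k x" for a k by (simp add: close_mass_at_def)
    have "(\<integral>\<^sup>+a. indicator (cball 0 R) a * ennreal (close_mass a r x powr e) \<partial>lborel)
      \<le> (\<integral>\<^sup>+a. (\<Sum>k<K. indicator (cball 0 R) a * ennreal (close_mass_at a r k x powr e))
            + ennreal g * indicator (cball 0 R) a \<partial>lborel)"
    proof (rule nn_integral_mono)
      fix a :: "real^'d^'t"
      have "close_mass a r x powr e \<le>
          ((\<Sum>k<K. close_mass_at a r k x) + measure \<mu> (cylinder n (prefix_of x K))) powr e"
        using close_mass_le[OF x] e by (intro powr_mono2) (auto simp: close_mass_def)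
      also have "\<dots> \<le> (\<Sum>k<K. close_mass_at a r k x) powr e + g"
        unfolding g_def using e f0 by (intro powr_add_le sum_nonneg) auto
      also have "\<dots> \<le> (\<Sum>k<K. close_mass_at a r k x powr e) + g"
        using e f0 by (intro add_right_mono powr_sum_subadditive) auto
      finally have "ennreal (close_mass a r x powr e) \<le> ennreal ((\<Sum>k<K. close_mass_at a r k x powr e) + g)"
        by (rule ennreal_leI)
      also have "\<dots> = (\<Sum>k<K. ennreal (close_mass_at a r k x powr e)) + ennreal g"
        by (simp add: g_def sum_nonneg)
      finally show "indicator (cball 0 R) a * ennreal (close_mass a r x powr e) \<le>
          (\<Sum>k<K. indicator (cball 0 R) a * ennreal (close_mass_at a r k x powr e))
            + ennreal g * indicator (cball 0 R) a"
        by (simp add: indicator_def)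
    qed
    also have "\<dots> = (\<Sum>k<K. \<integral>\<^sup>+a. indicator (cball 0 R) a * ennreal (close_mass_at a r k x powr e) \<partial>lborel)
         + ennreal g * ennreal (ball_volume R)"
      by (subst nn_integral_sum_add) (measurable, simp only: nn_integral_ball)
    also have "\<dots> \<le> (\<Sum>k<K. ennreal (V * l (prefix_of x k))) + ennreal g * ennreal (ball_volume R)"
      unfolding V_def l_def
      by (intro add_right_mono sum_mono nn_integral_close_mass_at_powr_le x s r R e)
    also have "ennreal g * ennreal (ball_volume R) = ennreal (ball_volume R * g)"
      using V0 by (simp add: ennreal_mult[symmetric] g_def mult.commute)
    finally show ?thesis unfolding g_def .
  qed
  have "(\<integral>\<^sup>+a. indicator (cball 0 R) a * (\<integral>\<^sup>+x. ennreal (close_mass a r x powr e) \<partial>\<mu>) \<partial>lborel)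
      = (\<integral>\<^sup>+a. (\<integral>\<^sup>+x. indicator (cball 0 R) a * ennreal (close_mass a r x powr e) \<partial>\<mu>) \<partial>lborel)"
  proof (rule nn_integral_cong)
    fix a :: "real^'d^'t"
    have "(\<lambda>x. close_mass a r x) \<in> borel_measurable \<mu>"
      using measurable_compose[OF measurable_Pair1' measurable_close_mass[of r], of a] by simp
    then show "indicator (cball 0 R) a * (\<integral>\<^sup>+x. ennreal (close_mass a r x powr e) \<partial>\<mu>) =
        (\<integral>\<^sup>+x. indicator (cball 0 R) a * ennreal (close_mass a r x powr e) \<partial>\<mu>)"
      by (subst nn_integral_cmult) simp_all
  qed
  also have "\<dots> = (\<integral>\<^sup>+x. (\<integral>\<^sup>+a. indicator (cball 0 R) a * ennreal (close_mass a r x powr e) \<partial>lborel) \<partial>\<mu>)"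
  proof (rule P.Fubini'[symmetric])
    have "(\<lambda>z. indicator (cball 0 R) (fst z) * ennreal (close_mass (fst z) r (snd z) powr e))
        \<in> borel_measurable (lborel \<Otimes>\<^sub>M \<mu>)"
      by (intro borel_measurable_times_ennreal measurable_compose[OF measurable_fst borel_measurable_indicator]
          measurable_compose[OF _ measurable_ennreal] powr_real_measurable m2 borel_measurable_const) simp
    then show "(\<lambda>(a, x). indicator (cball 0 R) a * ennreal (close_mass a r x powr e))
        \<in> borel_measurable (lborel \<Otimes>\<^sub>M \<mu>)"
      by (simp add: case_prod_beta')
  qed
  also have "\<dots> \<le> (\<integral>\<^sup>+x. (\<Sum>k<K. ennreal (V * l (prefix_of x k))) +
        ennreal (ball_volume R * measure \<mu> (cylinder n (prefix_of x K)) powr e) \<partial>\<mu>)"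
    by (intro nn_integral_mono inner)
  also have "\<dots> = (\<Sum>k<K. \<integral>\<^sup>+x. ennreal (V * l (prefix_of x k)) \<partial>\<mu>) +
       (\<integral>\<^sup>+x. ennreal (ball_volume R * measure \<mu> (cylinder n (prefix_of x K)) powr e) \<partial>\<mu>)"
  proof -
    have [measurable]: "(\<lambda>x. ennreal (h (prefix_of x k))) \<in> borel_measurable \<mu>" for h k
      by (rule measurable_compose[OF measurable_prefix_of]) simp
    show ?thesis
      using nn_integral_sum_add[of "\<lambda>k x. ennreal (V * l (prefix_of x k))" \<mu>
        "\<lambda>x. ennreal (ball_volume R * measure \<mu> (cylinder n (prefix_of x K)) powr e)" "{..<K}" 1] by simp
  qed
  also have "\<dots> = (\<Sum>k<K. ennreal (V * r powr (s * e) * level_sum s q k)) +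
      ennreal (ball_volume R * (\<Sum>u\<in>words n K. measure \<mu> (cylinder n u) powr q))"
  proof -
    have q_eq: "y powr e * y = y powr q" if "y \<ge> 0" for y :: real
      using that powr_mult_base[of y e] by (simp add: e_def mult.commute)
    have "(\<integral>\<^sup>+x. ennreal (V * l (prefix_of x k)) \<partial>\<mu>) = ennreal (V * r powr (s * e) * level_sum s q k)" for k
    proof -
      have "(\<integral>\<^sup>+x. ennreal (V * l (prefix_of x k)) \<partial>\<mu>) =
          ennreal (\<Sum>u\<in>words n k. V * l u * measure \<mu> (cylinder n u))"
        using V0 by (intro nn_integral_prefix_of[of k "\<lambda>u. V * l u"]) (simp add: l_def)
      also have "(\<Sum>u\<in>words n k. V * l u * measure \<mu> (cylinder n u)) = V * r powr (s * e) * level_sum s q k"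
        unfolding level_sum_def sum_distrib_left
      proof (rule sum.cong)
        fix u assume u: "u \<in> words n k"
        note sv = sv_fun_word_matrix[OF u s]
        have "l u = r powr (s * e) * sv_fun s (word_matrix T u) powr (1 - q) * measure \<mu> (cylinder n u) powr e"
          using sv r by (simp add: l_def powr_mult powr_divide powr_powr e_def powr_minus_divide[of _ "q - 1", simplified])
        then show "V * l u * measure \<mu> (cylinder n u) = V * r powr (s * e) *
            (sv_fun s (word_matrix T u) powr (1 - q) * measure \<mu> (cylinder n u) powr q)"
          by (simp add: q_eq[symmetric])
      qed simp
      finally show ?thesis .
    qed
    moreover have "(\<integral>\<^sup>+x. ennreal (ball_volume R * measure \<mu> (cylinder n (prefix_of x K)) powr e) \<partial>\<mu>) =
        ennreal (ball_volume R * (\<Sum>u\<in>words n K. measure \<mu> (cylinder n u) powr q))"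
      using V0 nn_integral_prefix_of[of K "\<lambda>u. ball_volume R * measure \<mu> (cylinder n u) powr e"]
      by (simp add: mult.assoc q_eq sum_distrib_left)
    ultimately show ?thesis by simp
  qed
  also have "\<dots> \<le> (\<Sum>k<K. ennreal (V * r powr (s * e) * level_sum s q k)) +
      ennreal (ball_volume R * level_sum s q K)"
  proof (intro add_left_mono ennreal_leI mult_left_mono V0)
    show "(\<Sum>u\<in>words n K. measure \<mu> (cylinder n u) powr q) \<le> level_sum s q K"
      unfolding level_sum_def
    proof (rule sum_mono)
      fix u assume u: "u \<in> words n K"
      have "1 \<le> sv_fun s (word_matrix T u) powr (1 - q)"
        using powr_mono2'[of "1 - q" "sv_fun s (word_matrix T u)" 1] sv_fun_word_matrix[OF u s] q by simp
      then show "measure \<mu> (cylinder n u) powr q \<le>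
          sv_fun s (word_matrix T u) powr (1 - q) * measure \<mu> (cylinder n u) powr q"
        using mult_right_mono[of 1 _ "measure \<mu> (cylinder n u) powr q"] by simp
    qed
  qed
  also have "\<dots> = ennreal (V * r powr (s * e) * (\<Sum>k<K. level_sum s q k) + ball_volume R * level_sum s q K)"
    using V0 level_sum_nonneg by (simp add: sum_distrib_left sum_nonneg)
  finally show ?thesis by (simp add: V_def e_def)
qed

lemma energy_estimate:
  assumes s: "0 < s" "s \<le> real CARD('d)" and R: "R \<ge> 0" and q: "1 < q" "q \<le> 2"
    and sm: "summable (level_sum s q)"
  shows "\<exists>C\<ge>0. \<forall>r>0. (\<integral>\<^sup>+a. indicator (cball 0 R) a *
      (\<integral>\<^sup>+x. ennreal (close_mass a r x powr (q - 1)) \<partial>\<mu>) \<partial>lborel) \<le> ennreal (C * r powr (s * (q - 1)))"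
proof (intro exI[of _ "(ball_volume R + param_volume R) * suminf (level_sum s q)"] conjI allI impI)
  have V: "0 \<le> ball_volume R" "0 \<le> ball_volume R + param_volume R"
    by (simp_all add: ball_volume_def param_volume_def)
  show "0 \<le> (ball_volume R + param_volume R) * suminf (level_sum s q)"
    using V level_sum_nonneg by (intro mult_nonneg_nonneg suminf_nonneg sm) auto
  fix r :: real assume r: "r > 0"
  have "(\<lambda>K. (ball_volume R + param_volume R) * r powr (s * (q - 1)) * (\<Sum>k<K. level_sum s q k)
        + ball_volume R * level_sum s q K)
     \<longlonglongrightarrow> (ball_volume R + param_volume R) * r powr (s * (q - 1)) * suminf (level_sum s q) + ball_volume R * 0"
    by (intro tendsto_intros summable_LIMSEQ summable_LIMSEQ_zero sm)
  then have "(\<lambda>K. ennreal ((ball_volume R + param_volume R) * r powr (s * (q - 1)) * (\<Sum>k<K. level_sum s q k)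
        + ball_volume R * level_sum s q K))
     \<longlonglongrightarrow> ennreal ((ball_volume R + param_volume R) * r powr (s * (q - 1)) * suminf (level_sum s q) + ball_volume R * 0)"
    by (rule tendsto_ennrealI)
  then have "(\<integral>\<^sup>+a. indicator (cball 0 R) a * (\<integral>\<^sup>+x. ennreal (close_mass a r x powr (q - 1)) \<partial>\<mu>) \<partial>lborel)
     \<le> ennreal ((ball_volume R + param_volume R) * r powr (s * (q - 1)) * suminf (level_sum s q) + ball_volume R * 0)"
    by (rule LIMSEQ_le_const) (intro exI[of _ 0] allI impI nn_integral_close_mass_truncated s r R q)
  then show "(\<integral>\<^sup>+a. indicator (cball 0 R) a * (\<integral>\<^sup>+x. ennreal (close_mass a r x powr (q - 1)) \<partial>\<mu>) \<partial>lborel)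
     \<le> ennreal ((ball_volume R + param_volume R) * suminf (level_sum s q) * r powr (s * (q - 1)))"
    by (simp add: mult_ac)
qed

section \<open>Mesh sums of the projected measure\<close>

definition \<nu> :: "real^'d^'t \<Rightarrow> (real^'d) measure" where
  "\<nu> a = distr \<mu> borel (\<pi> a)"

lemma measurable_\<pi>_param[measurable]: "\<pi> a \<in> borel_measurable \<mu>"
  using measurable_\<pi>[of "\<lambda>_. a" \<mu> "\<lambda>x. x"] by simp

lemma measure_\<nu>: "Q \<in> sets borel \<Longrightarrow> measure (\<nu> a) Q = measure \<mu> {x \<in> space \<mu>. \<pi> a x \<in> Q}"
  unfolding \<nu>_def by (subst measure_distr) (auto intro!: arg_cong[of _ _ "measure \<mu>"])

lemma norm_\<pi>_le: "x \<in> space \<mu> \<Longrightarrow> norm (\<pi> a x) \<le> norm a / (1 - \<rho>)"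
  unfolding \<pi>_def by (rule summable_tail_point(2)) (simp add: space_mu)

definition cubes_meeting :: "real^'d^'t \<Rightarrow> real \<Rightarrow> (nat \<Rightarrow> nat) set \<Rightarrow> (real^'d) set set" where
  "cubes_meeting a r C = {Q \<in> mesh_cubes r. Q \<inter> \<pi> a ` C \<noteq> {}}"

lemma cubes_meeting_space:
  assumes r: "0 < r" "r \<le> 1"
  shows "finite (cubes_meeting a r (space \<mu>))"
    "real (card (cubes_meeting a r (space \<mu>))) \<le>
      measure lborel (cball (0 :: real^'d) (norm a / (1 - \<rho>) + real CARD('d))) / r ^ CARD('d)"
proof -
  let ?Y = "cball (0 :: real^'d) (norm a / (1 - \<rho>) + real CARD('d))"
  have "emeasure lborel ?Y \<le> ennreal (measure lborel ?Y)"
    using emeasure_bounded_finite[OF bounded_cball, of "0 :: real^'d" "norm a / (1 - \<rho>) + real CARD('d)"]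
    by (intro eq_refl emeasure_eq_ennreal_measure) auto
  moreover have "y \<in> ?Y" if "x \<in> \<pi> a ` space \<mu>" "dist x y \<le> real CARD('d) * r" for x y :: "real^'d"
  proof -
    have "norm x \<le> norm a / (1 - \<rho>)" using that norm_\<pi>_le by auto
    moreover have "real CARD('d) * r \<le> real CARD('d) * 1" using r by (intro mult_left_mono) auto
    moreover have "norm y \<le> norm x + dist x y" using norm_triangle_sub[of y x] by (simp add: dist_norm norm_minus_commute)
    ultimately have "norm y \<le> norm a / (1 - \<rho>) + real CARD('d)" using that(2) by linarith
    then show ?thesis by simp
  qed
  ultimately show "finite (cubes_meeting a r (space \<mu>))"
    "real (card (cubes_meeting a r (space \<mu>))) \<le> measure lborel ?Y / r ^ CARD('d)"
    unfolding cubes_meeting_def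
    using mesh_cubes_meeting[of r ?Y "measure lborel ?Y" "\<pi> a ` space \<mu>"] r by auto
qed

lemma finite_cubes_meeting:
  assumes "0 < r" "r \<le> 1" "C \<subseteq> space \<mu>"
  shows "finite (cubes_meeting a r C)"
  by (rule finite_subset[OF _ cubes_meeting_space(1)[OF assms(1,2)]])
    (use assms(3) in \<open>auto simp: cubes_meeting_def\<close>)

lemma mesh_sum_eq:
  assumes r: "0 < r" "r \<le> 1"
  shows "mesh_sum q (\<nu> a) r =
    (\<Sum>Q\<in>cubes_meeting a r (space \<mu>). measure \<mu> {x \<in> space \<mu>. \<pi> a x \<in> Q} powr q)"
proof -
  have "mesh_sum q (\<nu> a) r = (\<Sum>\<^sub>\<infinity>Q\<in>cubes_meeting a r (space \<mu>). measure (\<nu> a) Q powr q)"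
    unfolding mesh_sum_def
  proof (rule infsum_cong_neutral)
    fix Q assume "Q \<in> mesh_cubes r - cubes_meeting a r (space \<mu>)"
    then have "{x \<in> space \<mu>. \<pi> a x \<in> Q} = {}" "Q \<in> sets borel"
      using sets_mesh_cube[of Q r] by (auto simp: cubes_meeting_def)
    then show "measure (\<nu> a) Q powr q = 0" by (simp only: measure_\<nu> measure_empty powr_0)
  qed (auto simp: cubes_meeting_def)
  also have "\<dots> = (\<Sum>Q\<in>cubes_meeting a r (space \<mu>). measure (\<nu> a) Q powr q)"
    by (rule infsum_finite[OF cubes_meeting_space(1)[OF r]])
  also have "\<dots> = (\<Sum>Q\<in>cubes_meeting a r (space \<mu>). measure \<mu> {x \<in> space \<mu>. \<pi> a x \<in> Q} powr q)"
    by (intro sum.cong refl) (auto simp: cubes_meeting_def measure_\<nu> sets_mesh_cube)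
  finally show ?thesis .
qed

lemma sets_preimage_mesh_cube:
  assumes "Q \<in> mesh_cubes r" "C \<in> sets \<mu>"
  shows "{x \<in> C. \<pi> a x \<in> Q} \<in> sets \<mu>"
proof -
  have "{x \<in> space \<mu>. \<pi> a x \<in> Q} \<in> sets \<mu>"
    using measurable_sets[OF measurable_\<pi>_param sets_mesh_cube[OF assms(1)]]
    by (simp add: vimage_def Int_def conj_commute)
  moreover have "{x \<in> C. \<pi> a x \<in> Q} = C \<inter> {x \<in> space \<mu>. \<pi> a x \<in> Q}"
    using sets.sets_into_space[OF assms(2)] by auto
  ultimately show ?thesis using assms(2) by simp
qed

lemma disjoint_family_mesh_preimages:
  assumes "r > 0" "F \<subseteq> mesh_cubes r"
  shows "disjoint_family_on (\<lambda>Q. {x \<in> C. \<pi> a x \<in> Q}) F"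
  unfolding disjoint_family_on_def
proof (intro ballI impI)
  fix P Q assume "P \<in> F" "Q \<in> F" "P \<noteq> Q"
  then have "P \<inter> Q = {}" using assms by (intro disjointD[OF disjoint_mesh_cubes[OF assms(1)]]) auto
  then show "{x \<in> C. \<pi> a x \<in> P} \<inter> {x \<in> C. \<pi> a x \<in> Q} = {}" by auto
qed

lemma measure_sum_cubes_meeting:
  assumes r: "0 < r" "r \<le> 1" and C: "C \<in> sets \<mu>"
  shows "(\<Sum>Q\<in>cubes_meeting a r C. measure \<mu> {x \<in> C. \<pi> a x \<in> Q}) = measure \<mu> C"
proof -
  have sub: "C \<subseteq> space \<mu>" using C by (rule sets.sets_into_space)
  have "(\<Sum>Q\<in>cubes_meeting a r C. measure \<mu> {x \<in> C. \<pi> a x \<in> Q}) =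
      measure \<mu> (\<Union>Q\<in>cubes_meeting a r C. {x \<in> C. \<pi> a x \<in> Q})"
    using C r by (intro mu.finite_measure_finite_Union[symmetric] finite_cubes_meeting sub
        disjoint_family_mesh_preimages[of r]) (auto simp: cubes_meeting_def intro: sets_preimage_mesh_cube)
  also have "(\<Union>Q\<in>cubes_meeting a r C. {x \<in> C. \<pi> a x \<in> Q}) = C"
  proof
    show "C \<subseteq> (\<Union>Q\<in>cubes_meeting a r C. {x \<in> C. \<pi> a x \<in> Q})"
    proof
      fix x assume x: "x \<in> C"
      have "\<pi> a x \<in> mesh_cube r (\<lambda>i. \<lfloor>\<pi> a x $ i / r\<rfloor>)" by (rule in_mesh_cube_floor[OF r(1)])
      with x show "x \<in> (\<Union>Q\<in>cubes_meeting a r C. {x \<in> C. \<pi> a x \<in> Q})"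
        unfolding cubes_meeting_def mesh_cubes_def by blast
    qed
  qed auto
  finally show ?thesis .
qed

lemma powr_measure_le_cubes_meeting:
  assumes r: "0 < r" "r \<le> 1" and C: "C \<in> sets \<mu>" and q: "q \<ge> 1"
  shows "measure \<mu> C powr q \<le> real (card (cubes_meeting a r C)) powr (q - 1) *
    (\<Sum>Q\<in>cubes_meeting a r C. measure \<mu> {x \<in> C. \<pi> a x \<in> Q} powr q)"
  using sum_powr_power_mean[of "cubes_meeting a r C" "\<lambda>Q. measure \<mu> {x \<in> C. \<pi> a x \<in> Q}" q]
    finite_cubes_meeting[OF r sets.sets_into_space[OF C]] q
  by (simp add: measure_sum_cubes_meeting[OF r C])

lemma mesh_sum_ge:
  assumes q: "q > 1"
  shows "\<exists>c>0. \<forall>r. 0 < r \<and> r \<le> 1 \<longrightarrow> c * r powr (real CARD('d) * (q - 1)) \<le> mesh_sum q (\<nu> a) r"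
proof -
  define V where "V = measure lborel (cball (0 :: real^'d) (norm a / (1 - \<rho>) + real CARD('d)))"
  have V: "V > 0" unfolding V_def
    using rho by (simp add: content_cball_pos add_nonneg_pos)
  show ?thesis
  proof (intro exI[of _ "V powr (1 - q)"] conjI allI impI)
    fix r :: real assume "0 < r \<and> r \<le> 1"
    then have r: "0 < r" "r \<le> 1" by auto
    define N where "N = real (card (cubes_meeting a r (space \<mu>)))"
    have N: "N \<le> V * r powr (- real CARD('d))"
      using cubes_meeting_space(2)[OF r, of a] r
      by (simp add: N_def V_def powr_minus_divide powr_realpow)
    have "1 \<le> N powr (q - 1) * mesh_sum q (\<nu> a) r"
      using powr_measure_le_cubes_meeting[OF r sets.top, of q a] q
      by (simp add: mesh_sum_eq[OF r] N_def mu.prob_space)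
    also have "\<dots> \<le> (V * r powr (- real CARD('d))) powr (q - 1) * mesh_sum q (\<nu> a) r"
      using N q by (intro mult_right_mono powr_mono2) (auto simp: N_def mesh_sum_eq[OF r] sum_nonneg)
    finally have *: "1 \<le> (V * r powr (- real CARD('d))) powr (q - 1) * mesh_sum q (\<nu> a) r" .
    have inv: "V powr (1 - q) * r powr (real CARD('d) * (q - 1)) * (V * r powr (- real CARD('d))) powr (q - 1) = 1"
    proof -
      have "(V * r powr (- real CARD('d))) powr (q - 1) = V powr (q - 1) * r powr (- (real CARD('d) * (q - 1)))"
        using V r by (simp add: powr_mult powr_powr)
      moreover have "V powr (1 - q) * V powr (q - 1) = 1" using V by (simp add: powr_add[symmetric])
      moreover have "r powr (real CARD('d) * (q - 1)) * r powr (- (real CARD('d) * (q - 1))) = 1"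
        using r by (simp add: powr_add[symmetric])
      ultimately show ?thesis by (metis (no_types, lifting) mult.assoc mult.left_commute mult_1)
    qed
    have "V powr (1 - q) * r powr (real CARD('d) * (q - 1)) * 1 \<le>
        V powr (1 - q) * r powr (real CARD('d) * (q - 1)) *
        ((V * r powr (- real CARD('d))) powr (q - 1) * mesh_sum q (\<nu> a) r)"
      using * by (intro mult_left_mono) auto
    then show "V powr (1 - q) * r powr (real CARD('d) * (q - 1)) \<le> mesh_sum q (\<nu> a) r"
      using inv by (simp only: mult.assoc[symmetric] mult_1 mult_1_right)
  qed (use V in simp)
qed

section \<open>The lower bound\<close>

lemma mesh_sum_pos:
  assumes r: "0 < r" "r \<le> 1" and q: "q > 1"
  shows "0 < mesh_sum q (\<nu> a) r"
proof -
  obtain c where "c > 0" "\<forall>r. 0 < r \<and> r \<le> 1 \<longrightarrow> c * r powr (real CARD('d) * (q - 1)) \<le> mesh_sum q (\<nu> a) r"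
    using mesh_sum_ge[OF q] by blast
  then have "0 < c * r powr (real CARD('d) * (q - 1))" "c * r powr (real CARD('d) * (q - 1)) \<le> mesh_sum q (\<nu> a) r"
    using r by auto
  then show ?thesis by simp
qed

lemma mesh_sum_le_close_mass:
  assumes r: "0 < r" "r \<le> 1" and q: "1 < q"
  shows "ennreal (mesh_sum q (\<nu> a) r) \<le>
    (\<integral>\<^sup>+x. ennreal (close_mass a (real CARD('d) * r) x powr (q - 1)) \<partial>\<mu>)"
proof -
  define F where "F = cubes_meeting a r (space \<mu>)"
  have F: "finite F" "F \<subseteq> mesh_cubes r"
    using cubes_meeting_space(1)[OF r] by (auto simp: F_def cubes_meeting_def)
  define m where "m = (\<lambda>Q. measure \<mu> {x \<in> space \<mu>. \<pi> a x \<in> Q})"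
  have sets: "{x \<in> space \<mu>. \<pi> a x \<in> Q} \<in> sets \<mu>" if "Q \<in> F" for Q
    using sets_preimage_mesh_cube[OF _ sets.top] F that by blast
  have "ennreal (mesh_sum q (\<nu> a) r) = (\<Sum>Q\<in>F. ennreal (m Q powr (q - 1)) * emeasure \<mu> {x \<in> space \<mu>. \<pi> a x \<in> Q})"
  proof -
    have "m Q powr q = m Q powr (q - 1) * m Q" for Q
      using powr_mult_base[of "m Q" "q - 1"] by (simp add: m_def mult.commute)
    then have "mesh_sum q (\<nu> a) r = (\<Sum>Q\<in>F. m Q powr (q - 1) * m Q)"
      by (simp add: mesh_sum_eq[OF r] F_def m_def)
    moreover have "ennreal (\<Sum>Q\<in>F. m Q powr (q - 1) * m Q) = (\<Sum>Q\<in>F. ennreal (m Q powr (q - 1)) * ennreal (m Q))"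
      by (simp add: m_def ennreal_mult sum_ennreal[symmetric] del: sum_ennreal)
    ultimately show ?thesis by (simp add: m_def mu.emeasure_eq_measure)
  qed
  also have "\<dots> = (\<Sum>Q\<in>F. \<integral>\<^sup>+x. ennreal (m Q powr (q - 1)) * indicator {x \<in> space \<mu>. \<pi> a x \<in> Q} x \<partial>\<mu>)"
    by (intro sum.cong refl nn_integral_cmult_indicator[symmetric] sets)
  also have "\<dots> = (\<integral>\<^sup>+x. (\<Sum>Q\<in>F. ennreal (m Q powr (q - 1)) * indicator {x \<in> space \<mu>. \<pi> a x \<in> Q} x) \<partial>\<mu>)"
    by (rule nn_integral_sum[symmetric]) (use sets in simp)
  also have "\<dots> \<le> (\<integral>\<^sup>+x. ennreal (close_mass a (real CARD('d) * r) x powr (q - 1)) \<partial>\<mu>)"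
  proof (rule nn_integral_mono)
    fix x assume x: "x \<in> space \<mu>"
    define P where "P = mesh_cube r (\<lambda>i. \<lfloor>\<pi> a x $ i / r\<rfloor>)"
    have PF: "P \<in> F" "\<pi> a x \<in> P"
      using in_mesh_cube_floor[OF r(1), of "\<pi> a x"] x unfolding P_def F_def cubes_meeting_def mesh_cubes_def by blast+
    have uniq: "Q = P" if "Q \<in> F" "\<pi> a x \<in> Q" for Q
    proof (rule ccontr)
      assume "Q \<noteq> P"
      then have "Q \<inter> P = {}"
        by (rule disjointD[OF disjoint_mesh_cubes[OF r(1)] subsetD[OF F(2) that(1)] subsetD[OF F(2) PF(1)]])
      then show False using that(2) PF(2) by blast
    qed
    have "(\<Sum>Q\<in>F. ennreal (m Q powr (q - 1)) * indicator {x \<in> space \<mu>. \<pi> a x \<in> Q} x) =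
        (\<Sum>Q\<in>F. if Q = P then ennreal (m P powr (q - 1)) else 0)"
    proof (rule sum.cong[OF refl])
      fix Q assume "Q \<in> F"
      then have "\<pi> a x \<in> Q \<longleftrightarrow> Q = P" using uniq PF(2) by metis
      then show "ennreal (m Q powr (q - 1)) * indicator {x \<in> space \<mu>. \<pi> a x \<in> Q} x =
          (if Q = P then ennreal (m P powr (q - 1)) else 0)" using x PF(2) by simp
    qed
    also have "\<dots> = ennreal (m P powr (q - 1))" using F PF by simp
    also have "\<dots> \<le> ennreal (close_mass a (real CARD('d) * r) x powr (q - 1))"
    proof (intro ennreal_leI powr_mono2)
      have [measurable]: "Measurable.pred \<mu> (\<lambda>y. dist (\<pi> a x) (\<pi> a y) \<le> real CARD('d) * r)" by measurable
      show "m P \<le> close_mass a (real CARD('d) * r) x"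
        unfolding m_def close_mass_def
      proof (rule mu.finite_measure_mono)
        show "{y \<in> space \<mu>. \<pi> a y \<in> P} \<subseteq> {y \<in> space \<mu>. dist (\<pi> a x) (\<pi> a y) \<le> real CARD('d) * r}"
          using dist_mesh_cube_le[OF r(1) subsetD[OF F(2) PF(1)] PF(2)] by auto
      qed measurable
    qed (use q in \<open>auto simp: m_def\<close>)
    finally show "(\<Sum>Q\<in>F. ennreal (m Q powr (q - 1)) * indicator {x \<in> space \<mu>. \<pi> a x \<in> Q} x)
        \<le> ennreal (close_mass a (real CARD('d) * r) x powr (q - 1))" .
  qed
  finally show ?thesis .
qed

lemma close_mass_mono:
  assumes "r \<le> r'"
  shows "close_mass a r x \<le> close_mass a r' x"
proof -
  have [measurable]: "Measurable.pred \<mu> (\<lambda>y. dist (\<pi> a x) (\<pi> a y) \<le> r')" by measurable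
  show ?thesis unfolding close_mass_def
    by (rule mu.finite_measure_mono) (use assms in \<open>auto intro: order_trans\<close>)
qed

lemma measurable_energy:
  "(\<lambda>a. \<integral>\<^sup>+x. ennreal (close_mass a r x powr e) \<partial>\<mu>) \<in> borel_measurable borel"
proof -
  have "(\<lambda>z. ennreal (close_mass (fst z) r (snd z) powr e)) \<in> borel_measurable (borel \<Otimes>\<^sub>M \<mu>)"
    by (intro measurable_compose[OF _ measurable_ennreal] powr_real_measurable measurable_close_mass
        borel_measurable_const)
  then show ?thesis
    using mu.borel_measurable_nn_integral[of "\<lambda>a x. ennreal (close_mass a r x powr e)" borel]
    by (simp add: case_prod_beta')
qed

lemma AE_energy_bounded:
  assumes s: "0 < s" "s \<le> real CARD('d)" and q: "1 < q" "q \<le> 2" and t: "t < s"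
    and sm: "summable (level_sum s q)"
  shows "AE a in lborel. \<exists>K>0. \<forall>j. (\<integral>\<^sup>+x. ennreal (close_mass a ((1 / 2) ^ j) x powr (q - 1)) \<partial>\<mu>)
    \<le> ennreal (K * ((1 / 2) ^ j) powr (t * (q - 1)))"
proof -
  define h where "h = (\<lambda>j a. \<integral>\<^sup>+x. ennreal (close_mass a ((1 / 2) ^ j) x powr (q - 1)) \<partial>\<mu>)"
  define w where "w = (\<lambda>j::nat. ((1 / 2) ^ j :: real) powr (- (t * (q - 1))))"
  have [measurable]: "h j \<in> borel_measurable borel" for j unfolding h_def by (rule measurable_energy)
  have w: "w j > 0" for j by (simp add: w_def)
  have AE_R: "AE a in lborel. a \<in> cball 0 (real R) \<longrightarrow>
      (\<Sum>j. ennreal (w j) * (indicator (cball 0 (real R)) a * h j a)) \<noteq> \<infinity>" for R :: nat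
  proof -
    obtain C where C: "C \<ge> 0" "\<And>r. r > 0 \<Longrightarrow> (\<integral>\<^sup>+a. indicator (cball 0 (real R)) a *
      (\<integral>\<^sup>+x. ennreal (close_mass a r x powr (q - 1)) \<partial>\<mu>) \<partial>lborel) \<le> ennreal (C * r powr (s * (q - 1)))"
      using energy_estimate[OF s _ q sm, of "real R"] by auto
    define y where "y = (1 / 2 :: real) powr ((s - t) * (q - 1))"
    have y: "0 < y" "y < 1"
      using t q powr_less_mono2[of "(s - t) * (q - 1)" "1 / 2" 1] by (auto simp: y_def)
    have "(\<integral>\<^sup>+a. (\<Sum>j. ennreal (w j) * (indicator (cball 0 (real R)) a * h j a)) \<partial>lborel) =
        (\<Sum>j. ennreal (w j) * (\<integral>\<^sup>+a. indicator (cball 0 (real R)) a * h j a \<partial>lborel))"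
      by (subst nn_integral_suminf) (simp_all add: nn_integral_cmult)
    also have "\<dots> \<le> (\<Sum>j. ennreal (C * y ^ j))"
    proof (intro suminf_le allI)
      fix j
      have "ennreal (w j) * (\<integral>\<^sup>+a. indicator (cball 0 (real R)) a * h j a \<partial>lborel)
          \<le> ennreal (w j) * ennreal (C * ((1 / 2) ^ j) powr (s * (q - 1)))"
        unfolding h_def by (intro mult_left_mono C) auto
      also have "\<dots> = ennreal (w j * (C * ((1 / 2) ^ j) powr (s * (q - 1))))"
        using w[of j] C by (simp add: ennreal_mult)
      also have "w j * (C * ((1 / 2) ^ j) powr (s * (q - 1))) = C * ((1 / 2) ^ j) powr ((s - t) * (q - 1))"
        unfolding w_def by (simp add: powr_add[symmetric] algebra_simps)
      also have "((1 / 2) ^ j :: real) powr ((s - t) * (q - 1)) = y ^ j"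
        unfolding y_def by (simp add: powr_realpow[symmetric] powr_powr mult.commute)
      finally show "ennreal (w j) * (\<integral>\<^sup>+a. indicator (cball 0 (real R)) a * h j a \<partial>lborel) \<le> ennreal (C * y ^ j)" .
    qed auto
    also have "\<dots> = ennreal (\<Sum>j. C * y ^ j)"
      using C y by (intro suminf_ennreal2) (auto intro!: summable_mult summable_geometric)
    finally have "(\<integral>\<^sup>+a. (\<Sum>j. ennreal (w j) * (indicator (cball 0 (real R)) a * h j a)) \<partial>lborel) \<noteq> \<infinity>"
      by (auto simp: top_unique)
    then have "AE a in lborel. (\<Sum>j. ennreal (w j) * (indicator (cball 0 (real R)) a * h j a)) \<noteq> \<infinity>"
      by (intro nn_integral_PInf_AE) measurable
    then show ?thesis by eventually_elim blast
  qed
  have "AE a in lborel. \<forall>R::nat. a \<in> cball 0 (real R) \<longrightarrow>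
      (\<Sum>j. ennreal (w j) * (indicator (cball 0 (real R)) a * h j a)) \<noteq> \<infinity>"
    unfolding AE_all_countable using AE_R by blast
  then show ?thesis
  proof eventually_elim
    fix a :: "real^'d^'t"
    assume *: "\<forall>R::nat. a \<in> cball 0 (real R) \<longrightarrow>
      (\<Sum>j. ennreal (w j) * (indicator (cball 0 (real R)) a * h j a)) \<noteq> \<infinity>"
    obtain R :: nat where R: "norm a \<le> real R" using real_arch_simple by blast
    then have fin: "(\<Sum>j. ennreal (w j) * h j a) \<noteq> \<infinity>" using *[rule_format, of R] by simp
    define K where "K = enn2real (\<Sum>j. ennreal (w j) * h j a) + 1"
    have K: "(\<Sum>j. ennreal (w j) * h j a) \<le> ennreal K" "K > 0"
    proof -
      have "(\<Sum>j. ennreal (w j) * h j a) = ennreal (enn2real (\<Sum>j. ennreal (w j) * h j a))"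
        using fin by (simp add: less_top)
      also have "\<dots> \<le> ennreal K" unfolding K_def by (intro ennreal_leI) simp
      finally show "(\<Sum>j. ennreal (w j) * h j a) \<le> ennreal K" .
    qed (simp add: K_def add_nonneg_pos)
    have "h j a \<le> ennreal (K * ((1 / 2) ^ j) powr (t * (q - 1)))" for j
    proof -
      have "ennreal (w j) * h j a \<le> (\<Sum>j. ennreal (w j) * h j a)"
        using sum_le_suminf[of "\<lambda>j. ennreal (w j) * h j a" "{j}"] by simp
      then have "ennreal (w j) * h j a \<le> ennreal K" using K(1) by (rule order_trans)
      then have "ennreal (1 / w j) * (ennreal (w j) * h j a) \<le> ennreal (1 / w j) * ennreal K"
        by (intro mult_left_mono) auto
      moreover have "ennreal (1 / w j) * (ennreal (w j) * h j a) = h j a"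
        using w[of j] by (simp add: mult.assoc[symmetric] ennreal_mult[symmetric])
      moreover have "ennreal (1 / w j) * ennreal K = ennreal (K * (1 / w j))"
        using w[of j] K(2) by (simp add: ennreal_mult[symmetric])
      moreover have "1 / w j = ((1 / 2) ^ j) powr (t * (q - 1))"
        unfolding w_def by (simp add: powr_minus_divide)
      ultimately show ?thesis by simp
    qed
    then show "\<exists>K>0. \<forall>j. (\<integral>\<^sup>+x. ennreal (close_mass a ((1 / 2) ^ j) x powr (q - 1)) \<partial>\<mu>)
        \<le> ennreal (K * ((1 / 2) ^ j) powr (t * (q - 1)))"
      using K(2) unfolding h_def by blast
  qed
qed

lemma lower_gen_dim_ge_of_energy:
  assumes q: "1 < q" and t: "0 \<le> t" and K: "K > 0"
    and h: "\<And>j. (\<integral>\<^sup>+x. ennreal (close_mass a ((1 / 2) ^ j) x powr (q - 1)) \<partial>\<mu>)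
      \<le> ennreal (K * ((1 / 2) ^ j) powr (t * (q - 1)))"
  shows "ereal t \<le> lower_gen_dim q (\<nu> a)"
proof -
  define d where "d = real CARD('d)"
  have d: "d \<ge> 1" by (simp add: d_def Suc_le_eq)
  show ?thesis
  proof (rule lower_gen_dim_ge[OF q, of "K * (2 * d) powr (t * (q - 1))" "1 / d"])
    fix r assume r: "0 < r" "r < 1 / d"
    have r1: "r \<le> 1" using r d by (meson divide_le_eq_1 less_imp_le order_trans le_divide_eq_1 order_less_le_trans zero_less_one)
    have "0 < d * r" "d * r \<le> 1" using r d by (auto simp: field_simps)
    then obtain j :: nat where j: "(1 / 2) ^ (Suc j) < d * r" "d * r \<le> (1 / 2) ^ j"
      by (rule dyadic_scale)
    have "ennreal (mesh_sum q (\<nu> a) r) \<le> (\<integral>\<^sup>+x. ennreal (close_mass a (d * r) x powr (q - 1)) \<partial>\<mu>)"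
      unfolding d_def by (rule mesh_sum_le_close_mass[OF r(1) r1 q])
    also have "\<dots> \<le> (\<integral>\<^sup>+x. ennreal (close_mass a ((1 / 2) ^ j) x powr (q - 1)) \<partial>\<mu>)"
      using q by (intro nn_integral_mono ennreal_leI powr_mono2 close_mass_mono j) (auto simp: close_mass_def)
    also have "\<dots> \<le> ennreal (K * ((1 / 2) ^ j) powr (t * (q - 1)))" by (rule h)
    also have "\<dots> \<le> ennreal (K * (2 * d * r) powr (t * (q - 1)))"
      using j K t q by (intro ennreal_leI mult_left_mono powr_mono2) auto
    also have "K * (2 * d * r) powr (t * (q - 1)) = K * (2 * d) powr (t * (q - 1)) * r powr (t * (q - 1))"
      using d r by (simp add: powr_mult)
    finally have "mesh_sum q (\<nu> a) r \<le> K * (2 * d) powr (t * (q - 1)) * r powr (t * (q - 1))"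
      using K by (simp add: ennreal_le_iff)
    then show "0 < mesh_sum q (\<nu> a) r \<and> mesh_sum q (\<nu> a) r \<le> K * (2 * d) powr (t * (q - 1)) * r powr (t * (q - 1))"
      using mesh_sum_pos[OF r(1) r1 q] by blast
  qed (use K d in auto)
qed

lemma AE_lower_gen_dim_ge:
  assumes s: "0 < s" "s \<le> real CARD('d)" and q: "1 < q" "q \<le> 2" and t: "0 \<le> t" "t < s"
    and sm: "summable (level_sum s q)"
  shows "AE a in lborel. ereal t \<le> lower_gen_dim q (\<nu> a)"
  using AE_energy_bounded[OF s q t(2) sm]
proof eventually_elim
  case (elim a)
  then show ?case using lower_gen_dim_ge_of_energy[OF q(1) t(1)] by blast
qed

lemma lower_gen_dim_nonneg:
  assumes q: "1 < q"
  shows "0 \<le> lower_gen_dim q (\<nu> a)"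
proof -
  have "ereal 0 \<le> lower_gen_dim q (\<nu> a)"
  proof (rule lower_gen_dim_ge[OF q, of 1 1])
    fix r :: real assume r: "0 < r" "r < 1"
    have "mesh_sum q (\<nu> a) r \<le> (\<Sum>Q\<in>cubes_meeting a r (space \<mu>). measure \<mu> {x \<in> space \<mu>. \<pi> a x \<in> Q}) powr q"
      using r q cubes_meeting_space(1)[of r a]
      by (subst mesh_sum_eq) (auto intro!: sum_powr_superadditive)
    also have "\<dots> = 1"
      using measure_sum_cubes_meeting[of r "space \<mu>" a] r by (simp add: mu.prob_space)
    finally show "0 < mesh_sum q (\<nu> a) r \<and> mesh_sum q (\<nu> a) r \<le> 1 * r powr (0 * (q - 1))"
      using mesh_sum_pos[of r q a] r q by simp
  qed auto
  then show ?thesis by (simp add: zero_ereal_def)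
qed

section \<open>The upper bound\<close>

lemma lower_gen_dim_le_dim:
  assumes q: "1 < q"
  shows "lower_gen_dim q (\<nu> a) \<le> ereal (real CARD('d))"
proof (rule ccontr)
  assume "\<not> lower_gen_dim q (\<nu> a) \<le> ereal (real CARD('d))"
  then obtain s where s: "real CARD('d) < s" "ereal s < lower_gen_dim q (\<nu> a)"
    using ereal_dense2[of "ereal (real CARD('d))"] by (auto simp: not_le)
  define e where "e = (s - real CARD('d)) * (q - 1)"
  have e: "e > 0" using s q by (simp add: e_def)
  obtain c where c: "c > 0" "\<And>r. 0 < r \<Longrightarrow> r \<le> 1 \<Longrightarrow> c * r powr (real CARD('d) * (q - 1)) \<le> mesh_sum q (\<nu> a) r"
    using mesh_sum_ge[OF q, of a] by auto
  obtain r0 where r0: "0 < r0" "r0 \<le> 1" "\<And>r. 0 < r \<Longrightarrow> r < r0 \<Longrightarrow> mesh_sum q (\<nu> a) r \<le> r powr (s * (q - 1))"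
    using mesh_sum_le_of_lower_gen_dim_gt[OF q s(2) mesh_sum_pos[OF _ _ q]] by blast
  define r where "r = min (r0 / 2) ((c / 2) powr (1 / e))"
  have r: "0 < r" "r < r0" "r \<le> (c / 2) powr (1 / e)" using r0 c by (auto simp: r_def)
  have "c * r powr (real CARD('d) * (q - 1)) \<le> r powr (s * (q - 1))"
    using c(2)[of r] r0(3)[of r] r r0(2) by linarith
  also have "s * (q - 1) = e + real CARD('d) * (q - 1)" by (simp add: e_def algebra_simps)
  also have "r powr (e + real CARD('d) * (q - 1)) = r powr e * r powr (real CARD('d) * (q - 1))"
    by (rule powr_add)
  finally have "c \<le> r powr e" using r by simp
  also have "\<dots> \<le> ((c / 2) powr (1 / e)) powr e" using r e by (intro powr_mono2) auto
  also have "\<dots> = c / 2" using e c by (simp add: powr_powr)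
  finally show False using c by simp
qed

definition cover_const :: "real^'d^'t \<Rightarrow> real" where
  "cover_const a = (norm a / (1 - \<rho>) + 2 * real CARD('d)) ^ CARD('d) *
     (unit_ball_vol (real CARD('d)) * (norm a / (1 - \<rho>) + 2 * real CARD('d)) ^ CARD('d))"

lemma cover_const_pos: "cover_const a > 0"
proof -
  have "norm a / (1 - \<rho>) + 2 * real CARD('d) > 0" using rho by (intro add_nonneg_pos) auto
  then show ?thesis by (simp add: cover_const_def)
qed

lemma card_cubes_meeting_cylinder_le:
  assumes u: "u \<in> words n k" and m: "m \<in> {1..CARD('d)}" and r: "0 < r" "r \<le> 1"
    and cls: "singular_value m (word_matrix T u) \<le> r" "r < 2 * singular_value m (word_matrix T u)"
  shows "real (card (cubes_meeting a r (cylinder n u))) \<le>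
    cover_const a * (\<Prod>i = 1..m - 1. singular_value i (word_matrix T u)) / r ^ (m - 1)"
proof -
  define A where "A = word_matrix T u"
  define \<sigma> where "\<sigma> = (\<lambda>i. singular_value i A)"
  define B where "B = norm a / (1 - \<rho>)"
  define d where "d = real CARD('d)"
  define c where "c = word_map T \<omega> a u 0"
  define D where "D = B + 2 * d"
  have B: "B \<ge> 0" unfolding B_def using rho by simp
  have d: "d \<ge> 1" by (simp add: d_def Suc_le_eq)
  have D: "D \<ge> 1" using B d by (simp add: D_def)
  obtain v :: "nat \<Rightarrow> real^'d" where v: "\<And>i. i \<in> {1..CARD('d)} \<Longrightarrow> norm (v i) = 1"
    "\<And>i. i \<in> {1..CARD('d)} \<Longrightarrow> norm (A *v v i) = singular_value i A"
    "\<And>i j. i \<in> {1..CARD('d)} \<Longrightarrow> j \<in> {1..CARD('d)} \<Longrightarrow> i \<noteq> j \<Longrightarrow> v i \<bullet> v j = 0"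
    "\<And>i x. i \<in> {1..CARD('d)} \<Longrightarrow> (A *v v i) \<bullet> (A *v x) = (singular_value i A)\<^sup>2 * (v i \<bullet> x)"
    "\<And>i j. 1 \<le> i \<Longrightarrow> i \<le> j \<Longrightarrow> j \<le> CARD('d) \<Longrightarrow> singular_value j A \<le> singular_value i A"
    by (rule singular_value_decomposition[of A]) (rule that; assumption)
  have pos: "\<sigma> i > 0" if "i \<in> {1..CARD('d)}" for i
    using word_matrix_singular_value(1)[OF u that] by (simp add: \<sigma>_def A_def)
  define b where "b = (\<lambda>i. (1 / \<sigma> i) *\<^sub>R (A *v v i))"
  have nb: "norm (b i) = 1" if "i \<in> {1..CARD('d)}" for i
    using v(2)[OF that] pos[OF that] by (simp add: b_def \<sigma>_def)
  have bA: "b i \<bullet> (A *v z) = \<sigma> i * (v i \<bullet> z)" if "i \<in> {1..CARD('d)}" for i z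
    using v(4)[OF that, of z] pos[OF that] by (simp add: b_def \<sigma>_def power2_eq_square)
  define h where "h = (\<lambda>i. \<sigma> i * B + d * r)"
  have h: "h i \<ge> 0" if "i \<in> {1..CARD('d)}" for i
    using pos[OF that] B d r by (simp add: h_def)
  define Y where "Y = {y \<in> cball c (B + d). \<forall>i\<in>{1..CARD('d)}. \<bar>b i \<bullet> y - b i \<bullet> c\<bar> \<le> h i}"
  have lin: "linear ((\<bullet>) (b i))" for i by (rule bounded_linear.linear[OF bounded_linear_inner_right])
  have Ym: "Y \<in> sets borel"
    unfolding Y_def using closed_slab_intersection[of "{1..CARD('d)}" "\<lambda>i. (\<bullet>) (b i)"] lin by (simp add: borel_closed)
  have "emeasure lborel Y \<le> ennreal (\<Prod>i\<in>{1..CARD('d)}. h i / 1) *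
      emeasure lborel (cball c (B + d + real (card {1..CARD('d)}) * 1))"
    unfolding Y_def
  proof (rule emeasure_slab_intersection_le)
    show "b i \<bullet> b i = 1" if "i \<in> {1..CARD('d)}" for i
      using nb[OF that] by (simp add: dot_square_norm)
    show "b i \<bullet> b j = 0" if "i \<in> {1..CARD('d)}" "j \<in> {1..CARD('d)}" "i \<noteq> j" for i j
    proof -
      have "b i \<bullet> b j = (1 / \<sigma> j) * (b i \<bullet> (A *v v j))" by (simp add: b_def)
      then show ?thesis using bA[OF that(1), of "v j"] v(3)[OF that] by simp
    qed
  qed (use lin nb h in auto)
  also have "emeasure lborel (cball c (B + d + real (card {1..CARD('d)}) * 1)) =
      ennreal (unit_ball_vol d * D ^ CARD('d))"
    using emeasure_cball[of "B + d + real (card {1..CARD('d)}) * 1" c] B d by (simp add: d_def D_def add.commute)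
  finally have "emeasure lborel Y \<le> ennreal (\<Prod>i\<in>{1..CARD('d)}. h i) * ennreal (unit_ball_vol d * D ^ CARD('d))"
    by simp
  also have "\<dots> = ennreal ((\<Prod>i\<in>{1..CARD('d)}. h i) * (unit_ball_vol d * D ^ CARD('d)))"
    using h D by (intro ennreal_mult[symmetric] prod_nonneg) (auto simp: d_def)
  finally have "emeasure lborel Y \<le> ennreal ((\<Prod>i\<in>{1..CARD('d)}. h i) * (unit_ball_vol d * D ^ CARD('d)))" .
  moreover have "y \<in> Y" if x: "x \<in> \<pi> a ` cylinder n u" and xy: "dist x y \<le> real CARD('d) * r" for x y
  proof -
    obtain w where w: "w \<in> inf_words n" "prefix_of w k = u" "x = \<pi> a w"
      using x length_words[OF u] by (auto simp: cylinder_def)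
    define z where "z = tail_point T \<omega> a w k"
    have z: "norm z \<le> B" unfolding z_def B_def by (rule summable_tail_point(2)[OF w(1)])
    have xc: "x - c = A *v z"
      using word_map_tail_point[OF w(1), of a k] word_map_diff[of T \<omega> a u z 0]
      by (simp add: w \<pi>_def z_def c_def A_def)
    have Az: "norm (A *v z) \<le> B"
    proof -
      have "norm (A *v z) \<le> \<rho> ^ k * norm z" unfolding A_def by (rule word_matrix_norm_le[OF u])
      also have "\<dots> \<le> 1 * norm z" using rho by (intro mult_right_mono power_le_one) auto
      finally show ?thesis using z by simp
    qed
    have dr: "dist x y \<le> d * r" "d * r \<le> d" using xy r d by (simp_all add: d_def mult_left_le)
    have "dist c y \<le> norm (x - c) + dist x y"
      using dist_triangle[of c y x] by (simp add: dist_norm norm_minus_commute)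
    then have "y \<in> cball c (B + d)" using Az xc dr by simp
    moreover have "\<bar>b i \<bullet> y - b i \<bullet> c\<bar> \<le> h i" if i: "i \<in> {1..CARD('d)}" for i
    proof -
      have "b i \<bullet> y - b i \<bullet> c = b i \<bullet> (A *v z) + b i \<bullet> (y - x)"
        unfolding xc[symmetric] by (simp add: inner_diff_right)
      also have "\<bar>\<dots>\<bar> \<le> \<bar>b i \<bullet> (A *v z)\<bar> + \<bar>b i \<bullet> (y - x)\<bar>" by (rule abs_triangle_ineq)
      also have "\<bar>b i \<bullet> (A *v z)\<bar> \<le> \<sigma> i * B"
      proof -
        have "\<bar>v i \<bullet> z\<bar> \<le> B" using Cauchy_Schwarz_ineq2[of "v i" z] v(1)[OF i] z by simp
        then show ?thesis using pos[OF i] by (simp add: bA[OF i] abs_mult)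
      qed
      also have "\<bar>b i \<bullet> (y - x)\<bar> \<le> d * r"
        using Cauchy_Schwarz_ineq2[of "b i" "y - x"] nb[OF i] dr by (simp add: dist_norm norm_minus_commute)
      finally show ?thesis by (simp add: h_def)
    qed
    ultimately show ?thesis by (simp add: Y_def)
  qed
  ultimately have "real (card (cubes_meeting a r (cylinder n u))) \<le>
      (\<Prod>i\<in>{1..CARD('d)}. h i) * (unit_ball_vol d * D ^ CARD('d)) / r ^ CARD('d)"
    unfolding cubes_meeting_def using h D
    by (intro mesh_cubes_meeting(2)[OF r(1) Ym]) (auto intro!: mult_nonneg_nonneg prod_nonneg simp: d_def)
  also have "\<dots> \<le> (D ^ CARD('d) * (\<Prod>i = 1..m - 1. \<sigma> i) * r ^ (CARD('d) - (m - 1))) *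
      (unit_ball_vol d * D ^ CARD('d)) / r ^ CARD('d)"
  proof (intro divide_right_mono mult_right_mono)
    have split: "{1..CARD('d)} = {1..m - 1} \<union> {m..CARD('d)}" "{1..m - 1} \<inter> {m..CARD('d)} = {}"
      using m by auto
    have "(\<Prod>i\<in>{1..CARD('d)}. h i) = (\<Prod>i = 1..m - 1. h i) * (\<Prod>i = m..CARD('d). h i)"
      unfolding split(1) by (rule prod.union_disjoint) (use split(2) in auto)
    also have "\<dots> \<le> (\<Prod>i = 1..m - 1. D * \<sigma> i) * (\<Prod>i = m..CARD('d). D * r)"
    proof (intro mult_mono prod_mono conjI)
      fix i assume i: "i \<in> {1..m - 1}"
      then have i': "i \<in> {1..CARD('d)}" using m by auto
      show "h i \<ge> 0" by (rule h[OF i'])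
      have "\<sigma> m \<le> \<sigma> i" using v(5)[of i m] i m by (auto simp: \<sigma>_def)
      then have "r \<le> 2 * \<sigma> i" using cls by (simp add: \<sigma>_def A_def)
      then have "d * r \<le> d * (2 * \<sigma> i)" using d by (intro mult_left_mono) auto
      then show "h i \<le> D * \<sigma> i" by (simp add: h_def D_def algebra_simps)
    next
      fix i assume i: "i \<in> {m..CARD('d)}"
      then have i': "i \<in> {1..CARD('d)}" using m by auto
      show "h i \<ge> 0" by (rule h[OF i'])
      have "\<sigma> i \<le> \<sigma> m" using v(5)[of m i] i m by (auto simp: \<sigma>_def)
      then have "\<sigma> i \<le> r" using cls by (simp add: \<sigma>_def A_def)
      then have "\<sigma> i * B \<le> r * B" using B by (rule mult_right_mono)
      moreover have "0 \<le> d * r" using d r by simp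
      ultimately show "h i \<le> D * r" by (simp add: h_def D_def algebra_simps)
    next
      show "0 \<le> (\<Prod>i = 1..m - 1. D * \<sigma> i)"
        using D pos m by (intro prod_nonneg) (auto intro!: mult_nonneg_nonneg less_imp_le)
      show "0 \<le> (\<Prod>i = m..CARD('d). h i)" using h m by (intro prod_nonneg) auto
    qed
    also have "\<dots> = D ^ (m - 1) * D ^ (CARD('d) - (m - 1)) * (\<Prod>i = 1..m - 1. \<sigma> i) * r ^ (CARD('d) - (m - 1))"
    proof -
      have "card {m..CARD('d)} = CARD('d) - (m - 1)" "card {1..m - 1} = m - 1" using m by auto
      then show ?thesis by (simp only: prod.distrib power_mult_distrib prod_constant mult_ac)
    qed
    also have "D ^ (m - 1) * D ^ (CARD('d) - (m - 1)) = D ^ CARD('d)"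
    proof -
      have "m - 1 + (CARD('d) - (m - 1)) = CARD('d)" using m by auto
      then show ?thesis by (simp only: power_add[symmetric])
    qed
    finally show "(\<Prod>i\<in>{1..CARD('d)}. h i) \<le> D ^ CARD('d) * (\<Prod>i = 1..m - 1. \<sigma> i) * r ^ (CARD('d) - (m - 1))" .
  qed (use D r in \<open>auto simp: d_def\<close>)
  also have "\<dots> = cover_const a * (\<Prod>i = 1..m - 1. \<sigma> i) / r ^ (m - 1)"
  proof -
    have "m - 1 + (CARD('d) - (m - 1)) = CARD('d)" using m by auto
    then have "r ^ CARD('d) = r ^ (m - 1) * r ^ (CARD('d) - (m - 1))" by (metis power_add)
    then show ?thesis using r by (simp add: cover_const_def D_def B_def d_def)
  qed
  finally show ?thesis by (simp add: \<sigma>_def A_def)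
qed

lemma word_term_le:
  assumes u: "u \<in> words n k" and s: "0 < s" "s \<le> real CARD('d)" and m: "m = nat \<lceil>s\<rceil>"
    and r: "0 < r" "r \<le> 1" and q: "q > 1"
    and cls: "singular_value m (word_matrix T u) \<le> r" "r < 2 * singular_value m (word_matrix T u)"
  shows "sv_fun s (word_matrix T u) powr (1 - q) * measure \<mu> (cylinder n u) powr q \<le>
    (2 * cover_const a) powr (q - 1) * r powr (- (s * (q - 1))) *
    (\<Sum>Q\<in>cubes_meeting a r (cylinder n u). measure \<mu> {x \<in> cylinder n u. \<pi> a x \<in> Q} powr q)"
proof -
  define e where "e = q - 1"
  have e: "e > 0" using q by (simp add: e_def)
  define \<theta> where "\<theta> = s - real m + 1"
  have m1: "m \<in> {1..CARD('d)}" and \<theta>: "0 < \<theta>" "\<theta> \<le> 1"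
    using nat_ceiling_bounds[OF s] by (auto simp: m \<theta>_def)
  define P where "P = (\<Prod>i = 1..m - 1. singular_value i (word_matrix T u))"
  define \<sigma> where "\<sigma> = singular_value m (word_matrix T u)"
  have \<sigma>: "\<sigma> > 0" unfolding \<sigma>_def by (rule word_matrix_singular_value(1)[OF u m1])
  have P: "P > 0" unfolding P_def using m1 by (intro prod_pos) (auto intro!: word_matrix_singular_value(1)[OF u])
  define C where "C = cover_const a"
  have C: "C > 0" unfolding C_def by (rule cover_const_pos)
  define N where "N = real (card (cubes_meeting a r (cylinder n u)))"
  define S where "S = (\<Sum>Q\<in>cubes_meeting a r (cylinder n u). measure \<mu> {x \<in> cylinder n u. \<pi> a x \<in> Q} powr q)"
  have S: "S \<ge> 0" by (simp add: S_def sum_nonneg)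
  have "sv_fun s (word_matrix T u) powr (1 - q) = P powr (- e) * \<sigma> powr (- (\<theta> * e))"
    unfolding sv_fun_eq[OF s m] P_def[symmetric] \<sigma>_def[symmetric] \<theta>_def[symmetric]
    using P by (simp add: powr_mult powr_powr e_def algebra_simps)
  also have "\<dots> \<le> P powr (- e) * (2 powr e * r powr (- (\<theta> * e)))"
  proof (intro mult_left_mono)
    have "\<sigma> powr (- (\<theta> * e)) \<le> (r / 2) powr (- (\<theta> * e))"
      using cls r \<theta> e by (intro powr_mono2') (auto simp: \<sigma>_def)
    also have "\<dots> = 2 powr (\<theta> * e) * r powr (- (\<theta> * e))"
      using r by (simp add: powr_divide powr_minus_divide)
    also have "\<dots> \<le> 2 powr e * r powr (- (\<theta> * e))"
      using \<theta> e by (intro mult_right_mono powr_mono) auto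
    finally show "\<sigma> powr (- (\<theta> * e)) \<le> 2 powr e * r powr (- (\<theta> * e))" .
  qed simp
  finally have 1: "sv_fun s (word_matrix T u) powr (1 - q) \<le> P powr (- e) * (2 powr e * r powr (- (\<theta> * e)))" .
  have "measure \<mu> (cylinder n u) powr q \<le> N powr e * S"
    unfolding N_def S_def e_def using powr_measure_le_cubes_meeting[OF r sets_cylinder, of q u a] q by simp
  also have "\<dots> \<le> (C * P * r powr (- (real m - 1))) powr e * S"
  proof (intro mult_right_mono powr_mono2 S)
    have "N \<le> C * P / r ^ (m - 1)"
      unfolding N_def C_def P_def by (rule card_cubes_meeting_cylinder_le[OF u m1 r cls])
    also have "r ^ (m - 1) = r powr (real m - 1)"
      using r m1 by (simp add: powr_realpow[symmetric] of_nat_diff)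
    also have "C * P / r powr (real m - 1) = C * P * r powr (- (real m - 1))"
      unfolding powr_minus_divide by simp
    finally show "N \<le> C * P * r powr (- (real m - 1))" .
  qed (use e in \<open>auto simp: N_def\<close>)
  also have "(C * P * r powr (- (real m - 1))) powr e = C powr e * P powr e * r powr (- ((real m - 1) * e))"
    using C P r by (simp add: powr_mult powr_powr algebra_simps)
  finally have 2: "measure \<mu> (cylinder n u) powr q \<le> C powr e * P powr e * r powr (- ((real m - 1) * e)) * S" .
  have "sv_fun s (word_matrix T u) powr (1 - q) * measure \<mu> (cylinder n u) powr q \<le>
      (P powr (- e) * (2 powr e * r powr (- (\<theta> * e)))) * (C powr e * P powr e * r powr (- ((real m - 1) * e)) * S)"
    by (intro mult_mono 1 2) auto
  also have "\<dots> = (2 powr e * C powr e) * (P powr (- e) * P powr e) *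
      (r powr (- (\<theta> * e)) * r powr (- ((real m - 1) * e))) * S"
    by (simp only: mult_ac)
  also have "2 powr e * C powr e = (2 * C) powr e" using C by (simp add: powr_mult)
  also have "P powr (- e) * P powr e = 1" using P by (simp add: powr_add[symmetric])
  also have "r powr (- (\<theta> * e)) * r powr (- ((real m - 1) * e)) = r powr (- (s * e))"
    by (simp add: powr_add[symmetric] \<theta>_def algebra_simps)
  finally show ?thesis by (simp add: e_def C_def S_def)
qed

lemma level_class_sum_le:
  assumes W: "W \<subseteq> words n k" and s: "0 < s" "s \<le> real CARD('d)" and m: "m = nat \<lceil>s\<rceil>"
    and r: "0 < r" "r \<le> 1" and q: "q > 1"
    and cls: "\<And>u. u \<in> W \<Longrightarrow> singular_value m (word_matrix T u) \<le> r \<and> r < 2 * singular_value m (word_matrix T u)"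
  shows "(\<Sum>u\<in>W. sv_fun s (word_matrix T u) powr (1 - q) * measure \<mu> (cylinder n u) powr q) \<le>
    (2 * cover_const a) powr (q - 1) * r powr (- (s * (q - 1))) * mesh_sum q (\<nu> a) r"
proof -
  define F where "F = cubes_meeting a r (space \<mu>)"
  define g where "g = (\<lambda>u Q. measure \<mu> {x \<in> cylinder n u. \<pi> a x \<in> Q})"
  have F: "finite F" "F \<subseteq> mesh_cubes r"
    using cubes_meeting_space(1)[OF r] by (auto simp: F_def cubes_meeting_def)
  have fW: "finite W" using W finite_words by (rule finite_subset)
  have "(\<Sum>u\<in>W. \<Sum>Q\<in>cubes_meeting a r (cylinder n u). g u Q powr q) \<le> (\<Sum>u\<in>W. \<Sum>Q\<in>F. g u Q powr q)"
    by (intro sum_mono sum_mono2 F) (auto simp: F_def cubes_meeting_def cylinder_def space_mu)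
  also have "\<dots> = (\<Sum>Q\<in>F. \<Sum>u\<in>W. g u Q powr q)" by (rule sum.swap)
  also have "\<dots> \<le> (\<Sum>Q\<in>F. (\<Sum>u\<in>W. g u Q) powr q)"
    using q fW by (intro sum_mono sum_powr_superadditive) (auto simp: g_def)
  also have "\<dots> \<le> (\<Sum>Q\<in>F. measure \<mu> {x \<in> space \<mu>. \<pi> a x \<in> Q} powr q)"
  proof (intro sum_mono powr_mono2)
    fix Q assume "Q \<in> F"
    then have Q: "Q \<in> mesh_cubes r" using F by auto
    have "(\<Sum>u\<in>W. g u Q) = measure \<mu> (\<Union>u\<in>W. {x \<in> cylinder n u. \<pi> a x \<in> Q})"
      unfolding g_def
    proof (rule mu.finite_measure_finite_Union[symmetric, OF fW])
      show "(\<lambda>u. {x \<in> cylinder n u. \<pi> a x \<in> Q}) ` W \<subseteq> sets \<mu>"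
        using sets_preimage_mesh_cube[OF Q sets_cylinder] by auto
      show "disjoint_family_on (\<lambda>u. {x \<in> cylinder n u. \<pi> a x \<in> Q}) W"
        using W by (auto simp: disjoint_family_on_def cylinder_def dest!: subsetD[OF W] length_words)
    qed
    also have "\<dots> \<le> measure \<mu> {x \<in> space \<mu>. \<pi> a x \<in> Q}"
      using sets_preimage_mesh_cube[OF Q sets.top]
      by (intro mu.finite_measure_mono) (auto simp: cylinder_def space_mu)
    finally show "(\<Sum>u\<in>W. g u Q) \<le> measure \<mu> {x \<in> space \<mu>. \<pi> a x \<in> Q}" .
  qed (use q in \<open>auto simp: g_def sum_nonneg\<close>)
  also have "\<dots> = mesh_sum q (\<nu> a) r" by (simp add: mesh_sum_eq[OF r] F_def)
  finally have *: "(\<Sum>u\<in>W. \<Sum>Q\<in>cubes_meeting a r (cylinder n u). g u Q powr q) \<le> mesh_sum q (\<nu> a) r" .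
  have "(\<Sum>u\<in>W. sv_fun s (word_matrix T u) powr (1 - q) * measure \<mu> (cylinder n u) powr q) \<le>
      (\<Sum>u\<in>W. (2 * cover_const a) powr (q - 1) * r powr (- (s * (q - 1))) *
        (\<Sum>Q\<in>cubes_meeting a r (cylinder n u). g u Q powr q))"
    unfolding g_def by (intro sum_mono word_term_le[OF _ s m r q]) (use W cls in auto)
  also have "\<dots> \<le> (2 * cover_const a) powr (q - 1) * r powr (- (s * (q - 1))) * mesh_sum q (\<nu> a) r"
    using * by (simp add: sum_distrib_left[symmetric] mult_left_mono)
  finally show ?thesis .
qed

lemma lower_gen_dim_le_of_not_summable:
  assumes s: "0 < s" "s \<le> real CARD('d)" and q: "1 < q" and ns: "\<not> summable (level_sum s q)"
  shows "lower_gen_dim q (\<nu> a) \<le> ereal s"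
proof (rule ccontr)
  assume "\<not> lower_gen_dim q (\<nu> a) \<le> ereal s"
  then obtain t where t: "s < t" "ereal t < lower_gen_dim q (\<nu> a)"
    using ereal_dense2[of "ereal s"] by (auto simp: not_le)
  obtain r0 where r0: "0 < r0" "r0 \<le> 1" "\<And>r. 0 < r \<Longrightarrow> r < r0 \<Longrightarrow> mesh_sum q (\<nu> a) r \<le> r powr (t * (q - 1))"
    using mesh_sum_le_of_lower_gen_dim_gt[OF q t(2) mesh_sum_pos[OF _ _ q]] by blast
  obtain k0 :: nat where k0: "(1 / 2) ^ k0 < r0" using real_arch_pow_inv[of r0 "1 / 2"] r0 by auto
  define m where "m = nat \<lceil>s\<rceil>"
  have m: "m \<in> {1..CARD('d)}" using nat_ceiling_bounds(1)[OF s] by (simp add: m_def)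
  define C where "C = (2 * cover_const a) powr (q - 1)"
  define y where "y = (1 / 2 :: real) powr ((t - s) * (q - 1) / 2)"
  have y: "0 < y" "y < 1"
    using t q powr_less_mono2[of "(t - s) * (q - 1) / 2" "1 / 2" 1] by (auto simp: y_def)
  define f where "f = (\<lambda>u. sv_fun s (word_matrix T u) powr (1 - q) * measure \<mu> (cylinder n u) powr q)"
  have bound: "level_sum s q k \<le> C / (1 - y) * y ^ k" if k: "k \<ge> k0" for k
  proof -
    have "\<exists>j. singular_value m (word_matrix T u) \<le> (1 / 2) ^ j \<and>
        (1 / 2) ^ j < 2 * singular_value m (word_matrix T u) \<and> k \<le> j" if u: "u \<in> words n k" for u
    proof -
      note sv = word_matrix_singular_value[OF u m]
      obtain j where j: "(1 / 2) ^ (Suc j) < singular_value m (word_matrix T u)"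
        "singular_value m (word_matrix T u) \<le> (1 / 2) ^ j"
        using dyadic_scale[OF sv(1,3)] by blast
      have "\<rho> ^ k \<le> (1 / 2) ^ k" using rho by (intro power_mono) auto
      then have "(1 / 2 :: real) ^ Suc j < (1 / 2) ^ k" using j(1) sv(2) by linarith
      then have "k < Suc j" by (simp only: power_strict_decreasing_iff)
      then show ?thesis using j by (intro exI[of _ j]) auto
    qed
    then obtain cl where cl: "\<And>u. u \<in> words n k \<Longrightarrow> singular_value m (word_matrix T u) \<le> (1 / 2) ^ cl u \<and>
        (1 / 2) ^ cl u < 2 * singular_value m (word_matrix T u) \<and> k \<le> cl u"
      by metis
    have class_le: "(\<Sum>u | u \<in> words n k \<and> cl u = j. f u) \<le> C * (y ^ k * y ^ j)" if j: "j \<in> cl ` words n k" for j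
    proof -
      have kj: "k \<le> j" using j cl by auto
      define r where "r = (1 / 2 :: real) ^ j"
      have r: "0 < r" "r \<le> 1" by (simp_all add: r_def power_le_one)
      have "r \<le> (1 / 2) ^ k0" unfolding r_def using k kj by (intro power_decreasing) auto
      then have rr0: "r < r0" using k0 by simp
      have "(\<Sum>u | u \<in> words n k \<and> cl u = j. f u) \<le> C * r powr (- (s * (q - 1))) * mesh_sum q (\<nu> a) r"
        unfolding f_def C_def
        by (rule level_class_sum_le[OF _ s m_def r q]) (use cl in \<open>auto simp: r_def\<close>)
      also have "\<dots> \<le> C * r powr (- (s * (q - 1))) * r powr (t * (q - 1))"
        using r0(3)[OF r(1) rr0] by (intro mult_left_mono) (auto simp: C_def)
      also have "\<dots> = C * r powr ((t - s) * (q - 1))"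
        by (simp add: mult.assoc powr_add[symmetric] algebra_simps)
      also have "r powr ((t - s) * (q - 1)) = y ^ j * y ^ j"
      proof -
        have "y ^ j * y ^ j = (y * y) ^ j" by (simp add: power_mult_distrib)
        also have "y * y = (1 / 2) powr ((t - s) * (q - 1))" by (simp add: y_def powr_add[symmetric] mult.commute)
        also have "\<dots> ^ j = r powr ((t - s) * (q - 1))"
          by (simp add: r_def powr_realpow[symmetric] powr_powr mult.commute)
        finally show ?thesis ..
      qed
      also have "C * (y ^ j * y ^ j) \<le> C * (y ^ k * y ^ j)"
        using kj y by (intro mult_left_mono mult_right_mono power_decreasing) (auto simp: C_def)
      finally show ?thesis .
    qed
    have "level_sum s q k = (\<Sum>u\<in>words n k. f u)" by (simp add: level_sum_def f_def)
    also have "\<dots> = (\<Sum>j\<in>cl ` words n k. \<Sum>u | u \<in> words n k \<and> cl u = j. f u)"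
      by (rule sum.image_gen[OF finite_words])
    also have "\<dots> \<le> (\<Sum>j\<in>cl ` words n k. C * (y ^ k * y ^ j))"
      by (intro sum_mono class_le)
    also have "\<dots> = C * y ^ k * (\<Sum>j\<in>cl ` words n k. y ^ j)"
      by (simp add: sum_distrib_left mult.assoc)
    also have "\<dots> \<le> C * y ^ k * (1 / (1 - y))"
    proof (rule mult_left_mono)
      have "(\<Sum>j\<in>cl ` words n k. y ^ j) \<le> (\<Sum>j. y ^ j)"
        using y finite_words by (intro sum_le_suminf summable_geometric) auto
      also have "\<dots> = 1 / (1 - y)" using y by (intro suminf_geometric) auto
      finally show "(\<Sum>j\<in>cl ` words n k. y ^ j) \<le> 1 / (1 - y)" .
    qed (use y in \<open>auto simp: C_def\<close>)
    finally show ?thesis by simp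
  qed
  have "summable (level_sum s q)"
    by (rule summable_comparison_test'[of "\<lambda>k. C / (1 - y) * y ^ k" k0])
      (use y bound level_sum_nonneg in \<open>auto intro!: summable_mult summable_geometric\<close>)
  with ns show False by simp
qed

lemma crit_set_eq: "crit_set n T \<mu> q = {s. 0 < s \<and> summable (level_sum s q)}"
proof -
  have "level_sum s q summable_on {1..} \<longleftrightarrow> summable (level_sum s q)" for s
  proof -
    have "summable (level_sum s q) \<longleftrightarrow> level_sum s q summable_on UNIV"
      by (rule summable_on_UNIV_nonneg_real_iff[symmetric, OF level_sum_nonneg])
    also have "(UNIV :: nat set) = insert 0 {1..}" by (auto simp: Suc_le_eq)
    also have "level_sum s q summable_on insert 0 {1..} \<longleftrightarrow> level_sum s q summable_on {1..}"
      by (rule summable_on_insert_iff)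
    finally show ?thesis ..
  qed
  then show ?thesis unfolding crit_set_def level_sum_def[abs_def] by simp
qed

lemma summable_level_sum_dim:
  assumes s: "real CARD('d) < s" and q: "1 < q" and sm: "summable (level_sum s q)"
  shows "summable (level_sum (real CARD('d)) q)"
proof (rule summable_comparison_test'[OF sm, of 0])
  fix k
  have "level_sum (real CARD('d)) q k \<le> level_sum s q k"
    unfolding level_sum_def
  proof (intro sum_mono mult_right_mono powr_mono2')
    fix u assume u: "u \<in> words n k"
    have sv: "0 < singular_value i (word_matrix T u) \<and> singular_value i (word_matrix T u) \<le> 1"
      if "i \<in> {1..CARD('d)}" for i
      using word_matrix_singular_value[OF u that] by simp
    show "0 < sv_fun s (word_matrix T u)" by (rule sv_fun_beyond_dim_le(1)[OF s sv])
    show "sv_fun s (word_matrix T u) \<le> sv_fun (real CARD('d)) (word_matrix T u)"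
      by (rule sv_fun_beyond_dim_le(2)[OF s sv])
  qed (use q in auto)
  then show "norm (level_sum (real CARD('d)) q k) \<le> level_sum s q k"
    using level_sum_nonneg by simp
qed

lemma lower_gen_dim_le_crit_exp:
  assumes q: "1 < q"
  shows "lower_gen_dim q (\<nu> a) \<le> min (crit_exp n T \<mu> q) (ereal (real CARD('d)))"
proof (rule min.boundedI)
  show le_dim: "lower_gen_dim q (\<nu> a) \<le> ereal (real CARD('d))" by (rule lower_gen_dim_le_dim[OF q])
  show "lower_gen_dim q (\<nu> a) \<le> crit_exp n T \<mu> q"
  proof (rule ccontr)
    assume "\<not> lower_gen_dim q (\<nu> a) \<le> crit_exp n T \<mu> q"
    then obtain s where s: "crit_exp n T \<mu> q < ereal s" "ereal s < lower_gen_dim q (\<nu> a)"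
      using ereal_dense2[of "crit_exp n T \<mu> q"] by (auto simp: not_le)
    have "0 \<le> crit_exp n T \<mu> q"
    proof (cases "crit_set n T \<mu> q = {}")
      case False
      then obtain x where x: "x \<in> crit_set n T \<mu> q" by blast
      then have "0 \<le> ereal x" by (simp add: crit_set_def)
      also have "\<dots> \<le> (SUP s\<in>crit_set n T \<mu> q. ereal s)" using x by (rule SUP_upper)
      finally show ?thesis using False by (simp add: crit_exp_def)
    qed (simp add: crit_exp_def)
    then have "0 < s" using s(1) by (metis ereal_less(2) order_le_less_trans)
    moreover have "s \<le> real CARD('d)" using s(2) le_dim by (metis ereal_less_eq(3) less_imp_le order_trans)
    moreover have "s \<notin> crit_set n T \<mu> q"
    proof
      assume x: "s \<in> crit_set n T \<mu> q"
      then have "ereal s \<le> (SUP s\<in>crit_set n T \<mu> q. ereal s)" by (rule SUP_upper)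
      with x s(1) show False by (auto simp: crit_exp_def split: if_splits)
    qed
    ultimately have "lower_gen_dim q (\<nu> a) \<le> ereal s"
      using crit_set_eq by (intro lower_gen_dim_le_of_not_summable q) auto
    with s(2) show False by simp
  qed
qed

lemma AE_crit_exp_le_lower_gen_dim:
  assumes q: "1 < q" "q \<le> 2"
  shows "AE a in lborel. min (crit_exp n T \<mu> q) (ereal (real CARD('d))) \<le> lower_gen_dim q (\<nu> a)"
proof -
  have *: "AE a in lborel. ereal t \<le> lower_gen_dim q (\<nu> a)"
    if t: "0 \<le> t" "ereal t < min (crit_exp n T \<mu> q) (ereal (real CARD('d)))" for t
  proof -
    have "ereal t < crit_exp n T \<mu> q" using t by simp
    then have "crit_set n T \<mu> q \<noteq> {}" "ereal t < (SUP s\<in>crit_set n T \<mu> q. ereal s)"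
      using t(1) by (auto simp: crit_exp_def split: if_splits)
    then obtain s where s: "s \<in> crit_set n T \<mu> q" "t < s" by (auto simp: less_SUP_iff)
    then have sm: "0 < s" "summable (level_sum s q)" by (auto simp: crit_set_eq)
    show ?thesis
    proof (cases "s \<le> real CARD('d)")
      case True
      then show ?thesis by (intro AE_lower_gen_dim_ge[OF sm(1) _ q t(1) s(2) sm(2)])
    next
      case False
      then show ?thesis
        using t(2) summable_level_sum_dim[OF _ q(1) sm(2)] by (intro AE_lower_gen_dim_ge[OF _ _ q t(1)]) auto
    qed
  qed
  have "AE a in lborel. \<forall>t::rat. 0 \<le> real_of_rat t \<and>
      ereal (real_of_rat t) < min (crit_exp n T \<mu> q) (ereal (real CARD('d))) \<longrightarrow>
      ereal (real_of_rat t) \<le> lower_gen_dim q (\<nu> a)"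
    unfolding AE_all_countable by (intro allI AE_impI, elim conjE) (rule *)
  then show ?thesis
  proof eventually_elim
    fix a
    assume *: "\<forall>t::rat. 0 \<le> real_of_rat t \<and>
      ereal (real_of_rat t) < min (crit_exp n T \<mu> q) (ereal (real CARD('d))) \<longrightarrow>
      ereal (real_of_rat t) \<le> lower_gen_dim q (\<nu> a)"
    show "min (crit_exp n T \<mu> q) (ereal (real CARD('d))) \<le> lower_gen_dim q (\<nu> a)"
    proof (rule ccontr)
      assume "\<not> min (crit_exp n T \<mu> q) (ereal (real CARD('d))) \<le> lower_gen_dim q (\<nu> a)"
      then obtain x where x: "lower_gen_dim q (\<nu> a) < ereal x" "ereal x < min (crit_exp n T \<mu> q) (ereal (real CARD('d)))"
        unfolding not_le using ereal_dense2 by blast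
      obtain y where y: "ereal x < ereal y" "ereal y < min (crit_exp n T \<mu> q) (ereal (real CARD('d)))"
        using ereal_dense2[OF x(2)] by auto
      obtain t where t: "x < real_of_rat t" "real_of_rat t < y" using of_rat_dense[of x y] y by auto
      have "0 < x" using x(1) lower_gen_dim_nonneg[OF q(1), of a] by (metis ereal_less(2) order_le_less_trans)
      moreover have "ereal (real_of_rat t) < min (crit_exp n T \<mu> q) (ereal (real CARD('d)))"
        using t(2) y(2) by (metis ereal_less_eq(3) less_imp_le order_le_less_trans)
      ultimately have "ereal (real_of_rat t) \<le> lower_gen_dim q (\<nu> a)"
        using t(1) by (intro *[rule_format] conjI) linarith
      moreover have "lower_gen_dim q (\<nu> a) < ereal (real_of_rat t)"
        using x(1) t(1) by (metis ereal_less_eq(3) less_imp_le order_less_le_trans)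
      ultimately show False by simp
    qed
  qed
qed

lemma nonaut_affine_measure_eq:
  assumes "nonaut_affine n T \<omega> a J"
  shows "nonaut_affine_measure n T \<omega> a J p = \<nu> a"
  unfolding nonaut_affine_measure_def \<nu>_def
  by (rule distr_cong) (simp_all add: coding_map_eq_tail_point[OF assms] \<pi>_def space_mu)

end

theorem theorem2p12:
  fixes n :: "nat \<Rightarrow> nat"
    and T :: "nat \<Rightarrow> nat \<Rightarrow> real^'d^'d"
    and \<omega> :: "nat list \<Rightarrow> 't::finite"
    and J :: "real^'d^'t \<Rightarrow> (real^'d) set"
    and p :: "nat \<Rightarrow> nat \<Rightarrow> real"
    and q :: real
  assumes "\<forall>k\<ge>1. 2 \<le> n k"
    and "\<forall>k\<ge>1. \<forall>j\<in>{1..n k}. invertible (T k j)"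
    and "(INF (k, j)\<in>(SIGMA k:{1..}. {1..n k}). ereal (singular_value CARD('d) (T k j))) > 0"
    and "distinct_siblings n \<omega>"
    and "\<forall>a. nonaut_affine n T \<omega> a (J a)"
    and "prob_vectors n p"
    and "(SUP (k, j)\<in>(SIGMA k:{1..}. {1..n k}). ereal (onorm ((*v) (T k j)))) < ereal (1 / 2)"
    and "1 < q" and "q \<le> 2"
  shows "AE a in lebesgue.
           lower_gen_dim q (nonaut_affine_measure n T \<omega> a (J a) p) =
           min (crit_exp n T (bernoulli_measure n p) q) (ereal (real CARD('d)))"
proof -
  obtain \<rho> where \<rho>: "(SUP (k, j)\<in>(SIGMA k:{1..}. {1..n k}). ereal (onorm ((*v) (T k j)))) < ereal \<rho>"
    "ereal \<rho> < ereal (1 / 2)"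
    using ereal_dense2[OF assms(7)] by blast
  have onorm_less: "onorm ((*v) (T k j)) < \<rho>" if "1 \<le> k" "j \<in> {1..n k}" for k j
  proof -
    have "ereal (onorm ((*v) (T k j))) \<le> (SUP (k, j)\<in>(SIGMA k:{1..}. {1..n k}). ereal (onorm ((*v) (T k j))))"
      using SUP_upper[of "(k, j)" "SIGMA k:{1..}. {1..n k}" "\<lambda>(k, j). ereal (onorm ((*v) (T k j)))"] that by simp
    from order_le_less_trans[OF this \<rho>(1)] show ?thesis by simp
  qed
  interpret contracting_system n T \<omega> p \<rho>
  proof
    fix k j assume kj: "1 \<le> k" "j \<in> {1..n k}"
    then show "invertible (T k j)" using assms(2) by blast
    fix x
    have "norm (T k j *v x) \<le> onorm ((*v) (T k j)) * norm x"
      by (rule onorm[OF matrix_vector_mul_bounded_linear])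
    also have "\<dots> \<le> \<rho> * norm x" using onorm_less[OF kj] by (intro mult_right_mono) auto
    finally show "norm (T k j *v x) \<le> \<rho> * norm x" .
  next
    have "2 \<le> n 1" using assms(1) by blast
    then have "onorm ((*v) (T 1 1)) < \<rho>" by (intro onorm_less) auto
    then show "0 < \<rho>" using onorm_pos_le[OF matrix_vector_mul_bounded_linear, of "T 1 1"] by simp
  qed (use assms \<rho> in auto)
  have "AE a in lborel. lower_gen_dim q (\<nu> a) = min (crit_exp n T (bernoulli_measure n p) q) (ereal (real CARD('d)))"
    using AE_crit_exp_le_lower_gen_dim[OF assms(8,9)]
    by eventually_elim (intro antisym lower_gen_dim_le_crit_exp assms(8))
  then have "AE a in lebesgue. lower_gen_dim q (\<nu> a) = min (crit_exp n T (bernoulli_measure n p) q) (ereal (real CARD('d)))"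
    by (rule AE_completion)
  then show ?thesis by (simp only: nonaut_affine_measure_eq[OF assms(5)[rule_format]])
qed

end
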